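(* Let $q$ be a power of a prime $p$, let $n>1$, let $K=\mathbb{F}_{q^n}$ and $F=K(x)$ the rational function field. Let $E=F(y)$, where $y$ satisfies the equation $$y^{q^{n-1}}+y^{q^{n-2}}+\cdots+y=\frac{h(x)}{g(x)},$$ where $h(x),g(x)\in F_{qs}^{\phi}$, $\frac{h(x)}{g(x)}$ is not the image of a rational function in $F$ under a linear polynomial, $\deg(g(x))>\deg(h(x))$, and $g(x)$ has no zeros in $\mathbb{F}_{q^n}$. Then all the rational places of $F$ split completely in $E$. Thus $N(E)=q^{n-1}(q^n+1)$, and $N(E)/[E:F]$ attains its maximum possible value of $q^n+1$.
   Context: A rational place is a place of degree one, and $N(E)$ is the number of places of degree one of $E$. A rational function $\mathbf{f}(X)\in K(x_1,\dots,x_n)$ is quasi-symmetric if it is fixed by the cyclic permutation $\varepsilon=(1\;2\;\cdots\;n)$ of the variables. An $(n,q)$-quasi-symmetric function is a function of the form $f(x)=\mathbf{f}(x,x^q,\dots,x^{q^{n-1}})$ with $\mathbf{f}$ quasi-symmetric. $F_{qs}^{\phi}$ denotes the field of $(n,q)$-quasi-symmetric rational functions in $F$ whose coefficients are from $\mathbb{F}_q$. The degree of a rational function is the degree of its numerator minus the degree of its denominator. A linear polynomial is an $\mathbb{F}_p$-linear (additive) polynomial $L(T)=\sum_i a_iT^{p^i}$ with $a_i\in K$, here of degree greater than $1$.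
   Formalization: It is additionally assumed that h and g come from quasi-symmetric functions that are defined (nonzero denominator) at every point (a, a^q, ..., a^(q^(n-1))) with a in F_(q^n); otherwise the claim fails, e.g. h = 1/x^3, g = 1, q = n = 2, where x = 0 ramifies. *)

theory Defs
  imports
    Complex_Main
    "HOL-Library.Cardinality"
    "HOL-Library.Poly_Mapping"
    "HOL-Computational_Algebra.Polynomial"
    "HOL-Computational_Algebra.Primes"
    "HOL-Computational_Algebra.Fraction_Field"
begin

section \<open>The rational function field \<open>K(x)\<close>\<close>

type_synonym 'k ratfun = "'k poly fract"

definition ratfun_const :: "'k::field \<Rightarrow> 'k ratfun" where
  "ratfun_const c = Fract [:c:] 1"

definition ratfun_var :: "'k::field ratfun" where
  "ratfun_var = Fract [:0, 1:] 1"

text \<open>Degree of numerator minus degree of denominator. This does not depend on the chosen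
  numerator and denominator; the value at \<open>0\<close> is a convention.\<close>

definition ratfun_degree :: "'k::field ratfun \<Rightarrow> int" where
  "ratfun_degree f =
    (if f = 0 then 0
     else (THE d. \<exists>a b. a \<noteq> 0 \<and> b \<noteq> 0 \<and> f = Fract a b \<and> d = int (degree a) - int (degree b)))"

definition has_zero_at :: "'k::field ratfun \<Rightarrow> 'k \<Rightarrow> bool" where
  "has_zero_at f \<alpha> \<longleftrightarrow> (\<exists>a b. f = Fract a b \<and> poly b \<alpha> \<noteq> 0 \<and> poly a \<alpha> = 0)"

text \<open>The subfield \<open>\<bbbF>\<^sub>q\<close> of \<open>K = \<bbbF>\<^bsub>q^n\<^esub>\<close> is \<open>{c. c ^ q = c}\<close>.\<close>

definition Fq :: "nat \<Rightarrow> 'k::field set" where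
  "Fq q = {c. c ^ q = c}"

definition coeffs_in_Fq :: "nat \<Rightarrow> 'k::field ratfun \<Rightarrow> bool" where
  "coeffs_in_Fq q f \<longleftrightarrow>
    (\<exists>a b. b \<noteq> 0 \<and> f = Fract a b \<and> (\<forall>i. coeff a i \<in> Fq q) \<and> (\<forall>i. coeff b i \<in> Fq q))"

definition linear_poly :: "nat \<Rightarrow> 'k::field poly \<Rightarrow> bool" where
  "linear_poly p L \<longleftrightarrow> (\<exists>a m. L = (\<Sum>i\<le>m. monom (a i) (p ^ i)))"

section \<open>Quasi-symmetric functions\<close>

text \<open>Polynomials over \<open>K\<close> in indeterminates indexed by \<open>nat\<close>. The paper's \<open>x\<^sub>1, \<dots>, x\<^sub>n\<close> are
  the indeterminates with indices \<open>0, \<dots>, n - 1\<close>.\<close>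

type_synonym 'k mpoly = "(nat \<Rightarrow>\<^sub>0 nat) \<Rightarrow>\<^sub>0 'k"

definition mpoly_const :: "'k::field \<Rightarrow> 'k mpoly" where
  "mpoly_const c = Poly_Mapping.single 0 c"

definition mpoly_var :: "nat \<Rightarrow> 'k::field mpoly" where
  "mpoly_var i = Poly_Mapping.single (Poly_Mapping.single i 1) 1"

definition in_variables :: "nat \<Rightarrow> 'k::field mpoly \<Rightarrow> bool" where
  "in_variables n A \<longleftrightarrow> (\<forall>m\<in>Poly_Mapping.keys A. Poly_Mapping.keys m \<subseteq> {..<n})"

text \<open>\<open>mpoly_eval \<kappa> v A\<close> maps the coefficients of \<open>A\<close> by \<open>\<kappa>\<close> and substitutes \<open>v i\<close> for the
  \<open>i\<close>-th indeterminate.\<close>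

definition mpoly_eval :: "('k::field \<Rightarrow> 'r::comm_ring_1) \<Rightarrow> (nat \<Rightarrow> 'r) \<Rightarrow> 'k mpoly \<Rightarrow> 'r" where
  "mpoly_eval \<kappa> v A =
    (\<Sum>m\<in>Poly_Mapping.keys A.
       \<kappa> (Poly_Mapping.lookup A m) * (\<Prod>i\<in>Poly_Mapping.keys m. v i ^ Poly_Mapping.lookup m i))"

definition cyclic_shift :: "nat \<Rightarrow> 'k::field mpoly \<Rightarrow> 'k mpoly" where
  "cyclic_shift n A = mpoly_eval mpoly_const (\<lambda>i. mpoly_var (Suc i mod n)) A"

definition quasi_symmetric :: "nat \<Rightarrow> 'k::field mpoly fract \<Rightarrow> bool" where
  "quasi_symmetric n R \<longleftrightarrow>
    (\<exists>A B. in_variables n A \<and> in_variables n B \<and> B \<noteq> 0 \<and> R = Fract A B \<and>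
       Fract (cyclic_shift n A) (cyclic_shift n B) = R)"

text \<open>\<open>has_value n \<kappa> v R w\<close>: the function \<open>R \<in> K(x\<^sub>1, \<dots>, x\<^sub>n)\<close> is defined at the point
  \<open>(v 0, \<dots>, v (n - 1))\<close>, whose coordinates lie in an extension field of \<open>K\<close> via \<open>\<kappa>\<close>, and takes
  the value \<open>w\<close> there. Defined means that \<open>R\<close> is a quotient of polynomials whose denominator does
  not vanish at the point.\<close>

definition has_value ::
  "nat \<Rightarrow> ('k::field \<Rightarrow> 'l::field) \<Rightarrow> (nat \<Rightarrow> 'l) \<Rightarrow> 'k mpoly fract \<Rightarrow> 'l \<Rightarrow> bool" where
  "has_value n \<kappa> v R w \<longleftrightarrow>
    (\<exists>A B. in_variables n A \<and> in_variables n B \<and> R = Fract A B \<and>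
       mpoly_eval \<kappa> v B \<noteq> 0 \<and> w = mpoly_eval \<kappa> v A / mpoly_eval \<kappa> v B)"

text \<open>\<open>f(x) = R(x, x\<^sup>q, \<dots>, x\<^bsup>q^(n-1)\<^esup>)\<close> with \<open>R\<close> quasi-symmetric.\<close>

definition nq_represents :: "nat \<Rightarrow> nat \<Rightarrow> 'k::field mpoly fract \<Rightarrow> 'k ratfun \<Rightarrow> bool" where
  "nq_represents n q R f \<longleftrightarrow>
    quasi_symmetric n R \<and> has_value n ratfun_const (\<lambda>i. ratfun_var ^ (q ^ i)) R f"

definition nq_quasi_symmetric :: "nat \<Rightarrow> nat \<Rightarrow> 'k::field ratfun \<Rightarrow> bool" where
  "nq_quasi_symmetric n q f \<longleftrightarrow> (\<exists>R. nq_represents n q R f)"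

definition Fqs_phi :: "nat \<Rightarrow> nat \<Rightarrow> 'k::field ratfun set" where
  "Fqs_phi n q = {f. nq_quasi_symmetric n q f \<and> coeffs_in_Fq q f}"

text \<open>The representing function can be chosen to be defined at every point
  \<open>(\<alpha>, \<alpha>\<^sup>q, \<dots>, \<alpha>\<^bsup>q^(n-1)\<^esup>)\<close> with \<open>\<alpha> \<in> K\<close>, so that \<open>f(x) = R(x, x\<^sup>q, \<dots>, x\<^bsup>q^(n-1)\<^esup>)\<close> may be
  evaluated there. This is automatic when \<open>R\<close> is a polynomial, but not in general: cancellation
  in the one variable \<open>x\<close> can hide points at which \<open>R\<close> is undefined. For \<open>q = n = 2\<close>,
  \<open>(x\<^sub>1 x\<^sub>2 + 1) / (x\<^sub>1 + x\<^sub>2 + 1)\<close> is symmetric and represents \<open>x + 1\<close>, whose value at an element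
  of \<open>\<bbbF>\<^sub>4\<close> outside \<open>\<bbbF>\<^sub>2\<close> is not in \<open>\<bbbF>\<^sub>2\<close>.\<close>

definition nq_regular :: "nat \<Rightarrow> nat \<Rightarrow> 'k::field ratfun \<Rightarrow> bool" where
  "nq_regular n q f \<longleftrightarrow>
    (\<exists>R. nq_represents n q R f \<and> (\<forall>\<alpha>. \<exists>w. has_value n (\<lambda>c. c) (\<lambda>i. \<alpha> ^ (q ^ i)) R w))"

section \<open>Field extensions\<close>

text \<open>An extension \<open>E/F\<close> is given by an embedding \<open>\<iota>\<close> of \<open>F\<close> into a type carrying \<open>E\<close>.\<close>

definition field_embedding :: "('f::field \<Rightarrow> 'e::field) \<Rightarrow> bool" where
  "field_embedding \<iota> \<longleftrightarrow>
    \<iota> 1 = 1 \<and> (\<forall>a b. \<iota> (a + b) = \<iota> a + \<iota> b) \<and> (\<forall>a b. \<iota> (a * b) = \<iota> a * \<iota> b)"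

definition is_subfield :: "'e::field set \<Rightarrow> bool" where
  "is_subfield S \<longleftrightarrow>
    1 \<in> S \<and> (\<forall>a\<in>S. \<forall>b\<in>S. a - b \<in> S) \<and> (\<forall>a\<in>S. \<forall>b\<in>S. a * b \<in> S) \<and> (\<forall>a\<in>S. inverse a \<in> S)"

definition adjoin :: "('f::field \<Rightarrow> 'e::field) \<Rightarrow> 'e \<Rightarrow> 'e set" where
  "adjoin \<iota> y = \<Inter>{S. is_subfield S \<and> range \<iota> \<subseteq> S \<and> y \<in> S}"

definition finite_extension :: "('f::field \<Rightarrow> 'e::field) \<Rightarrow> bool" where
  "finite_extension \<iota> \<longleftrightarrow> (\<exists>B. finite B \<and> module.span (\<lambda>c v. \<iota> c * v) B = UNIV)"

definition extension_degree :: "('f::field \<Rightarrow> 'e::field) \<Rightarrow> nat" where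
  "extension_degree \<iota> = vector_space.dim (\<lambda>c v. \<iota> c * v) (UNIV :: 'e set)"

section \<open>Places\<close>

text \<open>Throughout, \<open>\<kappa>\<close> embeds the constant field \<open>K\<close> into the function field.\<close>

definition valuation_ring :: "('k::field \<Rightarrow> 'e::field) \<Rightarrow> 'e set \<Rightarrow> bool" where
  "valuation_ring \<kappa> \<O> \<longleftrightarrow>
    range \<kappa> \<subset> \<O> \<and> \<O> \<subset> UNIV \<and>
    (\<forall>a\<in>\<O>. \<forall>b\<in>\<O>. a - b \<in> \<O> \<and> a * b \<in> \<O>) \<and>
    (\<forall>z. z \<noteq> 0 \<longrightarrow> z \<in> \<O> \<or> inverse z \<in> \<O>)"

definition is_ideal :: "'e::field set \<Rightarrow> 'e set \<Rightarrow> bool" where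
  "is_ideal \<O> I \<longleftrightarrow>
    I \<subseteq> \<O> \<and> 0 \<in> I \<and> (\<forall>a\<in>I. \<forall>b\<in>I. a + b \<in> I) \<and> (\<forall>r\<in>\<O>. \<forall>a\<in>I. r * a \<in> I)"

definition is_maximal_ideal :: "'e::field set \<Rightarrow> 'e set \<Rightarrow> bool" where
  "is_maximal_ideal \<O> P \<longleftrightarrow>
    is_ideal \<O> P \<and> P \<noteq> \<O> \<and> (\<forall>J. is_ideal \<O> J \<and> P \<subseteq> J \<longrightarrow> J = P \<or> J = \<O>)"

definition places :: "('k::field \<Rightarrow> 'e::field) \<Rightarrow> 'e set set" where
  "places \<kappa> = {P. \<exists>\<O>. valuation_ring \<kappa> \<O> \<and> is_maximal_ideal \<O> P}"

text \<open>A place determines its valuation ring.\<close>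

definition ring_of_place :: "'e::field set \<Rightarrow> 'e set" where
  "ring_of_place P = {z. z = 0 \<or> inverse z \<notin> P}"

text \<open>The residue classes of \<open>b 0, \<dots>, b (d - 1)\<close> form a \<open>K\<close>-basis of \<open>\<O>\<^sub>P / P\<close>.\<close>

definition residue_basis :: "('k::field \<Rightarrow> 'e::field) \<Rightarrow> 'e set \<Rightarrow> nat \<Rightarrow> (nat \<Rightarrow> 'e) \<Rightarrow> bool" where
  "residue_basis \<kappa> P d b \<longleftrightarrow>
    (\<forall>i<d. b i \<in> ring_of_place P) \<and>
    (\<forall>z\<in>ring_of_place P. \<exists>!c. (\<forall>i\<ge>d. c i = 0) \<and> z - (\<Sum>i<d. \<kappa> (c i) * b i) \<in> P)"

text \<open>\<open>[\<O>\<^sub>P / P : K]\<close>, with the convention \<open>0\<close> for infinite dimension.\<close>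

definition place_degree :: "('k::field \<Rightarrow> 'e::field) \<Rightarrow> 'e set \<Rightarrow> nat" where
  "place_degree \<kappa> P =
    (if \<exists>d b. residue_basis \<kappa> P d b then (THE d. \<exists>b. residue_basis \<kappa> P d b) else 0)"

definition rational_places :: "('k::field \<Rightarrow> 'e::field) \<Rightarrow> 'e set set" where
  "rational_places \<kappa> = {P \<in> places \<kappa>. place_degree \<kappa> P = 1}"

definition num_rational_places :: "('k::field \<Rightarrow> 'e::field) \<Rightarrow> nat" where
  "num_rational_places \<kappa> = card (rational_places \<kappa>)"

definition lies_over :: "('f::field \<Rightarrow> 'e::field) \<Rightarrow> 'e set \<Rightarrow> 'f set \<Rightarrow> bool" where
  "lies_over \<iota> P' P \<longleftrightarrow> \<iota> ` P \<subseteq> P'"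

text \<open>\<open>P\<close> splits completely in the finite extension \<open>E/F\<close>: there are exactly \<open>[E:F]\<close> places of
  \<open>E\<close> over \<open>P\<close>. Here \<open>\<kappa>\<close> is the constant embedding of \<open>F\<close>.\<close>

definition splits_completely ::
  "('k::field \<Rightarrow> 'f::field) \<Rightarrow> ('f \<Rightarrow> 'e::field) \<Rightarrow> 'f set \<Rightarrow> bool" where
  "splits_completely \<kappa> \<iota> P \<longleftrightarrow>
    finite_extension \<iota> \<and> finite {P' \<in> places (\<iota> \<circ> \<kappa>). lies_over \<iota> P' P} \<and>
    card {P' \<in> places (\<iota> \<circ> \<kappa>). lies_over \<iota> P' P} = extension_degree \<iota>"

end

(* Let T(Y) = Y^(q^(n-1)) + ... + Y and f = h/g. All roots of T lie in K, and every c in F_q has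
   q^(n-1) preimages in K under T. Since f is not L(r) for a linear polynomial L, the polynomial
   T(Y) - f is irreducible over F, so [E:F] = q^(n-1).

   Quasi-symmetry together with the F_q-rationality of the coefficients makes f(alpha) invariant
   under c -> c^q for every alpha in K, and f vanishes at infinity. So at every rational place of F
   the function f has a value c in F_q, and each of the q^(n-1) roots of T(Y) - c in K lifts to a
   root of T(Y) - f in K((t)). The resulting embeddings of E into K((t)) give q^(n-1) distinct
   rational places over the given one, and by the inequality "number of places over P <= [E:F]"
   there are no others. The same inequality over the q^n + 1 rational places of F gives the
   maximality statement. *)

theory Submission
  imports
    Defs
    "HOL-Library.FuncSet"
    "HOL-Computational_Algebra.Formal_Laurent_Series"
    "HOL-Computational_Algebra.Polynomial_FPS"
begin

section \<open>Field embeddings\<close>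

text \<open>Places are handled as bare valuation rings, without ramification indices or Galois
  groups. From above, only the weak half of the fundamental inequality is needed; it follows from
  elements that are congruent to 1 at one place and to 0 at the others, and it holds in every finite
  extension, which is why it also gives the maximality. The degree has to be settled first: a root
  of T(Y) - f in K((t)) is guaranteed to give an embedding of E only once T(Y) - f is irreducible.
  As T is additive with all its roots in K, the roots of T(Y) - f are the y + v with T(v) = 0, and a
  proper factor belongs to a proper subgroup of the roots of T. Finite additive groups are root sets
  of additive polynomials, and this turns a proper factor into f = L(r), the excluded case. The
  values in F_q come from two comparisons with the point \<alpha>^q: quasi-symmetry equates
  f(\<alpha>) with f(\<alpha>^q), and coefficients in F_q equate f(\<alpha>)^q with f(\<alpha>^q).
  The first one evaluates the multivariate function itself, hence \<open>nq_regular\<close>.\<close>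

locale field_hom =
  fixes \<iota> :: "'f::field \<Rightarrow> 'e::field"
  assumes field_embedding: "field_embedding \<iota>"
begin

lemma hom_1 [simp]: "\<iota> 1 = 1"
  and hom_add: "\<iota> (a + b) = \<iota> a + \<iota> b"
  and hom_mult: "\<iota> (a * b) = \<iota> a * \<iota> b"
  using field_embedding by (auto simp: field_embedding_def)

lemma hom_0 [simp]: "\<iota> 0 = 0"
  using hom_add[of 0 0] by (metis add.right_neutral add_cancel_right_right)

lemma hom_uminus: "\<iota> (- a) = - \<iota> a"
  using hom_add[of a "- a"] by (simp add: eq_neg_iff_add_eq_0 add.commute)

lemma hom_diff: "\<iota> (a - b) = \<iota> a - \<iota> b"
  using hom_add[of a "- b"] by (simp add: hom_uminus)

lemma hom_sum: "\<iota> (sum g A) = (\<Sum>a\<in>A. \<iota> (g a))"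
  by (induction A rule: infinite_finite_induct) (simp_all add: hom_add)

lemma hom_of_nat: "\<iota> (of_nat j) = of_nat j"
  by (induction j) (simp_all add: hom_add)

lemma hom_eq_0_iff [simp]: "\<iota> a = 0 \<longleftrightarrow> a = 0"
proof
  assume "\<iota> a = 0"
  show "a = 0"
  proof (rule ccontr)
    assume "a \<noteq> 0"
    then have "\<iota> (a * inverse a) = 1" by simp
    then show False using \<open>\<iota> a = 0\<close> by (simp add: hom_mult)
  qed
qed simp

lemma hom_eq_iff [simp]: "\<iota> a = \<iota> b \<longleftrightarrow> a = b"
  using hom_eq_0_iff[of "a - b"] by (simp add: hom_diff)

lemma hom_inverse: "\<iota> (inverse a) = inverse (\<iota> a)"
proof (cases "a = 0")
  case False
  then have "\<iota> (inverse a * a) = 1" by simp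
  then have "\<iota> (inverse a) * \<iota> a = 1" by (simp add: hom_mult)
  then show ?thesis by (metis inverse_unique mult.commute)
qed simp

lemma hom_divide: "\<iota> (a / b) = \<iota> a / \<iota> b"
  by (simp add: divide_inverse hom_mult hom_inverse)

definition ev :: "'e \<Rightarrow> 'f poly \<Rightarrow> 'e" where
  "ev y c = poly (map_poly \<iota> c) y"

lemma ev_altdef: "degree c \<le> d \<Longrightarrow> ev y c = (\<Sum>i\<le>d. \<iota> (coeff c i) * y ^ i)"
  unfolding ev_def poly_altdef
  by (rule sum.mono_neutral_cong_left) (auto simp: coeff_map_poly coeff_eq_0 degree_map_poly intro: order.trans)

lemma ev_pCons: "ev y (pCons a c) = \<iota> a + y * ev y c"
  by (cases "pCons a c = 0") (auto simp: ev_def map_poly_pCons)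

lemma ev_0 [simp]: "ev y 0 = 0"
  by (simp add: ev_def)

lemma ev_const [simp]: "ev y [:a:] = \<iota> a"
  by (simp add: ev_pCons)

lemma ev_1 [simp]: "ev y 1 = 1"
  using ev_const[of y 1] by (simp add: one_pCons)

lemma ev_X [simp]: "ev y [:0, 1:] = y"
  by (simp add: ev_pCons)

lemma ev_add: "ev y (c + d) = ev y c + ev y d"
proof (induction c d rule: poly_induct2)
  case (pCons a c b d)
  then show ?case by (simp add: ev_pCons hom_add algebra_simps)
qed simp

lemma ev_smult: "ev y (smult a c) = \<iota> a * ev y c"
  by (induction c) (simp_all add: ev_pCons hom_mult algebra_simps)

lemma ev_mult: "ev y (c * d) = ev y c * ev y d"
  by (induction c) (simp_all add: ev_pCons ev_add ev_smult algebra_simps)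

lemma ev_uminus: "ev y (- c) = - ev y c"
  using ev_smult[of y "-1" c] by (simp add: hom_uminus)

lemma ev_diff: "ev y (c - d) = ev y c - ev y d"
  using ev_add[of y c "- d"] by (simp add: ev_uminus)

lemma ev_power: "ev y (c ^ i) = ev y c ^ i"
  by (induction i) (simp_all add: ev_mult)

lemma ev_sum: "ev y (sum g A) = (\<Sum>a\<in>A. ev y (g a))"
  by (induction A rule: infinite_finite_induct) (simp_all add: ev_add)

lemma ev_monom: "ev y (monom a i) = \<iota> a * y ^ i"
  by (induction i) (simp_all add: monom_0 monom_Suc ev_pCons mult_ac)

lemma ev_hom: "ev (\<iota> x) c = \<iota> (poly c x)"
  by (induction c) (simp_all add: ev_pCons hom_add hom_mult)

lemma ev_pcompose: "ev y (pcompose c d) = ev (ev y d) c"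
  by (induction c) (simp_all add: ev_pCons pcompose_pCons ev_add ev_mult)

lemma map_poly_hom_eq_0_iff [simp]: "map_poly \<iota> c = 0 \<longleftrightarrow> c = 0"
  by (rule map_poly_eq_0_iff) auto

lemma degree_map_poly_hom [simp]: "degree (map_poly \<iota> c) = degree c"
  by (rule degree_map_poly) simp

lemma CHAR_eq_hom: "CHAR('e) = CHAR('f)"
  by (rule CHAR_eqI) (simp_all flip: hom_of_nat add: of_nat_eq_0_iff_char_dvd)

end

lemma field_hom_comp:
  assumes "field_hom \<kappa>" "field_hom \<iota>"
  shows "field_hom (\<iota> \<circ> \<kappa>)"
proof -
  interpret a: field_hom \<kappa> by fact
  interpret b: field_hom \<iota> by fact
  show ?thesis
    by standard (auto simp: field_embedding_def a.hom_add b.hom_add a.hom_mult b.hom_mult)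
qed

lemma field_hom_id: "field_hom (\<lambda>x. x)"
  by standard (simp add: field_embedding_def)

lemma field_hom_ratfun_const: "field_hom (ratfun_const :: 'k::field \<Rightarrow> 'k ratfun)"
  by standard (simp add: field_embedding_def ratfun_const_def One_fract_def one_pCons mult.commute)

section \<open>Finite fields\<close>

text \<open>Translation by 1 permutes the field, so adding 1 to every element leaves the sum over
  the field unchanged; the total increment is the cardinality.\<close>

lemma of_nat_card_UNIV_eq_0: "of_nat CARD('k) = (0 :: 'k::{field,finite})"
proof -
  have "(\<Sum>x\<in>(UNIV :: 'k set). x) = (\<Sum>x\<in>UNIV. x + 1)"
    by (rule sum.reindex_bij_witness[of _ "\<lambda>x. x + 1" "\<lambda>x. x - 1"]) auto
  then show ?thesis by (simp add: sum.distrib)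
qed

text \<open>Multiplication by \<open>x \<noteq> 0\<close> permutes the nonzero elements, so their
  product is unchanged by the factor x^(|K|-1).\<close>

lemma power_card_UNIV: "x ^ CARD('k) = (x :: 'k::{field,finite})"
proof (cases "x = 0")
  case False
  have "x * (\<Prod>y\<in>UNIV-{0}. x * y) = x * x ^ (CARD('k) - 1) * \<Prod>(UNIV-{0})"
    by (simp add: prod.distrib mult_ac)
  also have "x * x ^ (CARD('k) - 1) = x ^ Suc (CARD('k) - 1)"
    by (subst power_Suc) auto
  also have "Suc (CARD('k) - 1) = CARD('k)"
    by simp
  also have "(\<Prod>y\<in>UNIV-{0}. x * y) = (\<Prod>y\<in>UNIV-{0}. y)"
    by (rule prod.reindex_bij_witness[of _ "\<lambda>y. y / x" "\<lambda>y. x * y"]) (use False in auto)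
  finally show ?thesis
    by simp
qed auto

text \<open>A vanishing power of \<open>p\<close> in a field forces \<open>p\<close> itself to
  vanish, so the characteristic is a divisor of \<open>p\<close> other than 1.\<close>

lemma CHAR_eq_prime_if_card:
  assumes "prime p" "CARD('k::{field,finite}) = p ^ j"
  shows "CHAR('k) = p"
proof -
  have "(of_nat p :: 'k) ^ j = 0"
    using of_nat_card_UNIV_eq_0[where 'k='k] assms(2) by simp
  then have "(of_nat p :: 'k) = 0" by simp
  then have "CHAR('k) dvd p" by (simp add: of_nat_eq_0_iff_char_dvd)
  then show ?thesis using assms(1) CHAR_not_1'[where 'a='k] unfolding prime_nat_iff One_nat_def by auto
qed

text \<open>Both the number of roots of \<open>T - c\<close> and the number of admissible \<open>c\<close> are bounded by a
  degree, and the two bounds multiply to the number of all elements; so both are attained.\<close>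

lemma trace_fibre_card:
  fixes c :: "'k::{field,finite}"
  assumes q: "prime p" "q = p ^ k" "k \<ge> 1" "n > 1" and card: "CARD('k) = q ^ n"
    and c: "c ^ q = c"
  shows "card {\<alpha>. (\<Sum>i<n. \<alpha> ^ (q ^ i)) = c} = q ^ (n - 1)"
proof -
  have p: "prime CHAR('k)" "q = CHAR('k) ^ k"
    using CHAR_eq_prime_if_card[of p "k * n", where 'k='k] q card by (auto simp: power_mult)
  have q1: "q > 1" unfolding q(2) using q(1,3) by (intro one_less_power) (auto dest: prime_gt_1_nat)
  let ?T = "\<lambda>\<alpha>::'k. \<Sum>i<n. \<alpha> ^ (q ^ i)"
  let ?A = "{c::'k. c ^ q = c}"
  let ?F = "\<lambda>c. {\<alpha>. ?T \<alpha> = c}"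
  \<comment> \<open>Raising to the power \<open>q\<close> moves every summand to the next one, and
    the last becomes \<alpha> because \<alpha>^(q^n) = \<alpha>.\<close>
  have T: "?T \<alpha> \<in> ?A" for \<alpha>
  proof -
    have "?T \<alpha> ^ q = (\<Sum>i<n. \<alpha> ^ (q ^ Suc i))"
      by (subst freshmans_dream_sum'[OF p]) (simp add: power_mult[symmetric] mult.commute)
    also have "\<dots> = (\<Sum>i=1..<Suc n. \<alpha> ^ (q ^ i))"
      by (simp add: sum.shift_bounds_Suc_ivl atLeast0LessThan del: sum.op_ivl_Suc power_Suc)
    also have "\<dots> = (\<Sum>i=1..<n. \<alpha> ^ (q ^ i)) + \<alpha> ^ (q ^ n)"
      using q by (subst sum.atLeastLessThan_Suc) auto
    also have "\<alpha> ^ (q ^ n) = \<alpha>" using power_card_UNIV[of \<alpha>] card by simp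
    also have "(\<Sum>i=1..<n. \<alpha> ^ (q ^ i)) + \<alpha> = ?T \<alpha>"
      using q by (simp add: lessThan_atLeast0 sum.atLeast_Suc_lessThan add.commute)
    finally show ?thesis by simp
  qed
  have A: "card ?A \<le> q"
  proof -
    let ?P = "monom 1 q - [:0, 1:] :: 'k poly"
    have "coeff ?P q = 1" using q1 by (simp add: coeff_pCons split: nat.split)
    then have "?P \<noteq> 0" by (metis coeff_0 zero_neq_one)
    moreover have "degree ?P \<le> q"
      using q1 by (intro degree_diff_le) (auto simp: degree_monom_le)
    ultimately have "card {x. poly ?P x = 0} \<le> q"
      using card_poly_roots_bound order_trans by blast
    then show ?thesis by (simp add: poly_monom)
  qed
  have F: "card (?F d) \<le> q ^ (n - 1)" for d
  proof -
    let ?P = "(\<Sum>i<n. monom 1 (q ^ i)) - [:d:] :: 'k poly"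
    have "coeff ?P (q ^ (n - 1)) = (\<Sum>i<n. if i = n - 1 then 1 else 0)"
      using q1 q(4) by (auto simp: coeff_sum coeff_pCons power_inject_exp split: nat.split intro!: sum.cong)
    then have "?P \<noteq> 0" using q(4) by auto
    moreover have "degree ?P \<le> q ^ (n - 1)"
      using q1 by (intro degree_diff_le degree_sum_le) (auto intro!: order.trans[OF degree_monom_le] power_increasing)
    ultimately have "card {x. poly ?P x = 0} \<le> q ^ (n - 1)"
      using card_poly_roots_bound order_trans by blast
    then show ?thesis by (simp add: poly_monom poly_sum)
  qed
  have "(UNIV :: 'k set) = (\<Union>d\<in>?A. ?F d)" using T by auto
  then have "q ^ n = card (\<Union>d\<in>?A. ?F d)" using card by simp
  also have "\<dots> = (\<Sum>d\<in>?A. card (?F d))" by (rule card_UN_disjoint) auto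
  \<comment> \<open>At most q - 1 other fibres, each of size at most q^(n-1), leave at least q^n -
    (q-1) q^(n-1) = q^(n-1) elements for the fibre of \<open>c\<close>.\<close>
  also have "\<dots> = card (?F c) + (\<Sum>d\<in>?A-{c}. card (?F d))"
    using c by (subst sum.remove[of _ c]) auto
  also have "\<dots> \<le> card (?F c) + card (?A - {c}) * q ^ (n - 1)"
    using sum_bounded_above[of "?A-{c}" "\<lambda>d. card (?F d)" "q ^ (n-1)"] F by simp
  also have "card (?A - {c}) \<le> q - 1" using A c by (subst card_Diff_singleton) auto
  also have "card (?F c) + (q - 1) * q ^ (n - 1) = card (?F c) + q ^ n - q ^ (n - 1)"
    using q(4) q1 by (cases n) (auto simp: diff_mult_distrib)
  finally have "q ^ n \<le> card (?F c) + q ^ n - q ^ (n - 1)" by simp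
  moreover have "q ^ (n - 1) \<le> q ^ n" using q1 by (intro power_increasing) auto
  moreover have "0 < q ^ (n - 1)" using q1 by simp
  ultimately have "q ^ (n - 1) \<le> card (?F c)" by linarith
  then show ?thesis using F[of c] by simp
qed

section \<open>Linear polynomials\<close>

text \<open>A condition on the support alone makes closure under sums and scalar multiples
  immediate, with no coefficient sequences of different lengths to be matched.\<close>

lemma linear_poly_iff:
  assumes "p > 1"
  shows "linear_poly p L \<longleftrightarrow> (\<forall>j. coeff L j \<noteq> 0 \<longrightarrow> (\<exists>i. j = p ^ i))"
proof
  assume "linear_poly p L"
  then obtain a m where "L = (\<Sum>i\<le>m. monom (a i) (p ^ i))" unfolding linear_poly_def by blast
  then show "\<forall>j. coeff L j \<noteq> 0 \<longrightarrow> (\<exists>i. j = p ^ i)"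
    by (auto simp: coeff_sum elim!: sum.not_neutral_contains_not_neutral split: if_splits)
next
  assume *: "\<forall>j. coeff L j \<noteq> 0 \<longrightarrow> (\<exists>i. j = p ^ i)"
  \<comment> \<open>Since i < p^i \<le> \<open>degree L\<close> for every exponent p^i that occurs,
    \<open>degree L\<close> is a generous but safe bound for the summation index.\<close>
  have "L = (\<Sum>i\<le>degree L. monom (coeff L (p ^ i)) (p ^ i))"
  proof (rule poly_eqI)
    fix j
    show "coeff L j = coeff (\<Sum>i\<le>degree L. monom (coeff L (p ^ i)) (p ^ i)) j"
    proof (cases "coeff L j = 0")
      case True
      then show ?thesis by (auto simp: coeff_sum intro!: sum.neutral)
    next
      case False
      then obtain i where i: "j = p ^ i" using * by blast
      have "i < p ^ i" using assms by (simp add: power_gt_expt)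
      also have "p ^ i \<le> degree L" using False i by (simp add: le_degree)
      finally have "i \<le> degree L" by simp
      have "coeff (\<Sum>i\<le>degree L. monom (coeff L (p ^ i)) (p ^ i)) j
        = (\<Sum>l\<le>degree L. if l = i then coeff L j else 0)"
        using assms i by (auto simp: coeff_sum intro!: sum.cong)
      then show ?thesis using \<open>i \<le> degree L\<close> by simp
    qed
  qed
  then show "linear_poly p L" unfolding linear_poly_def
    by (intro exI[of _ "\<lambda>i. coeff L (p ^ i)"] exI[of _ "degree L"])
qed

lemma (in field_hom) ev_linear_poly_add:
  assumes "linear_poly p L" "prime p" "CHAR('e) = p"
  shows "ev (x + y) L = ev x L + ev y L"
proof -
  obtain a m where "L = (\<Sum>i\<le>m. monom (a i) (p ^ i))"
    using assms(1) unfolding linear_poly_def by blast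
  moreover have "(x + y) ^ (p ^ i) = x ^ (p ^ i) + y ^ (p ^ i)" for i
    using assms by (intro freshmans_dream') auto
  ultimately show ?thesis
    by (simp add: ev_sum ev_monom sum.distrib distrib_left)
qed

lemma poly_linear_poly_add:
  fixes L :: "'k::field poly"
  assumes "linear_poly p L" "prime p" "CHAR('k) = p"
  shows "poly L (x + y) = poly L x + poly L y"
proof -
  interpret field_hom "\<lambda>x::'k. x" by (rule field_hom_id)
  show ?thesis using ev_linear_poly_add[OF assms, of x y] unfolding ev_def map_poly_id' .
qed

section \<open>Additive polynomials with a prescribed finite group of roots\<close>

lemma CHAR_poly: "CHAR('k::field poly) = CHAR('k)"
proof (rule CHAR_eqI)
  have *: "(of_nat j :: 'k poly) = [:of_nat j:]" for j by (simp add: of_nat_poly)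
  show "of_nat CHAR('k) = (0 :: 'k poly)" by (simp add: *)
  show "CHAR('k) dvd j" if "of_nat j = (0 :: 'k poly)" for j
    using that by (simp add: * of_nat_eq_0_iff_char_dvd)
qed

text \<open>Frobenius acts term by term: coefficients are raised to the power \<open>p\<close> and
  p^i becomes p^(i+1), so the exponents remain powers of \<open>p\<close>.\<close>

lemma linear_poly_power:
  fixes L :: "'k::field poly"
  assumes "linear_poly p L" "prime p" "CHAR('k) = p"
  shows "linear_poly p (L ^ p)"
proof -
  obtain a m where L: "L = (\<Sum>i\<le>m. monom (a i) (p ^ i))"
    using assms(1) unfolding linear_poly_def by blast
  have "L ^ p = (\<Sum>i\<le>m. monom (a i) (p ^ i) ^ p)"
    unfolding L by (rule freshmans_dream_sum) (auto simp: CHAR_poly assms)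
  also have "\<dots> = (\<Sum>i\<le>m. monom (a i ^ p) (p ^ Suc i))"
    by (simp add: monom_power mult.commute)
  also have "linear_poly p \<dots>"
    using prime_gt_1_nat[OF assms(2)]
    by (auto simp: linear_poly_iff coeff_sum elim!: sum.not_neutral_contains_not_neutral
        split: if_splits simp del: power_Suc)
  finally show ?thesis .
qed

text \<open>In positive characteristic \<open>- a\<close> is a sum of copies of \<open>a\<close>, so
  closure under addition describes the subgroups.\<close>

definition additive_subgroup :: "'k::field set \<Rightarrow> bool" where
  "additive_subgroup W \<longleftrightarrow> 0 \<in> W \<and> (\<forall>a\<in>W. \<forall>b\<in>W. a + b \<in> W)"

lemma of_nat_power_prime_char:
  assumes "prime p" "CHAR('k::field) = p"
  shows "(of_nat j :: 'k) ^ p = of_nat j"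
proof (induction j)
  case (Suc j)
  have "(1 + of_nat j :: 'k) ^ p = 1 ^ p + of_nat j ^ p"
    using assms by (intro freshmans_dream) auto
  then show ?case by (simp add: Suc)
qed (use prime_gt_0_nat[OF assms(1)] in simp)

lemma linear_poly_of_nat_mult:
  assumes "linear_poly p L" "prime p" "CHAR('k::field) = p"
  shows "poly L (of_nat j * x) = of_nat j * poly L (x :: 'k)"
proof (induction j)
  case 0
  then show ?case using poly_linear_poly_add[OF assms, of 0 0] by (metis add.right_neutral add_cancel_right_right mult_zero_left of_nat_0)
next
  case (Suc j)
  then show ?case using poly_linear_poly_add[OF assms, of x "of_nat j * x"] by (simp add: algebra_simps)
qed

text \<open>For finite \<open>W\<close> the last three conditions say that \<open>L\<close> is the
  product of X - w over w in \<open>W\<close>; the substance lies in the additivity of this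
  product.\<close>

definition is_subgroup_poly :: "nat \<Rightarrow> 'k::field set \<Rightarrow> 'k poly \<Rightarrow> bool" where
  "is_subgroup_poly p W L \<longleftrightarrow>
    linear_poly p L \<and> lead_coeff L = 1 \<and> degree L = card W \<and> {x. poly L x = 0} = W"

text \<open>On the coset H + j w the polynomial \<open>L\<close> takes the value j u, where u =
  L(w). The product of X - j u over j in the prime field is X^p - u^(p-1) X; substituting
  \<open>L\<close> for X gives L^p - u^(p-1) L, which is again additive and vanishes on the enlarged
  group.\<close>

lemma subgroup_poly_extend:
  fixes H :: "'k::field set"
  assumes p: "prime p" "CHAR('k) = p"
    and H: "additive_subgroup H" "finite H" "is_subgroup_poly p H L" and w: "w \<notin> H"
  shows "\<exists>L'. is_subgroup_poly p {h + of_nat j * w |h j. h \<in> H} L'"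
proof -
  note p1 = prime_gt_1_nat[OF p(1)]
  let ?H = "{h + of_nat j * w |h j. h \<in> H}"
  have L: "linear_poly p L" "lead_coeff L = 1" "degree L = card H" "{x. poly L x = 0} = H"
    using H(3) by (auto simp: is_subgroup_poly_def)
  define u where "u = poly L w"
  have u: "u \<noteq> 0" using w L by (auto simp: u_def)
  have Lx: "poly L (h + of_nat j * w) = of_nat j * u" if "h \<in> H" for h j
    using that L by (auto simp: poly_linear_poly_add[OF L(1) p] linear_poly_of_nat_mult[OF L(1) p] u_def)
  define L' where "L' = L ^ p - smult (u ^ (p - 1)) L"
  have cH: "card H > 0" using H by (auto simp: card_gt_0_iff additive_subgroup_def)
  have dp: "degree (L ^ p) = p * card H" using L by (subst degree_power_eq) auto
  have lt: "degree (smult (u ^ (p - 1)) L) < p * card H"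
    using L cH p1 by (intro le_less_trans[OF degree_smult_le]) auto
  have dL': "degree L' = p * card H" "lead_coeff L' = 1"
  proof -
    have "degree (- smult (u ^ (p - 1)) L) < degree (L ^ p)" using lt dp by simp
    from degree_add_eq_left[OF this] have d: "degree L' = p * card H" by (simp add: L'_def dp)
    moreover have "coeff (L ^ p) (p * card H) = 1"
      using L(2) dp lead_coeff_power[of L p] by simp
    moreover have "coeff (smult (u ^ (p - 1)) L) (p * card H) = 0"
      using lt by (rule coeff_eq_0)
    ultimately show "degree L' = p * card H" "lead_coeff L' = 1" by (simp_all add: L'_def)
  qed
  have lin: "linear_poly p L'"
    using linear_poly_power[OF L(1) p] L(1) unfolding linear_poly_iff[OF p1] L'_def
    by (metis coeff_diff coeff_smult diff_zero mult_zero_right)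
  have van: "?H \<subseteq> {x. poly L' x = 0}"
  proof safe
    fix h j assume h: "h \<in> H"
    have "(of_nat j * u) ^ p = of_nat j * u ^ p"
      by (simp add: power_mult_distrib of_nat_power_prime_char[OF p])
    moreover have "u ^ p = u ^ (p - 1) * u" using p1 by (metis Suc_diff_1 less_trans power_Suc2 zero_less_one)
    ultimately show "poly L' (h + of_nat j * w) = 0"
      using Lx[OF h, of j] by (simp add: L'_def)
  qed
  have "L' \<noteq> 0" using dL' by auto
  then have fin: "finite {x. poly L' x = 0}" "card {x. poly L' x = 0} \<le> p * card H"
    using poly_roots_finite card_poly_roots_bound dL' by metis+
  \<comment> \<open>Applying \<open>L\<close> to h + j w recovers j u, hence j modulo
    \<open>p\<close>. So there are p |H| distinct elements of this form; this is the degree of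
    \<open>L'\<close>, which leaves room for no other root.\<close>
  have inj: "inj_on (\<lambda>(h, j). h + of_nat j * w) (H \<times> {..<p})"
  proof (rule inj_onI, clarsimp)
    fix h j h' j' assume *: "h \<in> H" "h' \<in> H" "j < p" "j' < p" "h + of_nat j * w = h' + of_nat j' * w"
    then have "of_nat j * u = of_nat j' * u" using Lx by metis
    then have "of_nat j = (of_nat j' :: 'k)" using u by simp
    then have "j = j'" using *(3,4) p(2) 
    proof (induction j j' rule: linorder_wlog)
      case (le a b)
      then have "of_nat (b - a) = (0 :: 'k)" by (simp add: of_nat_diff)
      then have "p dvd b - a" using p(2) by (simp add: of_nat_eq_0_iff_char_dvd)
      then show ?case using le by (metis diff_is_0_eq diff_less_mono2 dvd_imp_le le_antisym le_zero_eq less_imp_diff_less not_gr0 not_less)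
    qed auto
    then show "h = h' \<and> j = j'" using * by simp
  qed
  have "p * card H = card ((\<lambda>(h, j). h + of_nat j * w) ` (H \<times> {..<p}))"
    using card_image[OF inj] by (simp add: card_cartesian_product)
  also have "\<dots> \<le> card ?H"
    by (rule card_mono[OF finite_subset[OF van fin(1)]]) auto
  finally have ge: "p * card H \<le> card ?H" .
  have "?H = {x. poly L' x = 0}"
    using ge fin van by (intro card_subset_eq) (auto dest: card_mono[OF fin(1)])
  moreover have "card ?H = p * card H" using ge fin calculation by simp
  ultimately have "is_subgroup_poly p ?H L'" using lin dL' by (simp add: is_subgroup_poly_def)
  then show ?thesis by blast
qed

text \<open>Starting from {0}, whose polynomial is X, the subgroup grows inside \<open>W\<close> by
  one new generator at a time until it is all of \<open>W\<close>.\<close>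

lemma ex_subgroup_poly:
  fixes W :: "'k::field set"
  assumes p: "prime p" "CHAR('k) = p" and W: "additive_subgroup W" "finite W"
  shows "\<exists>L. is_subgroup_poly p W L"
proof -
  have "\<exists>L. is_subgroup_poly p W L"
    if "additive_subgroup H" "H \<subseteq> W" "is_subgroup_poly p H L" for H and L :: "'k poly"
    using that
  proof (induction "card W - card H" arbitrary: H L rule: less_induct)
    case less
    show ?case
    proof (cases "H = W")
      case True
      then show ?thesis using less by blast
    next
      case False
      then obtain w where w: "w \<in> W" "w \<notin> H" using less by blast
      let ?H = "{h + of_nat j * w |h j. h \<in> H}"
      have finH: "finite H" using less W finite_subset by blast
      have mult: "of_nat j * w \<in> W" for j
        using W w by (induction j) (auto simp: additive_subgroup_def distrib_right)
      have sub: "?H \<subseteq> W" using less(3) W mult by (auto simp: additive_subgroup_def)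
      have H0: "0 \<in> H" using less by (simp add: additive_subgroup_def)
      have sg: "additive_subgroup ?H"
        unfolding additive_subgroup_def
      proof safe
        show "\<exists>h j. 0 = h + of_nat j * w \<and> h \<in> H"
          using H0 by (intro exI[of _ 0]) auto
        fix h h' j j' assume "h \<in> H" "h' \<in> H"
        then show "\<exists>h'' j''. h + of_nat j * w + (h' + of_nat j' * w) = h'' + of_nat j'' * w \<and> h'' \<in> H"
          using less(2) by (intro exI[of _ "h + h'"] exI[of _ "j + j'"])
            (auto simp: additive_subgroup_def algebra_simps)
      qed
      have "H \<subseteq> ?H"
      proof
        fix h assume "h \<in> H"
        then show "h \<in> ?H" by (intro CollectI exI[of _ h] exI[of _ 0]) auto
      qed
      moreover have "w \<in> ?H" using H0 by (intro CollectI exI[of _ 0] exI[of _ 1]) auto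
      ultimately have "H \<subset> ?H" using w by blast
      then have "card H < card ?H" by (rule psubset_card_mono[OF finite_subset[OF sub W(2)]])
      moreover have "card ?H \<le> card W" using sub W by (intro card_mono)
      ultimately have "card W - card ?H < card W - card H" by linarith
      moreover obtain L' where "is_subgroup_poly p ?H L'"
        using subgroup_poly_extend[OF p less(2) finH less(4) w(2)] by blast
      ultimately show ?thesis using less(1) sg sub by blast
    qed
  qed
  moreover have "is_subgroup_poly p {0} [:0, 1::'k:]"
    using prime_gt_1_nat[OF p(1)]
    by (auto simp: is_subgroup_poly_def linear_poly_iff coeff_pCons split: nat.splits intro: exI[of _ 0])
  moreover have "additive_subgroup ({0} :: 'k set)" by (simp add: additive_subgroup_def)
  moreover have "{0} \<subseteq> W" using W by (simp add: additive_subgroup_def)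
  ultimately show ?thesis by blast
qed

section \<open>The extension defined by a linear polynomial\<close>

text \<open>Every element is a polynomial in \<open>y\<close>, so the map is forced;
  \<open>rel\<close> says that two polynomials with the same value at \<open>y\<close> also have the
  same value at \<open>Y\<close>, which makes it well defined.\<close>

lemma ex_hom_extension:
  assumes "field_hom \<iota>" "field_hom \<theta>"
    and gen: "\<And>z. \<exists>c. z = field_hom.ev \<iota> y c"
    and rel: "\<And>c. field_hom.ev \<iota> y c = 0 \<Longrightarrow> field_hom.ev \<theta> Y c = 0"
  shows "\<exists>\<Phi>. field_hom \<Phi> \<and> (\<forall>a. \<Phi> (\<iota> a) = \<theta> a) \<and> \<Phi> y = Y"
proof -
  interpret i: field_hom \<iota> by fact
  interpret t: field_hom \<theta> by fact
  define \<Phi> where "\<Phi> z = t.ev Y (SOME c. z = i.ev y c)" for z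
  have \<Phi>: "\<Phi> (i.ev y c) = t.ev Y c" for c
  proof -
    have "i.ev y c = i.ev y (SOME d. i.ev y c = i.ev y d)" by (rule someI) (rule refl)
    then have "i.ev y (c - (SOME d. i.ev y c = i.ev y d)) = 0" by (simp add: i.ev_diff)
    from rel[OF this] show ?thesis by (simp add: \<Phi>_def t.ev_diff)
  qed
  have "field_embedding \<Phi>"
    unfolding field_embedding_def
  proof (intro conjI allI)
    show "\<Phi> 1 = 1" using \<Phi>[of 1] by simp
    fix a b
    obtain c d where "a = i.ev y c" "b = i.ev y d" using gen by metis
    then show "\<Phi> (a + b) = \<Phi> a + \<Phi> b" "\<Phi> (a * b) = \<Phi> a * \<Phi> b"
      using \<Phi>[of "c + d"] \<Phi>[of "c * d"] \<Phi> by (simp_all add: i.ev_add i.ev_mult t.ev_add t.ev_mult)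
  qed
  moreover have "\<Phi> (\<iota> a) = \<theta> a" for a using \<Phi>[of "[:a:]"] by simp
  moreover have "\<Phi> y = Y" using \<Phi>[of "[:0, 1:]"] by simp
  ultimately show ?thesis by (auto intro: field_hom.intro)
qed

sublocale field_hom \<subseteq> vs: vector_space "\<lambda>c v. \<iota> c * v"
  by standard (simp_all add: hom_add hom_mult algebra_simps)

text \<open>The trace polynomial is abstracted to a monic additive \<open>T\<close> with
  \<open>degree T\<close> distinct roots in K. Then the roots of T(Y) - f in E are exactly the
  translates of \<open>y\<close> by the roots of \<open>T\<close>.\<close>

locale linear_extension =
  \<kappa>: field_hom \<kappa> + \<iota>: field_hom \<iota>
  for \<kappa> :: "'k::field \<Rightarrow> 'f::field" and \<iota> :: "'f \<Rightarrow> 'e::field" +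
  fixes p :: nat and T :: "'k poly" and f :: 'f and y :: 'e
  assumes p: "prime p" "CHAR('k) = p"
    and T: "linear_poly p T" "lead_coeff T = 1" "card {v. poly T v = 0} = degree T"
    and y: "poly (map_poly (\<iota> \<circ> \<kappa>) T) y = \<iota> f"
    and not_image: "\<not> (\<exists>L r. linear_poly p L \<and> degree L > 1 \<and> f = poly (map_poly \<kappa> L) r)"
    and generated: "adjoin \<iota> y = UNIV"
begin

sublocale \<iota>\<kappa>: field_hom "\<iota> \<circ> \<kappa>"
  by (rule field_hom_comp) unfold_locales

definition M :: "'f poly" where "M = map_poly \<kappa> T - [:f:]"

abbreviation V where "V \<equiv> {v. poly T v = 0}"

lemma CHAR_e: "CHAR('e) = p"
  using \<iota>\<kappa>.CHAR_eq_hom p by simp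

lemma ev_map_\<kappa>: "\<iota>.ev z (map_poly \<kappa> c) = \<iota>\<kappa>.ev z c"
  unfolding \<iota>.ev_def \<iota>\<kappa>.ev_def by (subst map_poly_map_poly) simp_all

lemma T_nz: "T \<noteq> 0" using T(2) by auto

lemma finite_V: "finite V" using T_nz by (rule poly_roots_finite)

lemma T_add: "poly T (a + b) = poly T a + poly T b"
  using poly_linear_poly_add[OF T(1) p] .

lemma zero_in_V: "0 \<in> V"
  using T_add[of 0 0] unfolding add_0_right mem_Collect_eq by (rule add_cancel_right_right[THEN iffD1])

lemma degree_T_pos: "degree T > 0"
proof -
  have "card V \<noteq> 0" using zero_in_V finite_V by (metis card_0_eq empty_iff)
  then show ?thesis unfolding T(3) by (rule neq0_conv[THEN iffD1])
qed

lemma degree_M: "degree M = degree T"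
  using degree_add_eq_left[of "- [:f:]" "map_poly \<kappa> T"] degree_T_pos
  by (simp add: M_def diff_conv_add_uminus del: add_uminus_conv_diff)

lemma lead_coeff_M: "lead_coeff M = 1"
  using T(2) degree_T_pos
  by (cases "degree T") (auto simp: degree_M, auto simp: M_def coeff_map_poly coeff_pCons)

lemma M_nz: "M \<noteq> 0" using lead_coeff_M by auto

lemma ev_M: "\<iota>.ev y M = 0"
  using y by (simp add: M_def \<iota>.ev_diff ev_map_\<kappa> \<iota>\<kappa>.ev_def)

lemma ev_mod: "\<iota>.ev y d = 0 \<Longrightarrow> \<iota>.ev y (c mod d) = \<iota>.ev y c"
proof -
  assume "\<iota>.ev y d = 0"
  then have "\<iota>.ev y (c div d * d + c mod d) = \<iota>.ev y (c mod d)"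
    by (simp only: \<iota>.ev_add \<iota>.ev_mult) simp
  then show ?thesis by simp
qed

text \<open>If the minimal polynomial \<open>m\<close> of \<open>y\<close> had smaller degree, its roots would be the translates
  of \<open>y\<close> by a proper subgroup \<open>G\<close> of the roots of \<open>T\<close>. With \<open>A\<close> the linear polynomial of \<open>G\<close>, the
  element \<open>A(y) = - m(0)\<close> is in the base field, and \<open>T\<close> factors as \<open>L \<circ> A\<close>.\<close>

lemma min_degree:
  assumes "c \<noteq> 0" "\<iota>.ev y c = 0"
  shows "degree T \<le> degree c"
proof (rule ccontr)
  assume less: "\<not> degree T \<le> degree c"
  obtain m0 where m0: "m0 \<noteq> 0" "\<iota>.ev y m0 = 0"
    and m0_min: "\<And>d. d \<noteq> 0 \<Longrightarrow> \<iota>.ev y d = 0 \<Longrightarrow> degree m0 \<le> degree d"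
    using ex_has_least_nat[of "\<lambda>d. d \<noteq> 0 \<and> \<iota>.ev y d = 0" c degree] assms by blast
  define m where "m = smult (inverse (lead_coeff m0)) m0"
  have m: "m \<noteq> 0" "\<iota>.ev y m = 0" "lead_coeff m = 1" and deg_m: "degree m = degree m0"
    using m0 by (auto simp: m_def \<iota>.ev_smult)
  have m_min: "d = 0" if "\<iota>.ev y d = 0" "degree d < degree m" for d
    using m0_min[of d] that deg_m by auto
  have mT: "degree m < degree T" using m0_min[OF assms] less deg_m by simp
  have deg0: "degree m > 0"
  proof (rule ccontr)
    assume "\<not> degree m > 0"
    then obtain a where "m = [:a:]" by (auto elim: degree_eq_zeroE)
    then show False using m by simp
  qed
  have "M mod m = 0"
    using m_min[of "M mod m"] ev_mod[OF m(2), of M] ev_M degree_mod_less[OF m(1), of M] by auto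
  then obtain e where e: "M = m * e" by (metis dvdE mod_0_imp_dvd)
  then have e0: "e \<noteq> 0" using M_nz by auto
  have deg_e: "degree T = degree m + degree e"
    using e m(1) e0 degree_M by (simp add: degree_mult_eq)
  define tr where "tr v = y + \<iota> (\<kappa> v)" for v
  have tr_inj: "inj tr" by (rule injI) (simp add: tr_def)
  define G where "G = {v \<in> V. \<iota>.ev (tr v) m = 0}"
  have finG: "finite G" using finite_V by (auto simp: G_def)
  have card_le: "card {v. \<iota>.ev (tr v) d = 0} \<le> degree d" if "d \<noteq> 0" for d
  proof -
    have "card {v. \<iota>.ev (tr v) d = 0} = card (tr ` {v. \<iota>.ev (tr v) d = 0})"
      by (rule card_image[symmetric]) (rule inj_on_subset[OF tr_inj], simp)
    also have "\<dots> \<le> card {x. poly (map_poly \<iota> d) x = 0}"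
      using that by (intro card_mono poly_roots_finite) (auto simp: \<iota>.ev_def)
    also have "\<dots> \<le> degree d"
      using card_poly_roots_bound[of "map_poly \<iota> d"] that by simp
    finally show ?thesis .
  qed
  have fin: "finite {v. \<iota>.ev (tr v) d = 0}" if "d \<noteq> 0" for d
  proof -
    have "finite (tr -` {x. poly (map_poly \<iota> d) x = 0})"
      using that by (intro finite_vimageI poly_roots_finite tr_inj) auto
    then show ?thesis by (simp add: vimage_def \<iota>.ev_def)
  qed
  have M_tr: "\<iota>.ev (tr v) M = 0" if "v \<in> V" for v
  proof -
    have "\<iota>.ev (tr v) M = \<iota>\<kappa>.ev y T + \<iota>\<kappa>.ev ((\<iota> \<circ> \<kappa>) v) T - \<iota> f"
      using \<iota>\<kappa>.ev_linear_poly_add[OF T(1) p(1) CHAR_e, of y "(\<iota> \<circ> \<kappa>) v"]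
      by (simp add: M_def \<iota>.ev_diff ev_map_\<kappa> tr_def)
    then show ?thesis using that y by (simp add: \<iota>\<kappa>.ev_def[of y] \<iota>\<kappa>.ev_hom del: comp_apply)
  qed
  \<comment> \<open>At each of the deg T translates of \<open>y\<close> one of the factors
    \<open>m\<close>, \<open>e\<close> of \<open>M\<close> vanishes, and \<open>e\<close> vanishes
    at no more than deg e of them. So all deg m roots of \<open>m\<close> are translates.\<close>
  have "V \<subseteq> G \<union> {v. \<iota>.ev (tr v) e = 0}"
    using M_tr by (auto simp: G_def e \<iota>.ev_mult)
  then have "card V \<le> card (G \<union> {v. \<iota>.ev (tr v) e = 0})"
    using finG fin[OF e0] by (intro card_mono) auto
  also have "\<dots> \<le> card G + degree e"
    using card_Un_le[of G "{v. \<iota>.ev (tr v) e = 0}"] card_le[OF e0] by linarith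
  finally have "degree m \<le> card G" using deg_e T(3) by simp
  moreover have "card G \<le> degree m"
    using card_le[OF m(1)] card_mono[OF fin[OF m(1)], of G] by (force simp: G_def)
  ultimately have card_G: "card G = degree m" by simp
  \<comment> \<open>m(X + v) and m are monic of the same degree and both vanish at \<open>y\<close>;
    their difference has smaller degree, so minimality makes it 0. This invariance under translation
    is what makes \<open>G\<close> a group.\<close>
  have shift: "pcompose m [:\<kappa> v, 1:] = m" if "v \<in> G" for v
  proof -
    let ?m = "pcompose m [:\<kappa> v, 1:]"
    have "\<iota>.ev y (?m - m) = 0"
      using that m(2) by (simp add: \<iota>.ev_diff \<iota>.ev_pcompose \<iota>.ev_pCons G_def tr_def add.commute)
    moreover have "degree (?m - m) < degree m"
    proof (rule degree_lessI)
      show "?m - m \<noteq> 0 \<or> degree m > 0" using deg0 by simp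
      have "degree ?m = degree m" by (simp add: degree_pcompose)
      moreover have "lead_coeff ?m = 1"
        using m(3) lead_coeff_comp[of "[:\<kappa> v, 1:]" m] by simp
      ultimately show "\<forall>k\<ge>degree m. coeff (?m - m) k = 0"
        using m(3) by (auto simp: le_less coeff_eq_0)
    qed
    ultimately have "?m - m = 0" by (rule m_min)
    then show ?thesis by simp
  qed
  have sgG: "additive_subgroup G"
    unfolding additive_subgroup_def
  proof (intro conjI ballI)
    show "0 \<in> G" using zero_in_V m(2) by (simp add: G_def tr_def)
    fix v w assume vw: "v \<in> G" "w \<in> G"
    have "\<iota>.ev (tr w) (pcompose m [:\<kappa> v, 1:]) = \<iota>.ev (tr (v + w)) m"
      by (simp add: \<iota>.ev_pcompose \<iota>.ev_pCons tr_def \<kappa>.hom_add \<iota>.hom_add algebra_simps)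
    then show "v + w \<in> G" using vw shift[OF vw(1)] T_add by (simp add: G_def)
  qed
  obtain A where A: "is_subgroup_poly p G A" using ex_subgroup_poly[OF p sgG finG] by blast
  then have A': "linear_poly p A" "lead_coeff A = 1" "degree A = degree m" "{x. poly A x = 0} = G"
    using card_G by (auto simp: is_subgroup_poly_def)
  have A_add: "poly A (a + b) = poly A a + poly A b" for a b
    using poly_linear_poly_add[OF A'(1) p] .
  \<comment> \<open>A(X - y) is monic with the roots y + v for v in \<open>G\<close>, and so is
    \<open>m\<close>. Their equality, read at X = 0, places A(y) in the image of F.\<close>
  let ?B = "pcompose (map_poly (\<iota> \<circ> \<kappa>) A) [:- y, 1:]"
  have ev_A: "\<iota>\<kappa>.ev (\<iota> (\<kappa> v)) A = 0" if "v \<in> G" for v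
    using that A'(4) \<iota>\<kappa>.ev_hom[of v A] by auto
  have "?B = map_poly \<iota> m"
  proof (rule poly_eqI_degree_lead_coeff[where n = "degree m" and A = "tr ` G"])
    show "degree ?B \<le> degree m" "degree (map_poly \<iota> m) \<le> degree m"
      using A'(3) by (simp_all add: degree_pcompose)
    show "degree m \<le> card (tr ` G)" using card_G card_image[OF inj_on_subset[OF tr_inj], of G] by simp
    have "lead_coeff ?B = 1"
      using A'(2) lead_coeff_comp[of "[:- y, 1:]" "map_poly (\<iota> \<circ> \<kappa>) A"] by (simp add: coeff_map_poly)
    then show "coeff ?B (degree m) = coeff (map_poly \<iota> m) (degree m)"
      using A'(3) m(3) by (simp add: degree_pcompose coeff_map_poly)
    fix z assume "z \<in> tr ` G"
    then obtain v where v: "v \<in> G" "z = tr v" by blast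
    then show "poly ?B z = poly (map_poly \<iota> m) z"
      using ev_A[OF v(1)] by (simp add: poly_pcompose \<iota>.ev_def[symmetric] \<iota>\<kappa>.ev_def[symmetric] G_def tr_def)
  qed
  then have "poly ?B 0 = poly (map_poly \<iota> m) 0" by simp
  then have "\<iota>\<kappa>.ev (- y) A = \<iota> (poly m 0)"
    using \<iota>.ev_hom[of 0 m] by (simp add: poly_pcompose \<iota>.ev_def[symmetric] \<iota>\<kappa>.ev_def[symmetric])
  moreover have "\<iota>\<kappa>.ev (- y) A + \<iota>\<kappa>.ev y A = \<iota>\<kappa>.ev 0 A"
    using \<iota>\<kappa>.ev_linear_poly_add[OF A'(1) p(1) CHAR_e, of "- y" y] by simp
  moreover have "\<iota>\<kappa>.ev 0 A = 0" using ev_A[of 0] sgG by (simp add: additive_subgroup_def)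
  ultimately have Ay: "\<iota>\<kappa>.ev y A = \<iota> (- poly m 0)"
    by (simp add: \<iota>.hom_uminus add_eq_0_iff)
  \<comment> \<open>If \<open>T\<close> is to factor as L(A(X)), the outer polynomial must vanish on
    the image of the roots of \<open>T\<close> under \<open>A\<close>.\<close>
  define W where "W = poly A ` V"
  have sgW: "additive_subgroup W"
    unfolding additive_subgroup_def
  proof (intro conjI ballI)
    have "poly A 0 = 0" using sgG A'(4) by (auto simp: additive_subgroup_def)
    then show "0 \<in> W" using zero_in_V by (force simp: W_def)
    fix a b assume "a \<in> W" "b \<in> W"
    then obtain v w where "v \<in> V" "w \<in> V" "a = poly A v" "b = poly A w" by (auto simp: W_def)
    then show "a + b \<in> W" using A_add T_add by (auto simp: W_def intro!: image_eqI[of _ _ "v + w"])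
  qed
  have finW: "finite W" using finite_V by (simp add: W_def)
  obtain L where "is_subgroup_poly p W L" using ex_subgroup_poly[OF p sgW finW] by blast
  then have L: "linear_poly p L" "lead_coeff L = 1" "degree L = card W" "{x. poly L x = 0} = W"
    by (auto simp: is_subgroup_poly_def)
  \<comment> \<open>\<open>A\<close> is additive with kernel \<open>G\<close> on \<open>V\<close>,
    so its fibres are cosets of \<open>G\<close>. Hence |V| = |W| |G|, and L(A(X)) gets the degree
    of \<open>T\<close>.\<close>
  have fibre: "card {v \<in> V. poly A v = w} = card G" if "w \<in> W" for w
  proof -
    obtain v where v: "v \<in> V" "poly A v = w" using \<open>w \<in> W\<close> unfolding W_def by blast
    have sub: "poly A (a - b) = poly A a - poly A b" for a b using A_add[of "a - b" b] by simp
    have subT: "poly T (a - b) = poly T a - poly T b" for a b using T_add[of "a - b" b] by simp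
    have GV: "g \<in> G \<longleftrightarrow> poly A g = 0" for g using A'(4) by blast
    have "g \<in> G \<Longrightarrow> poly T g = 0" for g by (simp add: G_def)
    then have "bij_betw (\<lambda>g. g + v) G {v \<in> V. poly A v = w}"
      using v by (intro bij_betwI[where g = "\<lambda>x. x - v"]) (auto simp: A_add T_add sub subT GV)
    then show ?thesis by (rule bij_betw_same_card[symmetric])
  qed
  have "card V = card (\<Union>w\<in>W. {v \<in> V. poly A v = w})"
    by (rule arg_cong[where f=card]) (auto simp: W_def)
  also have "\<dots> = (\<Sum>w\<in>W. card {v \<in> V. poly A v = w})"
    using finW finite_V by (intro card_UN_disjoint) auto
  finally have card_V: "card V = card W * card G" using fibre by simp
  have "pcompose L A = T"
  proof (rule poly_eqI_degree_lead_coeff[where n = "degree T" and A = V])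
    have d: "degree (pcompose L A) = degree T"
      using card_V T(3) L(3) A'(3) card_G by (simp add: degree_pcompose)
    then show "degree (pcompose L A) \<le> degree T" "degree T \<le> degree T" "degree T \<le> card V"
      using T(3) by simp_all
    have "lead_coeff (pcompose L A) = 1"
      using lead_coeff_comp[of A L] deg0 A'(2,3) L(2) by simp
    then show "coeff (pcompose L A) (degree T) = coeff T (degree T)"
      using d T(2) by simp
    fix z assume "z \<in> V"
    then have "poly A z \<in> W" by (simp add: W_def)
    then show "poly (pcompose L A) z = poly T z"
      using L(4) \<open>z \<in> V\<close> by (auto simp: poly_pcompose)
  qed
  then have "\<iota> f = \<iota>\<kappa>.ev y (pcompose L A)"
    using y by (simp add: \<iota>\<kappa>.ev_def)
  also have "\<dots> = \<iota>.ev (\<iota> (- poly m 0)) (map_poly \<kappa> L)"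
    by (simp add: \<iota>\<kappa>.ev_pcompose Ay ev_map_\<kappa>)
  also have "\<dots> = \<iota> (poly (map_poly \<kappa> L) (- poly m 0))"
    by (rule \<iota>.ev_hom)
  finally have "f = poly (map_poly \<kappa> L) (- poly m 0)" by simp
  \<comment> \<open>Otherwise |V| \<le> |G| = deg m, against deg m < deg T.\<close>
  moreover have "degree L > 1"
  proof (rule ccontr)
    assume "\<not> degree L > 1"
    then have "card W * card G \<le> 1 * card G" using L(3) by (intro mult_le_mono) auto
    then show False using card_V card_G mT T(3) by simp
  qed
  ultimately show False using not_image L(1) by blast
qed

lemma M_dvd:
  assumes "\<iota>.ev y c = 0"
  shows "M dvd c"
proof -
  have "c mod M = 0"
  proof (rule ccontr)
    assume *: "c mod M \<noteq> 0"
    then have "degree T \<le> degree (c mod M)"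
      using ev_mod[OF ev_M, of c] assms by (intro min_degree) auto
    then show False using degree_mod_less[OF M_nz, of c] * degree_M by simp
  qed
  then show ?thesis by auto
qed

lemma degree_mod_M: "degree (c mod M) < degree T"
  using degree_mod_less[OF M_nz, of c] degree_M degree_T_pos by auto

lemma ev_mod_M: "\<iota>.ev y (c mod M) = \<iota>.ev y c"
  using ev_mod[OF ev_M] .

text \<open>The polynomials whose value at \<open>y\<close> is a multiple of c(y) by some u(y)
  contain \<open>M\<close> and are closed under remainders, so a nonzero one of least degree,
  \<open>d\<close>, divides \<open>M\<close>. As d(y) \<noteq> 0, the cofactor vanishes at
  \<open>y\<close> and has full degree by \<open>min_degree\<close>; hence \<open>d\<close> is a
  constant, and u(y) is the inverse up to that constant.\<close>

lemma ev_inverse: "\<exists>d. inverse (\<iota>.ev y c) = \<iota>.ev y d"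
proof (cases "\<iota>.ev y c = 0")
  case True
  then show ?thesis by (metis \<iota>.ev_0 inverse_zero)
next
  case False
  let ?I = "\<lambda>d. d \<noteq> 0 \<and> (\<exists>u. \<iota>.ev y d = \<iota>.ev y c * \<iota>.ev y u)"
  have "?I (c mod M)"
    using False ev_mod_M[of c] by (auto intro: exI[of _ 1])
  then obtain d where d: "?I d" "\<And>d'. ?I d' \<Longrightarrow> degree d \<le> degree d'"
    using ex_has_least_nat[of ?I "c mod M" degree] by blast
  then obtain u where u: "\<iota>.ev y d = \<iota>.ev y c * \<iota>.ev y u" by blast
  have "degree d < degree T" using d(2)[OF \<open>?I (c mod M)\<close>] degree_mod_M[of c] by simp
  then have ev_d: "\<iota>.ev y d \<noteq> 0" using min_degree[of d] d(1) by auto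
  have "M mod d = 0"
  proof (rule ccontr)
    assume *: "M mod d \<noteq> 0"
    have "\<iota>.ev y (M mod d) = \<iota>.ev y (M - M div d * d)" by (simp add: minus_div_mult_eq_mod)
    also have "\<dots> = \<iota>.ev y c * \<iota>.ev y (- (M div d) * u)"
      by (simp add: \<iota>.ev_diff \<iota>.ev_mult \<iota>.ev_uminus ev_M u)
    finally have "degree d \<le> degree (M mod d)" using * by (intro d(2)) blast
    then show False using degree_mod_less[of d M] d(1) * by auto
  qed
  then obtain e where e: "M = d * e" by (metis dvdE mod_0_imp_dvd)
  then have "e \<noteq> 0" using M_nz by auto
  moreover have "\<iota>.ev y e = 0" using ev_M ev_d e by (simp add: \<iota>.ev_mult)
  ultimately have "degree T \<le> degree e" by (rule min_degree)
  moreover have "degree T = degree d + degree e"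
    using e d(1) \<open>e \<noteq> 0\<close> degree_M by (simp add: degree_mult_eq)
  ultimately have "degree d = 0" by simp
  then obtain a where a: "d = [:a:]" "a \<noteq> 0" using d(1) by (auto elim: degree_eq_zeroE)
  then have "\<iota>.ev y c * (\<iota>.ev y u * \<iota> (inverse a)) = 1"
    using u by (metis \<iota>.ev_const \<iota>.hom_eq_0_iff \<iota>.hom_inverse mult.assoc right_inverse)
  then have "inverse (\<iota>.ev y c) = \<iota>.ev y (u * [:inverse a:])"
    by (simp add: \<iota>.ev_mult inverse_unique del: mult_pCons_right)
  then show ?thesis by blast
qed

lemma ex_ev: "\<exists>c. z = \<iota>.ev y c"
proof -
  have "is_subfield (range (\<iota>.ev y))"
    unfolding is_subfield_def
  proof (intro conjI ballI)
    show "1 \<in> range (\<iota>.ev y)" by (metis \<iota>.ev_1 rangeI)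
    fix a assume "a \<in> range (\<iota>.ev y)"
    then show "inverse a \<in> range (\<iota>.ev y)" using ev_inverse by auto
    fix b assume "b \<in> range (\<iota>.ev y)"
    then show "a - b \<in> range (\<iota>.ev y)" "a * b \<in> range (\<iota>.ev y)"
      using \<open>a \<in> _\<close> by (auto simp flip: \<iota>.ev_diff \<iota>.ev_mult)
  qed
  moreover have "range \<iota> \<subseteq> range (\<iota>.ev y)" by (metis \<iota>.ev_const image_subsetI rangeI)
  moreover have "y \<in> range (\<iota>.ev y)" by (metis \<iota>.ev_X rangeI)
  ultimately have "adjoin \<iota> y \<subseteq> range (\<iota>.ev y)" unfolding adjoin_def by blast
  then show ?thesis using generated by blast
qed

lemma span_powers: "\<iota>.vs.span ((\<lambda>i. y ^ i) ` {..<degree T}) = UNIV"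
proof -
  have "z \<in> \<iota>.vs.span ((\<lambda>i. y ^ i) ` {..<degree T})" for z
  proof -
    obtain c where c: "z = \<iota>.ev y c" using ex_ev by blast
    have "z = \<iota>.ev y (c mod M)" using c ev_mod_M by simp
    also have "\<dots> = (\<Sum>i\<le>degree (c mod M). \<iota> (coeff (c mod M) i) * y ^ i)" by (rule \<iota>.ev_altdef) simp
    also have "\<dots> \<in> \<iota>.vs.span ((\<lambda>i. y ^ i) ` {..<degree T})"
      using degree_mod_M[of c]
      by (intro \<iota>.vs.span_sum \<iota>.vs.span_scale \<iota>.vs.span_base imageI) auto
    finally show ?thesis .
  qed
  then show ?thesis by blast
qed

lemma finite_ext: "finite_extension \<iota>"
  unfolding finite_extension_def using span_powers by blast

lemma powers_independent:
  assumes "(\<Sum>i<degree T. \<iota> (a i) * y ^ i) = 0" "j < degree T"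
  shows "a j = 0"
proof -
  let ?c = "\<Sum>i<degree T. monom (a i) i"
  have "\<iota>.ev y ?c = 0" using assms(1) by (simp add: \<iota>.ev_sum \<iota>.ev_monom)
  moreover have "degree ?c < degree T"
    by (rule degree_sum_less) (auto intro: le_less_trans[OF degree_monom_le] simp: degree_T_pos)
  ultimately have "?c = 0" using min_degree[of ?c] by auto
  moreover have "coeff ?c j = a j" using assms(2) by (simp add: coeff_sum)
  ultimately show ?thesis by simp
qed

lemma extension_degree_eq: "extension_degree \<iota> = degree T"
proof -
  let ?B = "(\<lambda>i. y ^ i) ` {..<degree T}"
  have inj: "inj_on (\<lambda>i. y ^ i) {..<degree T}"
  proof (rule inj_onI, rule ccontr)
    fix i j assume *: "i \<in> {..<degree T}" "j \<in> {..<degree T}" "y ^ i = y ^ j" "i \<noteq> j"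
    have "(\<Sum>l<degree T. \<iota> (if l = i then 1 else if l = j then - 1 else 0) * y ^ l)
      = (\<Sum>l<degree T. (if l = i then y ^ l else 0) - (if l = j then y ^ l else 0))"
      using *(4) by (intro sum.cong) (auto simp: \<iota>.hom_uminus)
    also have "\<dots> = 0" using * by (simp add: sum_subtractf)
    finally show False using powers_independent[of _ i] *(1) by fastforce
  qed
  have "\<iota>.vs.independent ?B"
  proof (rule \<iota>.vs.independent_if_scalars_zero)
    fix u x assume *: "(\<Sum>x\<in>?B. \<iota> (u x) * x) = 0" "x \<in> ?B"
    then have "(\<Sum>i<degree T. \<iota> (u (y ^ i)) * y ^ i) = 0" by (simp add: sum.reindex[OF inj])
    then show "u x = 0" using powers_independent[of "\<lambda>i. u (y ^ i)"] *(2) by auto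
  qed simp
  then have "\<iota>.vs.dim UNIV = card ?B"
    using span_powers by (intro \<iota>.vs.dim_unique[of ?B]) auto
  then show ?thesis using card_image[OF inj] by (simp add: extension_degree_def)
qed

text \<open>All relations of \<open>y\<close> over F are multiples of \<open>M\<close>, so any root
  of the transported equation may serve as the image of \<open>y\<close>.\<close>

lemma ex_hom_generated:
  assumes "field_hom \<theta>" and Y: "poly (map_poly (\<theta> \<circ> \<kappa>) T) Y = \<theta> f"
  shows "\<exists>\<Phi>. field_hom \<Phi> \<and> (\<forall>a. \<Phi> (\<iota> a) = \<theta> a) \<and> \<Phi> y = Y"
proof -
  interpret t: field_hom \<theta> by fact
  have M: "t.ev Y M = 0"
    using Y by (simp add: M_def t.ev_diff) (simp add: t.ev_def map_poly_map_poly comp_def)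
  show ?thesis
  proof (rule ex_hom_extension)
    fix c assume "\<iota>.ev y c = 0"
    then obtain d where "c = M * d" using M_dvd by blast
    then show "t.ev Y c = 0" using M by (simp add: t.ev_mult)
  qed (use ex_ev in \<open>unfold_locales; blast\<close>)+
qed

end

section \<open>Valuation rings and places\<close>

text \<open>For the strict inclusion of the constants: the inverse of \<open>z0\<close> lies in
  \<O>, and if it were a constant, then so would \<open>z0\<close> be.\<close>

lemma valuation_ringI:
  assumes "field_hom \<kappa>" and "range \<kappa> \<subseteq> \<O>" and ex: "z0 \<notin> \<O>"
    and "\<And>a b. a \<in> \<O> \<Longrightarrow> b \<in> \<O> \<Longrightarrow> a - b \<in> \<O>"
    and "\<And>a b. a \<in> \<O> \<Longrightarrow> b \<in> \<O> \<Longrightarrow> a * b \<in> \<O>"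
    and val: "\<And>z. z \<noteq> 0 \<Longrightarrow> z \<notin> \<O> \<Longrightarrow> inverse z \<in> \<O>"
  shows "valuation_ring \<kappa> \<O>"
proof -
  interpret field_hom \<kappa> by fact
  have "\<not> \<O> \<subseteq> range \<kappa>"
  proof
    assume sub: "\<O> \<subseteq> range \<kappa>"
    have "z0 \<noteq> 0" using ex assms(2) hom_0 by (metis rangeI subsetD)
    then obtain a where "inverse z0 = \<kappa> a" using val ex sub by blast
    then have "z0 = \<kappa> (inverse a)" by (metis hom_inverse inverse_inverse_eq)
    then show False using ex assms(2) by blast
  qed
  then show ?thesis using assms unfolding valuation_ring_def by blast
qed

context
  fixes \<kappa> :: "'k::field \<Rightarrow> 'e::field" and \<O>
  assumes \<kappa>: "field_hom \<kappa>" and \<O>: "valuation_ring \<kappa> \<O>"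
begin

interpretation field_hom \<kappa> by (rule \<kappa>)

abbreviation (input) nonunits where "nonunits \<equiv> {z. z = 0 \<or> inverse z \<notin> \<O>}"

lemma vr_1: "1 \<in> \<O>" and vr_diff: "a \<in> \<O> \<Longrightarrow> b \<in> \<O> \<Longrightarrow> a - b \<in> \<O>"
  and vr_mult: "a \<in> \<O> \<Longrightarrow> b \<in> \<O> \<Longrightarrow> a * b \<in> \<O>"
  and vr_val: "z \<noteq> 0 \<Longrightarrow> z \<notin> \<O> \<Longrightarrow> inverse z \<in> \<O>"
proof -
  have r: "range \<kappa> \<subseteq> \<O>" and c: "\<forall>a\<in>\<O>. \<forall>b\<in>\<O>. a - b \<in> \<O> \<and> a * b \<in> \<O>"
    and v: "\<forall>z. z \<noteq> 0 \<longrightarrow> z \<in> \<O> \<or> inverse z \<in> \<O>"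
    using \<O> unfolding valuation_ring_def by (elim conjE, simp only: psubset_imp_subset)+
  show "1 \<in> \<O>" using subsetD[OF r rangeI[of \<kappa> 1]] by simp
  show "a \<in> \<O> \<Longrightarrow> b \<in> \<O> \<Longrightarrow> a - b \<in> \<O>" "a \<in> \<O> \<Longrightarrow> b \<in> \<O> \<Longrightarrow> a * b \<in> \<O>" using c by blast+
  show "z \<noteq> 0 \<Longrightarrow> z \<notin> \<O> \<Longrightarrow> inverse z \<in> \<O>" using v by blast
qed

lemma vr_0: "0 \<in> \<O>" using vr_diff[OF vr_1 vr_1] by simp

lemma vr_add: "a + b \<in> \<O>" if "a \<in> \<O>" "b \<in> \<O>"
proof -
  have "a - (0 - b) \<in> \<O>" by (intro vr_diff vr_0 that)
  then show ?thesis by simp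
qed

text \<open>For sums: one of a/b and b/a lies in \<O>, say a/b. Then a + b is b times the element
  a/b + 1 of \<O>, so an inverse of a + b in \<O> would put the inverse of b into \<O>.\<close>

lemma nonunits_ideal: "is_ideal \<O> nonunits"
  unfolding is_ideal_def
proof (intro conjI ballI)
  show "nonunits \<subseteq> \<O>"
  proof (rule subsetI, rule ccontr)
    fix z assume *: "z \<in> nonunits" "z \<notin> \<O>"
    then have "z \<noteq> 0" using vr_0 by metis
    then show False using * vr_val by blast
  qed
  show "0 \<in> nonunits" by simp
  have add_aux: "a + b \<in> nonunits"
    if "a \<noteq> 0" "b \<noteq> 0" "inverse b \<notin> \<O>" "a * inverse b \<in> \<O>" for a b
  proof (rule ccontr)
    assume "a + b \<notin> nonunits"
    then have *: "a + b \<noteq> 0" "inverse (a + b) \<in> \<O>" by auto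
    then have "(a * inverse b + 1) * inverse (a + b) \<in> \<O>"
      by (intro vr_mult[OF vr_add[OF that(4) vr_1]])
    also have "(a * inverse b + 1) * inverse (a + b) = inverse b"
      using that * by (simp add: field_simps)
    finally show False using that by simp
  qed
  fix a b assume ab: "a \<in> nonunits" "b \<in> nonunits"
  show "a + b \<in> nonunits"
  proof (cases "a = 0 \<or> b = 0")
    case True
    then show ?thesis using ab by auto
  next
    case False
    then have "a * inverse b \<in> \<O> \<or> b * inverse a \<in> \<O>"
      using vr_val[of "a * inverse b"] by (auto simp: mult.commute)
    then show ?thesis using add_aux[of a b] add_aux[of b a] ab False by (auto simp: add.commute)
  qed
next
  fix r a assume ra: "r \<in> \<O>" "a \<in> nonunits"
  show "r * a \<in> nonunits"
  proof (rule ccontr)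
    assume "r * a \<notin> nonunits"
    then have *: "r * a \<noteq> 0" "inverse (r * a) \<in> \<O>" by auto
    then have "r * inverse (r * a) \<in> \<O>" using ra vr_mult by blast
    then show False using ra(2) * by (simp add: field_simps)
  qed
qed

lemma ideal_subset_nonunits:
  assumes "is_ideal \<O> I" "I \<noteq> \<O>"
  shows "I \<subseteq> nonunits"
proof
  fix z assume z: "z \<in> I"
  show "z \<in> nonunits"
  proof (rule ccontr)
    assume *: "z \<notin> nonunits"
    then have "inverse z * z \<in> I" using assms z unfolding is_ideal_def by blast
    then have "1 \<in> I" using * by simp
    then have "r \<in> I" if "r \<in> \<O>" for r
      using that assms(1) unfolding is_ideal_def by (metis mult.right_neutral)
    then show False using assms unfolding is_ideal_def by blast
  qed
qed

lemma nonunits_neq: "nonunits \<noteq> \<O>"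
proof
  assume "nonunits = \<O>"
  then have "1 \<in> nonunits" using vr_1 by simp
  then show False using vr_1 by simp
qed

text \<open>A valuation ring is local: a proper ideal contains no unit, so the ideal of nonunits
  contains every proper ideal and is the only maximal one.\<close>

lemma maximal_ideal_iff_nonunits: "is_maximal_ideal \<O> P \<longleftrightarrow> P = nonunits"
  unfolding is_maximal_ideal_def
  using nonunits_ideal nonunits_neq ideal_subset_nonunits by blast

lemma ring_of_nonunits: "ring_of_place nonunits = \<O>"
  using vr_0 by (auto simp: ring_of_place_def)

end

lemma places_iff:
  assumes "field_hom \<kappa>"
  shows "P \<in> places \<kappa> \<longleftrightarrow>
    (\<exists>\<O>. valuation_ring \<kappa> \<O> \<and> P = {z. z = 0 \<or> inverse z \<notin> \<O>} \<and> ring_of_place P = \<O>)"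
proof -
  have "valuation_ring \<kappa> \<O> \<and> is_maximal_ideal \<O> P \<longleftrightarrow>
    valuation_ring \<kappa> \<O> \<and> P = {z. z = 0 \<or> inverse z \<notin> \<O>} \<and> ring_of_place P = \<O>" for \<O>
    using maximal_ideal_iff_nonunits[OF assms, of \<O> P] ring_of_nonunits[OF assms, of \<O>] by metis
  then show ?thesis unfolding places_def by simp
qed

locale place = field_hom \<kappa> for \<kappa> :: "'k::field \<Rightarrow> 'e::field" +
  fixes P :: "'e set"
  assumes P: "P \<in> places \<kappa>"
begin

abbreviation \<O> where "\<O> \<equiv> ring_of_place P"

lemma valuation_ring: "valuation_ring \<kappa> \<O>" and P_iff: "z \<in> P \<longleftrightarrow> z = 0 \<or> inverse z \<notin> \<O>"
  using P places_iff[OF field_hom_axioms] by blast+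

lemmas O_1 = vr_1[OF field_hom_axioms valuation_ring]
  and O_0 = vr_0[OF field_hom_axioms valuation_ring]
  and O_add = vr_add[OF field_hom_axioms valuation_ring]
  and O_diff = vr_diff[OF field_hom_axioms valuation_ring]
  and O_mult = vr_mult[OF field_hom_axioms valuation_ring]

lemma O_uminus: "a \<in> \<O> \<Longrightarrow> - a \<in> \<O>"
  using O_diff[OF O_0] by fastforce

lemma O_const: "\<kappa> c \<in> \<O>"
  using valuation_ring unfolding valuation_ring_def by blast

lemma O_power: "a \<in> \<O> \<Longrightarrow> a ^ i \<in> \<O>"
  by (induction i) (auto intro: O_1 O_mult)

lemma ex_notin_O: "\<exists>z. z \<notin> \<O>"
  using valuation_ring unfolding valuation_ring_def by blast

lemma P_ideal: "is_ideal \<O> P"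
proof -
  have "P = {z. z = 0 \<or> inverse z \<notin> \<O>}" using P_iff by blast
  then show ?thesis using nonunits_ideal[OF field_hom_axioms valuation_ring] by simp
qed

lemma P_subset_O: "a \<in> P \<Longrightarrow> a \<in> \<O>" and P_0: "0 \<in> P"
  and P_add: "a \<in> P \<Longrightarrow> b \<in> P \<Longrightarrow> a + b \<in> P"
  and P_mult: "r \<in> \<O> \<Longrightarrow> a \<in> P \<Longrightarrow> r * a \<in> P"
  using P_ideal unfolding is_ideal_def by blast+

lemma P_mult_right: "a \<in> P \<Longrightarrow> r \<in> \<O> \<Longrightarrow> a * r \<in> P"
  using P_mult[of r a] by (simp only: mult.commute)

lemma P_uminus: "a \<in> P \<Longrightarrow> - a \<in> P"
  using P_mult[OF O_uminus[OF O_1]] by fastforce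

lemma P_diff: "a \<in> P \<Longrightarrow> b \<in> P \<Longrightarrow> a - b \<in> P"
  using P_add[of a "- b"] P_uminus by simp

lemma one_notin_P: "1 \<notin> P"
  using P_iff[of 1] O_1 by simp

lemma inverse_in_P: "z \<notin> \<O> \<Longrightarrow> inverse z \<in> P"
  using P_iff[of "inverse z"] by simp

lemma inverse_in_O: "z \<notin> P \<Longrightarrow> inverse z \<in> \<O>"
  using P_iff by blast

lemma const_in_P [simp]: "\<kappa> c \<in> P \<longleftrightarrow> c = 0"
  using P_iff[of "\<kappa> c"] O_const[of "inverse c"] by (auto simp: hom_inverse)

lemma P_prime: "a \<in> \<O> \<Longrightarrow> a * b \<in> P \<Longrightarrow> a \<notin> P \<Longrightarrow> b \<in> P"
proof -
  assume *: "a \<in> \<O>" "a * b \<in> P" "a \<notin> P"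
  then have "inverse a * (a * b) \<in> P" by (intro P_mult[OF inverse_in_O])
  moreover have "a \<noteq> 0" using * P_0 by blast
  then have "inverse a * (a * b) = b" by (simp add: mult.assoc[symmetric])
  ultimately show "b \<in> P" by simp
qed

text \<open>The inverse of \<open>u\<close> lies in P, and so does its \<open>m\<close>-th power; if
  u^m were in the ring, the product of the two would put 1 into P.\<close>

lemma power_notin_O: "u \<notin> \<O> \<Longrightarrow> m > 0 \<Longrightarrow> u ^ m \<notin> \<O>"
proof
  assume *: "u \<notin> \<O>" "m > 0" "u ^ m \<in> \<O>"
  have "inverse u \<in> P" using * inverse_in_P by blast
  moreover have "inverse u ^ (m - 1) \<in> \<O>"
    using calculation by (intro O_power P_subset_O)
  ultimately have "inverse u ^ (m - 1) * inverse u \<in> P" by (rule P_mult[rotated])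
  then have "inverse u ^ m \<in> P" using *(2) by (cases m) (simp_all add: mult.commute)
  then have "u ^ m * inverse u ^ m \<in> P" using * P_mult by blast
  moreover have "u \<noteq> 0" using * O_0 by blast
  ultimately show False using one_notin_P by (simp flip: power_mult_distrib)
qed

lemma O_sum: "(\<And>i. i \<in> A \<Longrightarrow> g i \<in> \<O>) \<Longrightarrow> sum g A \<in> \<O>"
  by (induction A rule: infinite_finite_induct) (auto intro: O_0 O_add)

lemma P_sum: "(\<And>i. i \<in> A \<Longrightarrow> g i \<in> P) \<Longrightarrow> sum g A \<in> P"
  by (induction A rule: infinite_finite_induct) (auto intro: P_0 P_add)

lemma one_plus_notin_P: "z \<in> P \<Longrightarrow> 1 + z \<notin> P"
  using P_diff[of "1 + z" z] one_notin_P by auto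

text \<open>The substitute for a coefficient of largest absolute value: no value group is available,
  so sizes are compared by asking whether quotients lie in \<O>. Dividing by the dominant
  coefficient makes all of them integral and one of them 1.\<close>

lemma ex_dominant_coeff:
  assumes "finite I" "\<exists>i\<in>I. a i \<noteq> 0"
  shows "\<exists>j\<in>I. a j \<noteq> 0 \<and> (\<forall>i\<in>I. a i / a j \<in> \<O>)"
  using assms
proof (induction I rule: finite_induct)
  case (insert x I)
  show ?case
  proof (cases "\<exists>i\<in>I. a i \<noteq> 0")
    case True
    then obtain j where j: "j \<in> I" "a j \<noteq> 0" "\<And>i. i \<in> I \<Longrightarrow> a i / a j \<in> \<O>"
      using insert by blast
    show ?thesis
    proof (cases "a x / a j \<in> \<O>")
      case True
      then show ?thesis using j by auto
    next
      case False
      then have inv: "a j / a x \<in> \<O>" using P_subset_O[OF inverse_in_P] by fastforce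
      have "a i / a x \<in> \<O>" if "i \<in> I" for i
        using O_mult[OF j(3)[OF that] inv] j(2) by simp
      moreover have "a x \<noteq> 0" using False O_0 by auto
      ultimately show ?thesis using O_1 by auto
    qed
  next
    case False
    then show ?thesis using insert O_0 O_1 by auto
  qed
qed simp

end

section \<open>Rational places\<close>

text \<open>These functions model the vectors in K^d, in the form in which
  \<open>residue_basis\<close> lists coordinates.\<close>

lemma card_coefficient_functions:
  "card {c::nat \<Rightarrow> 'k::{field,finite}. \<forall>i\<ge>d. c i = 0} = CARD('k) ^ d"
  "finite {c::nat \<Rightarrow> 'k::{field,finite}. \<forall>i\<ge>d. c i = 0}"
proof -
  let ?C = "{c::nat \<Rightarrow> 'k. \<forall>i\<ge>d. c i = 0}"
  have "bij_betw (\<lambda>c. restrict c {..<d}) ?C (PiE {..<d} (\<lambda>_. UNIV))"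
  proof (rule bij_betwI[where g = "\<lambda>c i. if i < d then c i else 0"])
    fix c :: "nat \<Rightarrow> 'k" assume c: "c \<in> ?C"
    show "(\<lambda>i. if i < d then restrict c {..<d} i else 0) = c"
      using c by (auto simp: fun_eq_iff)
  next
    fix c :: "nat \<Rightarrow> 'k" assume c: "c \<in> PiE {..<d} (\<lambda>_. UNIV)"
    show "restrict (\<lambda>i. if i < d then c i else 0) {..<d} = c"
      using c by (auto simp: fun_eq_iff PiE_def extensional_def restrict_def)
  qed auto
  then show "card ?C = CARD('k) ^ d" "finite ?C"
    using bij_betw_same_card bij_betw_finite by (fastforce simp: card_PiE finite_PiE)+
qed

text \<open>The map from K to the residue field is onto; in this form no residue basis has to be
  chosen.\<close>

definition rational_place :: "('k::field \<Rightarrow> 'e::field) \<Rightarrow> 'e set \<Rightarrow> bool" where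
  "rational_place \<kappa> P \<longleftrightarrow> P \<in> places \<kappa> \<and> (\<forall>z\<in>ring_of_place P. \<exists>k. z - \<kappa> k \<in> P)"

text \<open>Over a finite K the invariance of dimension is a matter of counting: passing from
  coordinates in one basis to coordinates in the other embeds K^d into K^d'.\<close>

lemma residue_basis_card_le:
  fixes \<kappa> :: "'k::{field,finite} \<Rightarrow> 'e::field"
  assumes "place \<kappa> P" and b: "residue_basis \<kappa> P d b" and b': "residue_basis \<kappa> P d' b'"
  shows "d \<le> d'"
proof -
  interpret place \<kappa> P by fact
  let ?C = "\<lambda>d. {c::nat \<Rightarrow> 'k. \<forall>i\<ge>d. c i = 0}"
  let ?z = "\<lambda>c. \<Sum>i<d. \<kappa> (c i) * b i" and ?z' = "\<lambda>c. \<Sum>i<d'. \<kappa> (c i) * b' i"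
  have zO: "?z c \<in> \<O>" for c
    using b by (intro O_sum O_mult O_const) (auto simp: residue_basis_def)
  have "\<forall>c\<in>?C d. \<exists>c'. c' \<in> ?C d' \<and> ?z c - ?z' c' \<in> P"
  proof
    fix c
    have "\<exists>!c'. (\<forall>i\<ge>d'. c' i = 0) \<and> ?z c - ?z' c' \<in> P"
      using b' zO[of c] unfolding residue_basis_def by blast
    then show "\<exists>c'. c' \<in> ?C d' \<and> ?z c - ?z' c' \<in> P" by blast
  qed
  then obtain g where g: "\<forall>c\<in>?C d. g c \<in> ?C d' \<and> ?z c - ?z' (g c) \<in> P"
    by (rule bchoice[THEN exE])
  have "inj_on g (?C d)"
  proof (rule inj_onI)
    fix c1 c2 assume c: "c1 \<in> ?C d" "c2 \<in> ?C d" "g c1 = g c2"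
    have "?z c1 - ?z' (g c1) \<in> P" using g c(1) by blast
    moreover have "?z c2 - ?z' (g c1) \<in> P" using g c(2) unfolding c(3) by blast
    ultimately have "(?z c1 - ?z' (g c1)) - (?z c2 - ?z' (g c1)) \<in> P" by (rule P_diff)
    then have "?z c1 - ?z c2 \<in> P" by simp
    moreover have "?z c1 - ?z c1 \<in> P" using P_0 by simp
    moreover have "\<exists>!c. (\<forall>i\<ge>d. c i = 0) \<and> ?z c1 - ?z c \<in> P"
      using b zO[of c1] unfolding residue_basis_def by blast
    ultimately show "c1 = c2" using c by blast
  qed
  then have "card (?C d) \<le> card (?C d')"
    using g card_coefficient_functions(2) by (intro card_inj_on_le[of g]) auto
  then have "CARD('k) ^ d \<le> CARD('k) ^ d'" by (simp only: card_coefficient_functions)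
  moreover have "card {0, 1::'k} \<le> CARD('k)" by (intro card_mono) auto
  then have "CARD('k) > 1" by simp
  ultimately show ?thesis using power_le_imp_le_exp by blast
qed

lemma place_degree_eq_1_iff:
  fixes \<kappa> :: "'k::{field,finite} \<Rightarrow> 'e::field"
  assumes "place \<kappa> P"
  shows "place_degree \<kappa> P = 1 \<longleftrightarrow> (\<forall>z\<in>ring_of_place P. \<exists>k. z - \<kappa> k \<in> P)"
proof
  interpret place \<kappa> P by fact
  have the: "place_degree \<kappa> P = d" if "residue_basis \<kappa> P d b" for d b
  proof -
    have "(THE d. \<exists>b. residue_basis \<kappa> P d b) = d"
      using that residue_basis_card_le[OF assms] by (intro the_equality) (blast intro: antisym)+
    then show ?thesis using that unfolding place_degree_def by auto
  qed
  {
    assume "place_degree \<kappa> P = 1"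
    then have "\<exists>d b. residue_basis \<kappa> P d b" unfolding place_degree_def by (auto split: if_splits)
    then obtain b where b: "residue_basis \<kappa> P 1 b" using the \<open>place_degree \<kappa> P = 1\<close> by metis
    have ex: "\<exists>c. z - \<kappa> c * b 0 \<in> P" if "z \<in> \<O>" for z
    proof -
      have "\<exists>!c. (\<forall>i\<ge>1. c i = 0) \<and> z - (\<Sum>i<1. \<kappa> (c i) * b i) \<in> P"
        using b that unfolding residue_basis_def by blast
      then show ?thesis by auto
    qed
    \<comment> \<open>The basis vector need not be congruent to a constant a priori; expanding 1
      gives a nonzero coordinate \<open>c1\<close>, by which the other coordinates are
      rescaled.\<close>
    obtain c1 where c1: "1 - \<kappa> c1 * b 0 \<in> P" using ex[OF O_1] by blast
    have c1': "c1 \<noteq> 0" using c1 one_notin_P by auto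
    show "\<forall>z\<in>\<O>. \<exists>k. z - \<kappa> k \<in> P"
    proof
      fix z assume "z \<in> \<O>"
      then obtain c where c: "z - \<kappa> c * b 0 \<in> P" using ex by blast
      have "(z - \<kappa> c * b 0) - \<kappa> (c / c1) * (1 - \<kappa> c1 * b 0) \<in> P"
        by (intro P_diff c P_mult O_const c1)
      also have "(z - \<kappa> c * b 0) - \<kappa> (c / c1) * (1 - \<kappa> c1 * b 0) = z - \<kappa> (c / c1)"
        using c1' by (simp add: hom_divide field_simps)
      finally show "\<exists>k. z - \<kappa> k \<in> P" by blast
    qed
  }
  {
    assume r: "\<forall>z\<in>\<O>. \<exists>k. z - \<kappa> k \<in> P"
    have "residue_basis \<kappa> P 1 (\<lambda>_. 1)"
      unfolding residue_basis_def
    proof (intro conjI ballI)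
      fix z assume "z \<in> \<O>"
      then obtain k where k: "z - \<kappa> k \<in> P" using r by blast
      show "\<exists>!c. (\<forall>i\<ge>1::nat. c i = 0) \<and> z - (\<Sum>i<1. \<kappa> (c i) * 1) \<in> P"
      proof (rule ex1I[of _ "\<lambda>i::nat. if i = 0 then k else 0"])
        fix c assume c: "(\<forall>i\<ge>1::nat. c i = 0) \<and> z - (\<Sum>i<1. \<kappa> (c i) * 1) \<in> P"
        then have "z - \<kappa> (c 0) \<in> P" by simp
        from P_diff[OF k this] have "\<kappa> (c 0 - k) \<in> P" by (simp add: hom_diff)
        then have "c 0 = k" by simp
        then show "c = (\<lambda>i. if i = 0 then k else 0)" using c by auto
      qed (use k in auto)
    qed (simp add: O_1)
    then show "place_degree \<kappa> P = 1" by (rule the)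
  }
qed

lemma rational_places_eq:
  fixes \<kappa> :: "'k::{field,finite} \<Rightarrow> 'e::field"
  assumes "field_hom \<kappa>"
  shows "rational_places \<kappa> = {P. rational_place \<kappa> P}"
  using place_degree_eq_1_iff[OF place.intro[OF assms place_axioms.intro]]
  unfolding rational_places_def rational_place_def by blast

text \<open>P \<subseteq> Q reverses to an inclusion of the ring of Q in that of P, so an element of
  Q has a residue k at P. This constant then lies in Q, so it is 0. The lemma turns the inclusion in
  \<open>lies_over\<close> into an equality.\<close>

lemma rational_place_maximal:
  assumes "field_hom \<kappa>" "rational_place \<kappa> P" "Q \<in> places \<kappa>" "P \<subseteq> Q"
  shows "Q = P"
proof -
  interpret P: place \<kappa> P
    using assms by (auto simp: rational_place_def place_def place_axioms_def)
  interpret Q: place \<kappa> Q using assms by (auto simp: place_def place_axioms_def)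
  have "z \<in> P" if "z \<in> Q" for z
  proof -
    have "z \<in> P.\<O>" using Q.P_subset_O[OF that] assms(4) unfolding ring_of_place_def by blast
    then obtain k where k: "z - \<kappa> k \<in> P" using assms(2) unfolding rational_place_def by blast
    then have "z - (z - \<kappa> k) \<in> Q" by (rule Q.P_diff[OF that subsetD[OF assms(4)]])
    then have "\<kappa> k \<in> Q" by (simp only: diff_diff_eq2 add_diff_cancel_left')
    then have "k = 0" using Q.const_in_P by blast
    then show ?thesis using k by simp
  qed
  then show ?thesis using assms(4) by blast
qed

section \<open>Places in finite extensions\<close>

text \<open>There are more powers of \<open>z\<close> than generators. Independence is a property of
  sets, so the case of two coinciding powers is treated separately.\<close>

lemma (in field_hom) finite_extension_algebraic:
  assumes "finite_extension \<iota>"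
  shows "\<exists>c. c \<noteq> 0 \<and> ev z c = 0"
proof -
  obtain B where B: "finite B" "vs.span B = UNIV" using assms unfolding finite_extension_def by blast
  let ?I = "{..card B}"
  show ?thesis
  proof (cases "inj_on (\<lambda>i. z ^ i) ?I")
    case False
    then obtain i j where "i \<noteq> j" "z ^ i = z ^ j" by (auto simp: inj_on_def)
    then have "monom 1 i - monom 1 j \<noteq> (0 :: 'f poly)" "ev z (monom 1 i - monom 1 j) = 0"
      by (auto simp: monom_eq_iff' ev_diff ev_monom)
    then show ?thesis by blast
  next
    case True
    let ?A = "(\<lambda>i. z ^ i) ` ?I"
    have "card ?A = Suc (card B)" using card_image[OF True] by simp
    then have "\<not> vs.independent ?A"
      using vs.independent_span_bound[OF B(1), of ?A] B(2) by auto
    then obtain u x where u: "(\<Sum>x\<in>?A. \<iota> (u x) * x) = 0" "x \<in> ?A" "u x \<noteq> 0"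
      using vs.independent_if_scalars_zero[of ?A] by blast
    let ?c = "\<Sum>i\<le>card B. monom (u (z ^ i)) i"
    have "ev z ?c = 0"
      using u(1) by (simp add: ev_sum ev_monom sum.reindex[OF True])
    moreover obtain i where "i \<le> card B" "x = z ^ i" using u(2) by auto
    then have "coeff ?c i \<noteq> 0" using u(3) by (simp add: coeff_sum)
    then have "?c \<noteq> 0" by (metis coeff_0)
    ultimately show ?thesis by blast
  qed
qed

text \<open>The point is that the restricted ring is not all of F. If it were, nonzero elements of F
  would be units at Q; a nonzero \<open>u\<close> in Q satisfies a polynomial over F, and after
  division by a power of \<open>u\<close> its constant term would be a unit equal to a multiple of
  \<open>u\<close>.\<close>

lemma place_restrict:
  assumes "field_hom \<kappa>" "field_hom \<iota>" "finite_extension \<iota>" "Q \<in> places (\<iota> \<circ> \<kappa>)"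
  shows "\<iota> -` Q \<in> places \<kappa>"
proof -
  interpret \<kappa>: field_hom \<kappa> by fact
  interpret \<iota>: field_hom \<iota> by fact
  interpret Q: place "\<iota> \<circ> \<kappa>" Q
    using field_hom_comp assms by (auto simp: place_def place_axioms_def)
  have "\<exists>a. \<iota> a \<notin> Q.\<O>"
  proof (rule ccontr)
    assume "\<nexists>a. \<iota> a \<notin> Q.\<O>"
    then have \<iota>O: "\<iota> a \<in> Q.\<O>" for a by blast
    have \<iota>P: "\<iota> a \<notin> Q" if "a \<noteq> 0" for a
      using Q.P_iff[of "\<iota> a"] \<iota>O[of "inverse a"] that by (simp add: \<iota>.hom_inverse)
    obtain z where z: "z \<notin> Q.\<O>" using Q.ex_notin_O by blast
    define u where "u = inverse z"
    have u: "u \<in> Q" "u \<noteq> 0" using z Q.inverse_in_P Q.O_0 by (auto simp: u_def)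
    have evO: "\<iota>.ev u c \<in> Q.\<O>" for c
      using \<iota>O u(1) by (induction c) (auto simp: \<iota>.ev_pCons intro: Q.O_add Q.O_mult Q.P_subset_O Q.O_0)
    have "\<iota>.ev u c \<noteq> 0" if "c \<noteq> 0" for c
      using that
    proof (induction c)
      case (pCons a c)
      show ?case
      proof (cases "a = 0")
        case True
        then show ?thesis using pCons u by (simp add: \<iota>.ev_pCons)
      next
        case False
        have "\<iota>.ev u (pCons a c) - u * \<iota>.ev u c \<notin> Q" using \<iota>P[OF False] by (simp add: \<iota>.ev_pCons)
        moreover have "u * \<iota>.ev u c \<in> Q" using u evO by (intro Q.P_mult_right)
        ultimately show ?thesis using Q.P_0 Q.P_diff by metis
      qed
    qed simp
    then show False using \<iota>.finite_extension_algebraic[OF assms(3), of u] by blast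
  qed
  then obtain a0 where a0: "\<iota> a0 \<notin> Q.\<O>" by blast
  have "valuation_ring \<kappa> (\<iota> -` Q.\<O>)"
  proof (rule valuation_ringI)
    show "a0 \<notin> \<iota> -` Q.\<O>" using a0 by simp
    show "range \<kappa> \<subseteq> \<iota> -` Q.\<O>" using Q.O_const by auto
    fix z assume "z \<notin> \<iota> -` Q.\<O>"
    then show "inverse z \<in> \<iota> -` Q.\<O>"
      using Q.P_subset_O[OF Q.inverse_in_P] by (simp add: \<iota>.hom_inverse)
  qed (use assms in \<open>auto simp: \<iota>.hom_diff \<iota>.hom_mult intro: Q.O_diff Q.O_mult\<close>)
  moreover have "\<iota> -` Q = {z. z = 0 \<or> inverse z \<notin> \<iota> -` Q.\<O>}"
    by (auto simp: Q.P_iff \<iota>.hom_inverse)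
  ultimately show ?thesis
    using places_iff[OF assms(1)] ring_of_nonunits[OF assms(1)] by metis
qed

lemma rational_place_restrict:
  assumes "field_hom \<kappa>" "field_hom \<iota>" "finite_extension \<iota>" "rational_place (\<iota> \<circ> \<kappa>) Q"
  shows "rational_place \<kappa> (\<iota> -` Q)"
proof -
  interpret \<iota>: field_hom \<iota> by fact
  have "ring_of_place (\<iota> -` Q) = \<iota> -` ring_of_place Q"
    by (auto simp: ring_of_place_def \<iota>.hom_inverse)
  then show ?thesis
    using assms place_restrict[OF assms(1-3)] unfolding rational_place_def
    by (auto simp: \<iota>.hom_diff)
qed

lemma lies_over_iff:
  assumes "field_hom \<kappa>" "field_hom \<iota>" "finite_extension \<iota>" "rational_place \<kappa> P"
    "Q \<in> places (\<iota> \<circ> \<kappa>)"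
  shows "lies_over \<iota> Q P \<longleftrightarrow> \<iota> -` Q = P"
  using rational_place_maximal[OF assms(1,4) place_restrict[OF assms(1-3,5)]]
  unfolding lies_over_def by blast

section \<open>The number of places over a place is at most the degree\<close>

locale places_over =
  \<kappa>: field_hom \<kappa> + \<iota>: field_hom \<iota> + F: place \<kappa> P
  for \<kappa> :: "'k::field \<Rightarrow> 'f::field" and \<iota> :: "'f \<Rightarrow> 'e::field" and P :: "'f set" +
  assumes finite_ext: "finite_extension \<iota>"
begin

definition Over :: "'e set set" where "Over = {Q \<in> places (\<iota> \<circ> \<kappa>). \<iota> -` Q = P}"

lemma place_Over: "Q \<in> Over \<Longrightarrow> place (\<iota> \<circ> \<kappa>) Q"
  using field_hom_comp[OF \<kappa>.field_hom_axioms \<iota>.field_hom_axioms]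
  by (auto simp: place_def place_axioms_def Over_def)

lemma in_Over: "Q \<in> Over \<Longrightarrow> \<iota> a \<in> Q \<longleftrightarrow> a \<in> P"
  by (auto simp: Over_def)

lemma O_in_Over: "Q \<in> Over \<Longrightarrow> a \<in> F.\<O> \<Longrightarrow> \<iota> a \<in> ring_of_place Q"
  using in_Over[of Q "inverse a"] by (auto simp: ring_of_place_def \<iota>.hom_inverse)

text \<open>An element of \<open>P\<^sub>1\<close> that is a unit for \<open>P\<^sub>2\<close> would satisfy no polynomial with coefficients
  in \<open>\<O>\<close> that are not all in \<open>P\<close>.\<close>

lemma Over_incomparable:
  assumes "P1 \<in> Over" "P2 \<in> Over" and sub: "ring_of_place P1 \<subseteq> ring_of_place P2"
  shows "P1 = P2"
proof -
  interpret P1: place "\<iota> \<circ> \<kappa>" P1 using assms place_Over by blast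
  interpret P2: place "\<iota> \<circ> \<kappa>" P2 using assms place_Over by blast
  have P21: "w \<in> P1" if "w \<in> P2" for w
    using that sub P1.P_iff[of w] P2.P_iff[of w] by blast
  have "P2.\<O> \<subseteq> P1.\<O>"
  proof (rule ccontr)
    assume "\<not> P2.\<O> \<subseteq> P1.\<O>"
    then obtain z where z: "z \<in> P2.\<O>" "z \<notin> P1.\<O>" by blast
    define u where "u = inverse z"
    have u: "u \<in> P1" "u \<noteq> 0" using z P1.inverse_in_P P1.O_0 by (auto simp: u_def)
    have u2: "u \<in> P2.\<O>" "u \<notin> P2"
      using P1.P_subset_O[OF u(1)] sub z u P2.P_iff[of u] by (auto simp: u_def)
    have evO: "\<iota>.ev u c \<in> P1.\<O>" if "\<And>i. coeff c i \<in> F.\<O>" for c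
      using that
    proof (induction c)
      case (pCons a c)
      have "coeff c i \<in> F.\<O>" for i using pCons(3)[of "Suc i"] by simp
      moreover have "a \<in> F.\<O>" using pCons(3)[of 0] by simp
      ultimately show ?case
        using pCons u O_in_Over[OF assms(1)]
        by (auto simp: \<iota>.ev_pCons intro!: P1.O_add P1.O_mult P1.P_subset_O[OF u(1)])
    qed (simp add: P1.O_0)
    have ev_notin: "\<iota>.ev u c \<notin> P2" if "\<And>i. coeff c i \<in> F.\<O>" "\<exists>i. coeff c i \<notin> P" for c
      using that
    proof (induction c)
      case 0
      then show ?case using F.P_0 by simp
    next
      case (pCons a c)
      have cO: "coeff c i \<in> F.\<O>" for i using pCons(3)[of "Suc i"] by simp
      have aO: "a \<in> F.\<O>" using pCons(3)[of 0] by simp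
      show ?case
      proof (cases "a \<in> P")
        case True
        obtain i where i: "coeff (pCons a c) i \<notin> P" using pCons(4) by blast
        then obtain j where "i = Suc j" using True by (cases i) auto
        then have "\<iota>.ev u c \<notin> P2" using pCons(2) cO i by auto
        then have "u * \<iota>.ev u c \<notin> P2" using u2 P2.P_prime by blast
        moreover have "\<iota> a \<in> P2" using True in_Over assms(2) by blast
        ultimately show ?thesis using P2.P_diff[of "\<iota> a + u * \<iota>.ev u c" "\<iota> a"] by (auto simp: \<iota>.ev_pCons)
      next
        case False
        then have "\<iota> a \<notin> P1" using in_Over assms(1) by blast
        moreover have "u * \<iota>.ev u c \<in> P1" using u(1) evO[OF cO] by (rule P1.P_mult_right)
        ultimately have "\<iota> a + u * \<iota>.ev u c \<notin> P1"
          using P1.P_diff[of "\<iota> a + u * \<iota>.ev u c" "u * \<iota>.ev u c"] by auto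
        then show ?thesis using P21 by (auto simp: \<iota>.ev_pCons)
      qed
    qed
    obtain c where c: "c \<noteq> 0" "\<iota>.ev u c = 0" using \<iota>.finite_extension_algebraic[OF finite_ext] by blast
    then have "\<exists>i\<in>{..degree c}. coeff c i \<noteq> 0" by (metis atMost_iff leading_coeff_0_iff order_refl)
    \<comment> \<open>Divided by its dominant coefficient, the relation satisfied by
      \<open>u\<close> is integral with one coefficient equal to 1, so its value 0 would have to lie
      outside \<open>P2\<close>.\<close>
    then obtain j where j: "coeff c j \<noteq> 0" "\<And>i. i \<le> degree c \<Longrightarrow> coeff c i / coeff c j \<in> F.\<O>"
      using F.ex_dominant_coeff[of "{..degree c}" "coeff c"] by auto
    let ?c = "smult (inverse (coeff c j)) c"
    have "\<iota>.ev u ?c \<notin> P2"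
    proof (rule ev_notin)
      show "coeff ?c i \<in> F.\<O>" for i
        using j(2)[of i] F.O_0 by (cases "i \<le> degree c") (auto simp: coeff_eq_0 divide_inverse mult.commute)
      show "\<exists>i. coeff ?c i \<notin> P" using j(1) F.one_notin_P by (intro exI[of _ j]) simp
    qed
    then show False using c P2.P_0 by (simp add: \<iota>.ev_smult)
  qed
  then have "P1.\<O> = P2.\<O>" using sub by blast
  then show ?thesis using P1.P_iff P2.P_iff by blast
qed

text \<open>A function vanishing at \<open>P1\<close> with poles throughout \<open>R\<close> may be
  regular at a new place Q. Then a power of some \<open>u\<close> with a zero at \<open>P1\<close>
  and a pole at Q is added; at each old place at most one exponent can destroy the existing
  pole.\<close>

lemma ex_pole:
  assumes "P1 \<in> Over" "finite R" "R \<subseteq> Over - {P1}"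
  shows "\<exists>z\<in>P1. \<forall>Q\<in>R. z \<notin> ring_of_place Q"
  using assms(2,3)
proof (induction R rule: finite_induct)
  case empty
  interpret P1: place "\<iota> \<circ> \<kappa>" P1 using assms place_Over by blast
  show ?case using P1.P_0 by blast
next
  case (insert Q R)
  interpret P1: place "\<iota> \<circ> \<kappa>" P1 using assms place_Over by blast
  interpret Q: place "\<iota> \<circ> \<kappa>" Q using insert place_Over by blast
  obtain y where y: "y \<in> P1" "\<And>Q'. Q' \<in> R \<Longrightarrow> y \<notin> ring_of_place Q'" using insert by blast
  show ?case
  proof (cases "y \<in> Q.\<O>")
    case False
    then show ?thesis using y by blast
  next
    case True
    have "P1 \<noteq> Q" "Q \<in> Over" using insert by auto
    then have "\<not> P1.\<O> \<subseteq> Q.\<O>" "\<not> Q.\<O> \<subseteq> P1.\<O>"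
      using Over_incomparable[of P1 Q] Over_incomparable[of Q P1] assms(1) by metis+
    then obtain a b where ab: "a \<in> P1.\<O>" "a \<notin> Q.\<O>" "b \<in> Q.\<O>" "b \<notin> P1.\<O>"
      by blast
    \<comment> \<open>Incomparability of the two rings in both directions gives this quotient a zero
      at \<open>P1\<close> and a pole at \<open>Q\<close>.\<close>
    define u where "u = a * inverse b"
    have u1: "u \<in> P1" unfolding u_def using ab by (intro P1.P_mult P1.inverse_in_P)
    have "b \<noteq> 0" using ab P1.O_0 by auto
    then have uQ: "u \<notin> Q.\<O>" using ab Q.O_mult[of u b] by (auto simp: u_def mult.assoc)
    let ?bad = "\<lambda>Q'. {m. y + u ^ Suc m \<in> ring_of_place Q'}"
    have fin: "finite (?bad Q')" if "Q' \<in> R" for Q'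
    proof -
      interpret Q': place "\<iota> \<circ> \<kappa>" Q' using insert that place_Over by blast
      have yQ': "y \<notin> Q'.\<O>" using y that by blast
      \<comment> \<open>Suppose two powers of \<open>u\<close> both cancel the pole of
        \<open>y\<close>. Their difference is integral, but it is the higher power times 1 - w with
        \<open>w\<close> in Q', a unit. So the higher power is integral, and then so is
        \<open>y\<close>.\<close>
      have "m \<le> m'" if m: "m \<in> ?bad Q'" "m' \<in> ?bad Q'" for m m'
      proof (rule ccontr)
        assume "\<not> m \<le> m'"
        then obtain k where k: "m = m' + Suc k" using less_imp_Suc_add by fastforce
        have "u ^ Suc m \<notin> Q'.\<O>"
        proof
          assume "u ^ Suc m \<in> Q'.\<O>"
          then have "y + u ^ Suc m - u ^ Suc m \<in> Q'.\<O>" using m(1) by (intro Q'.O_diff) auto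
          then show False using yQ' by simp
        qed
        then have uQ': "u \<notin> Q'.\<O>" using Q'.O_power by blast
        then have u0: "u \<noteq> 0" using Q'.O_0 by blast
        define w where "w = inverse u ^ Suc k"
        have w: "w \<in> Q'" unfolding w_def using Q'.inverse_in_P[OF uQ']
          by (simp add: Q'.P_mult_right Q'.O_power Q'.P_subset_O)
        have "(y + u ^ Suc m) - (y + u ^ Suc m') \<in> Q'.\<O>" using m by (intro Q'.O_diff) auto
        also have "(y + u ^ Suc m) - (y + u ^ Suc m') = u ^ Suc m * (1 + (- w))"
        proof -
          have "u ^ Suc m * w = u ^ Suc m'"
            using u0 by (simp add: w_def k power_add power_inverse field_simps)
          then show ?thesis by (simp add: algebra_simps del: power_Suc)
        qed
        finally have "u ^ Suc m * (1 + (- w)) * inverse (1 + (- w)) \<in> Q'.\<O>"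
          using Q'.one_plus_notin_P[OF Q'.P_uminus[OF w]] by (rule Q'.O_mult[OF _ Q'.inverse_in_O])
        moreover have "1 + (- w) \<noteq> 0"
          using Q'.one_plus_notin_P[OF Q'.P_uminus[OF w]] Q'.P_0 by metis
        ultimately have "u ^ Suc m \<in> Q'.\<O>" by (simp add: mult.assoc)
        then show False using \<open>u ^ Suc m \<notin> Q'.\<O>\<close> by blast
      qed
      then have "?bad Q' \<subseteq> {..m}" if "m \<in> ?bad Q'" for m using that by blast
      then show ?thesis by (cases "?bad Q' = {}") (auto intro: finite_subset)
    qed
    have "finite (\<Union>Q'\<in>R. ?bad Q')" using insert fin by blast
    then obtain m where m: "m \<notin> (\<Union>Q'\<in>R. ?bad Q')"
      using infinite_UNIV_nat by (metis UNIV_eq_I)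
    have "y + u ^ Suc m \<in> P1"
      unfolding power_Suc using y(1) u1 by (intro P1.P_add P1.P_mult_right P1.O_power P1.P_subset_O)
    moreover have "y + u ^ Suc m \<notin> Q.\<O>"
      using Q.O_diff[of "y + u ^ Suc m" y] True Q.power_notin_O[OF uQ, of "Suc m"] by auto
    moreover have "y + u ^ Suc m \<notin> ring_of_place Q'" if "Q' \<in> R" for Q' using m that by blast
    ultimately show ?thesis by blast
  qed
qed

text \<open>For \<open>z\<close> with a zero at \<open>P1\<close> and poles on \<open>R\<close>, the
  element 1/(1 + z) is congruent to 1 at \<open>P1\<close> and vanishes on \<open>R\<close>.\<close>

lemma ex_separating_element:
  assumes "P1 \<in> Over" "finite R" "R \<subseteq> Over - {P1}"
  shows "\<exists>e. e - 1 \<in> P1 \<and> (\<forall>Q\<in>R. e \<in> Q)"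
proof -
  interpret P1: place "\<iota> \<circ> \<kappa>" P1 using assms place_Over by blast
  obtain z where z: "z \<in> P1" "\<And>Q. Q \<in> R \<Longrightarrow> z \<notin> ring_of_place Q" using ex_pole[OF assms] by blast
  define e where "e = inverse (1 + z)"
  have z1: "1 + z \<notin> P1" using P1.one_plus_notin_P[OF z(1)] .
  then have nz: "1 + z \<noteq> 0" using P1.P_0 by metis
  have "- (e * z) \<in> P1" unfolding e_def
    using z1 z(1) by (intro P1.P_uminus P1.P_mult P1.inverse_in_O)
  also have "- (e * z) = e - 1" using nz by (simp add: e_def field_simps)
  finally have "e - 1 \<in> P1" .
  moreover have "e \<in> Q" if "Q \<in> R" for Q
  proof -
    interpret Q: place "\<iota> \<circ> \<kappa>" Q using assms that place_Over by blast
    have w: "inverse z \<in> Q" using z(2)[OF that] by (rule Q.inverse_in_P)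
    have z0: "z \<noteq> 0" using z(2)[OF that] Q.O_0 by blast
    have "inverse (1 + inverse z) * inverse z \<in> Q"
      using Q.one_plus_notin_P[OF w] w by (intro Q.P_mult Q.inverse_in_O)
    also have "inverse (1 + inverse z) * inverse z = e"
      using z0 nz by (simp add: e_def distrib_right flip: inverse_mult_distrib)
    finally show ?thesis .
  qed
  ultimately show ?thesis by blast
qed

text \<open>The separating elements are linearly independent over F: divide a relation by its
  dominant coefficient, belonging to a place J. All other terms then lie in J, which forces the
  element congruent to 1 modulo J into J.\<close>

lemma card_Over_le_aux:
  assumes S: "finite S" "S \<subseteq> Over"
  shows "card S \<le> extension_degree \<iota>"
proof -
  have "\<forall>Q\<in>S. \<exists>e. e - 1 \<in> Q \<and> (\<forall>Q'\<in>S - {Q}. e \<in> Q')"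
  proof
    fix Q assume "Q \<in> S"
    then show "\<exists>e. e - 1 \<in> Q \<and> (\<forall>Q'\<in>S - {Q}. e \<in> Q')"
      using S by (intro ex_separating_element) auto
  qed
  then obtain e where e: "\<forall>Q\<in>S. e Q - 1 \<in> Q \<and> (\<forall>Q'\<in>S - {Q}. e Q \<in> Q')"
    by (rule bchoice[THEN exE])
  have e_notin: "e Q \<notin> Q" if "Q \<in> S" for Q
  proof -
    interpret Q: place "\<iota> \<circ> \<kappa>" Q using S that place_Over by blast
    show ?thesis using Q.P_diff[of "e Q" "e Q - 1"] Q.one_notin_P e that by auto
  qed
  have inj: "inj_on e S"
    using e e_notin by (intro inj_onI) (metis Diff_iff empty_iff insert_iff)
  have rel: "a Q = 0" if sum0: "(\<Sum>Q\<in>S. \<iota> (a Q) * e Q) = 0" and "Q \<in> S" for a Q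
  proof (rule ccontr)
    assume "a Q \<noteq> 0"
    then obtain J where J: "J \<in> S" "a J \<noteq> 0" "\<And>Q. Q \<in> S \<Longrightarrow> a Q / a J \<in> F.\<O>"
      using F.ex_dominant_coeff[OF S(1), of a] \<open>Q \<in> S\<close> by blast
    interpret J: place "\<iota> \<circ> \<kappa>" J using S J place_Over by blast
    have "0 = \<iota> (inverse (a J)) * (\<Sum>Q\<in>S. \<iota> (a Q) * e Q)" using sum0 by simp
    also have "\<dots> = (\<Sum>Q\<in>S. \<iota> (a Q / a J) * e Q)"
      by (simp add: sum_distrib_left \<iota>.hom_divide \<iota>.hom_inverse field_simps)
    also have "\<dots> = e J + (\<Sum>Q\<in>S - {J}. \<iota> (a Q / a J) * e Q)"
      using S J by (subst sum.remove[of _ J]) auto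
    finally have "e J = - (\<Sum>Q\<in>S - {J}. \<iota> (a Q / a J) * e Q)" by (simp add: eq_neg_iff_add_eq_0)
    also have "\<dots> \<in> J"
      using e J S by (intro J.P_uminus J.P_sum J.P_mult O_in_Over) auto
    finally show False using e_notin J by blast
  qed
  have indep: "\<iota>.vs.independent (e ` S)"
  proof (rule \<iota>.vs.independent_if_scalars_zero)
    fix u x assume *: "(\<Sum>x\<in>e ` S. \<iota> (u x) * x) = 0" "x \<in> e ` S"
    then have "(\<Sum>Q\<in>S. \<iota> (u (e Q)) * e Q) = 0" by (simp add: sum.reindex[OF inj])
    then show "u x = 0" using rel[of "\<lambda>Q. u (e Q)"] *(2) by auto
  qed (use S in simp)
  obtain B where B: "finite B" "\<iota>.vs.span B = UNIV" using finite_ext unfolding finite_extension_def by blast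
  obtain C where C: "\<iota>.vs.independent C" "UNIV \<subseteq> \<iota>.vs.span C" "card C = \<iota>.vs.dim (UNIV :: 'e set)"
    by (rule \<iota>.vs.basis_exists[of UNIV])
  have "finite C" using \<iota>.vs.independent_span_bound[OF B(1) C(1)] B(2) by simp
  then have "card (e ` S) \<le> card C" using \<iota>.vs.independent_span_bound[OF _ indep] C(2) by blast
  then show ?thesis using C(3) card_image[OF inj] by (simp add: extension_degree_def)
qed

lemma finite_Over: "finite Over" and card_Over_le: "card Over \<le> extension_degree \<iota>"
  using finite_if_finite_subsets_card_bdd[of Over "extension_degree \<iota>"] card_Over_le_aux by blast+

end

section \<open>Places from embeddings into Laurent series\<close>

lemma field_hom_fls_const: "field_hom (fls_const :: 'k::field \<Rightarrow> 'k fls)"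
  by standard (simp add: field_embedding_def fls_plus_const fls_const_mult_const)

interpretation fls: field_hom "fls_const :: 'k::field \<Rightarrow> 'k fls"
  by (rule field_hom_fls_const)

lemma in_range_fps_to_fls_iff: "w \<in> range fps_to_fls \<longleftrightarrow> fls_subdegree w \<ge> 0"
  using fls_regpart_to_fls_trivial[of w] fls_subdegree_fls_to_fps_gt0 by (metis imageE rangeI)

text \<open>The subdegree of 0 is 0 by convention, hence the separate alternative
  \<open>w = 0\<close>.\<close>

lemma fls_subdegree_pos_iff:
  "w = 0 \<or> fls_subdegree w > 0 \<longleftrightarrow> (\<exists>s. w = fps_to_fls s \<and> s $ 0 = 0)"
proof
  assume w: "w = 0 \<or> fls_subdegree w > 0"
  then have "w = fps_to_fls (fls_regpart w)" by auto
  moreover have "fls_regpart w $ 0 = 0" using w by auto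
  ultimately show "\<exists>s. w = fps_to_fls s \<and> s $ 0 = 0" by blast
next
  assume "\<exists>s. w = fps_to_fls s \<and> s $ 0 = 0"
  then obtain s where s: "w = fps_to_fls s" "s $ 0 = 0" by blast
  then show "w = 0 \<or> fls_subdegree w > 0"
    by (auto simp: fls_subdegree_fls_to_fps subdegree_eq_0_iff intro!: gr0I)
qed

definition laurent_place :: "('e::field \<Rightarrow> 'k::field fls) \<Rightarrow> 'e set" where
  "laurent_place \<Phi> = {z. \<exists>s. \<Phi> z = fps_to_fls s \<and> s $ 0 = 0}"

lemma laurent_placeI: "\<Phi> z = fps_to_fls s \<Longrightarrow> s $ 0 = 0 \<Longrightarrow> z \<in> laurent_place \<Phi>"
  by (auto simp: laurent_place_def)

text \<open>The residue of \<open>z\<close> is the constant coefficient of its series, and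
  \<open>z0\<close> prevents the ring from being the whole field.\<close>

lemma rational_laurent_place:
  assumes "field_hom \<kappa>" "field_hom \<Phi>" and const: "\<And>c. \<Phi> (\<kappa> c) = fls_const c"
    and z0: "\<Phi> z0 \<notin> range fps_to_fls"
  shows "rational_place \<kappa> (laurent_place \<Phi>)"
proof -
  interpret \<Phi>: field_hom \<Phi> by fact
  let ?O = "{z. \<Phi> z \<in> range fps_to_fls}"
  have vr: "valuation_ring \<kappa> ?O"
  proof (rule valuation_ringI)
    show "range \<kappa> \<subseteq> ?O" using const by (auto simp: in_range_fps_to_fls_iff)
    show "z0 \<notin> ?O" using z0 by simp
    fix z assume "z \<notin> ?O"
    then show "inverse z \<in> ?O" by (simp add: in_range_fps_to_fls_iff \<Phi>.hom_inverse)
  next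
    fix a b assume "a \<in> ?O" "b \<in> ?O"
    then show "a - b \<in> ?O" "a * b \<in> ?O"
      by (auto simp: \<Phi>.hom_diff \<Phi>.hom_mult simp flip: fps_to_fls_minus fls_times_fps_to_fls)
  qed fact
  have P: "laurent_place \<Phi> = {z. z = 0 \<or> inverse z \<notin> ?O}"
    unfolding laurent_place_def fls_subdegree_pos_iff[symmetric]
    by (auto simp: in_range_fps_to_fls_iff \<Phi>.hom_inverse)
  have places: "laurent_place \<Phi> \<in> places \<kappa>" "ring_of_place (laurent_place \<Phi>) = ?O"
    using places_iff[OF assms(1), of "laurent_place \<Phi>"] ring_of_nonunits[OF assms(1) vr] vr P by auto
  moreover have "\<exists>k. z - \<kappa> k \<in> laurent_place \<Phi>" if z: "z \<in> ?O" for z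
  proof -
    obtain s where s: "\<Phi> z = fps_to_fls s" using z by blast
    have "\<Phi> (z - \<kappa> (s $ 0)) = fps_to_fls (s - fps_const (s $ 0))"
      by (simp add: \<Phi>.hom_diff s const)
    then show ?thesis using laurent_placeI by fastforce
  qed
  ultimately show ?thesis unfolding rational_place_def by blast
qed

section \<open>The rational places of \<open>K(x)\<close>\<close>

interpretation \<kappa>: field_hom "ratfun_const :: 'k::field \<Rightarrow> 'k ratfun"
  by (rule field_hom_ratfun_const)

lemma ev_ratfun_var: "\<kappa>.ev ratfun_var a = Fract a 1"
proof (induction a)
  case (pCons c a)
  have "\<kappa>.ev ratfun_var (pCons c a) = ratfun_const c + ratfun_var * Fract a 1"
    by (simp only: \<kappa>.ev_pCons pCons.IH)
  also have "\<dots> = Fract (pCons c a) 1" by (simp add: ratfun_const_def ratfun_var_def)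
  finally show ?case .
qed (simp add: Zero_fract_def)

lemma Fract_eq_ev: "Fract a b = \<kappa>.ev ratfun_var a / \<kappa>.ev ratfun_var b"
  by (simp add: ev_ratfun_var)

lemma ev_ratfun_var_eq_0 [simp]: "\<kappa>.ev ratfun_var a = 0 \<longleftrightarrow> a = 0"
  by (simp add: ev_ratfun_var Zero_fract_def eq_fract)

text \<open>By \<open>inj\<close> the element \<xi> is transcendental over the image of K, so no
  nonzero denominator vanishes and equal fractions have equal images.\<close>

lemma ex_hom_ratfun:
  assumes "field_hom \<theta>" and inj: "\<And>a. field_hom.ev \<theta> \<xi> a = 0 \<Longrightarrow> a = 0"
  shows "\<exists>\<Theta>. field_hom \<Theta> \<and> (\<forall>c. \<Theta> (ratfun_const c) = \<theta> c) \<and>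
    (\<forall>a b. b \<noteq> 0 \<longrightarrow> \<Theta> (Fract a b) = field_hom.ev \<theta> \<xi> a / field_hom.ev \<theta> \<xi> b)"
proof -
  interpret \<theta>: field_hom \<theta> by fact
  define rep where "rep f = (SOME ab. snd ab \<noteq> 0 \<and> f = Fract (fst ab) (snd ab))" for f :: "'a ratfun"
  define \<Theta> where "\<Theta> f = \<theta>.ev \<xi> (fst (rep f)) / \<theta>.ev \<xi> (snd (rep f))" for f
  have nz: "\<theta>.ev \<xi> b \<noteq> 0" if "b \<noteq> 0" for b using inj that by blast
  have \<Theta>: "\<Theta> (Fract a b) = \<theta>.ev \<xi> a / \<theta>.ev \<xi> b" if "b \<noteq> 0" for a b
  proof -
    have "snd (rep (Fract a b)) \<noteq> 0 \<and> Fract a b = Fract (fst (rep (Fract a b))) (snd (rep (Fract a b)))"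
      unfolding rep_def by (rule someI[of _ "(a, b)"]) (use that in simp)
    then obtain a' b' where r: "rep (Fract a b) = (a', b')" "b' \<noteq> 0" "Fract a b = Fract a' b'"
      by (metis prod.collapse)
    then have "a * b' = a' * b" using that by (simp add: eq_fract)
    then have "\<theta>.ev \<xi> a * \<theta>.ev \<xi> b' = \<theta>.ev \<xi> a' * \<theta>.ev \<xi> b" by (simp flip: \<theta>.ev_mult)
    then show ?thesis using nz[OF that] nz[OF r(2)] by (simp add: \<Theta>_def r(1) field_simps)
  qed
  have "field_embedding \<Theta>"
    unfolding field_embedding_def
  proof (intro conjI allI)
    show "\<Theta> 1 = 1" using \<Theta>[of 1 1] by (simp add: One_fract_def)
    fix f g :: "'a ratfun"
    obtain a b c d where "f = Fract a b" "b \<noteq> 0" "g = Fract c d" "d \<noteq> 0"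
      by (metis Fract_cases)
    then show "\<Theta> (f + g) = \<Theta> f + \<Theta> g" "\<Theta> (f * g) = \<Theta> f * \<Theta> g"
      using nz by (simp_all add: \<Theta> \<theta>.ev_add \<theta>.ev_mult field_simps)
  qed
  then have "field_hom \<Theta>" by (rule field_hom.intro)
  moreover have "\<Theta> (ratfun_const c) = \<theta> c" for c by (simp add: ratfun_const_def \<Theta>)
  ultimately show ?thesis using \<Theta> by blast
qed

lemma ev_fls_X_plus_const:
  "fls.ev (fls_X + fls_const \<alpha>) a = fps_to_fls (fps_of_poly (pcompose a [:\<alpha>, 1:]))"
proof (induction a)
  case (pCons c a)
  then show ?case
    by (simp add: fls.ev_pCons pcompose_pCons fps_of_poly_add fps_of_poly_mult fps_of_poly_const
        fps_of_poly_linear fls_times_fps_to_fls del: mult_pCons_left)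
qed simp

text \<open>The constant added in each Horner step has subdegree 0, above that of the other summand,
  so it does not matter. The lemma yields both the transcendence needed for the expansion at
  infinity and the order of h/g there.\<close>

lemma subdegree_ev_fls_X_inv:
  "a \<noteq> 0 \<Longrightarrow> fls.ev fls_X_inv a \<noteq> 0 \<and> fls_subdegree (fls.ev fls_X_inv a) = - int (degree a)"
proof (induction a)
  case (pCons c a)
  show ?case
  proof (cases "a = 0")
    case True
    then show ?thesis using pCons by (simp add: fls.ev_pCons)
  next
    case False
    then have IH: "fls.ev fls_X_inv a \<noteq> 0" "fls_subdegree (fls.ev fls_X_inv a) = - int (degree a)"
      using pCons by auto
    have d: "fls_subdegree (fls_X_inv * fls.ev fls_X_inv a) = - int (Suc (degree a))"
      using IH by simp
    have "fls_subdegree (fls_const c + fls_X_inv * fls.ev fls_X_inv a) = - int (Suc (degree a))"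
    proof (cases "c = 0")
      case False
      show ?thesis by (subst fls_subdegree_add_eq2) (use d IH False in auto)
    qed (use d in simp)
    then show ?thesis using False by (auto simp: fls.ev_pCons)
  qed
qed simp

text \<open>\<open>None\<close> stands for the point at infinity of the projective line, and \<open>\<Theta>\<close> expands rational
  functions in the local parameter at the point \<open>u\<close>.\<close>

definition hom_at :: "'k::field option \<Rightarrow> ('k ratfun \<Rightarrow> 'k fls) \<Rightarrow> bool" where
  "hom_at u \<Theta> \<longleftrightarrow> field_hom \<Theta> \<and> (\<forall>c. \<Theta> (ratfun_const c) = fls_const c) \<and>
    (let \<xi> = (case u of None \<Rightarrow> fls_X_inv | Some \<alpha> \<Rightarrow> fls_X + fls_const \<alpha>) in
     \<forall>a b. b \<noteq> 0 \<longrightarrow> \<Theta> (Fract a b) = fls.ev \<xi> a / fls.ev \<xi> b)"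

lemma ex_hom_at: "\<exists>\<Theta>. hom_at u \<Theta>"
proof (cases u)
  case None
  have "\<exists>\<Theta>. field_hom \<Theta> \<and> (\<forall>c. \<Theta> (ratfun_const c) = fls_const c) \<and>
    (\<forall>a b. b \<noteq> 0 \<longrightarrow> \<Theta> (Fract a b) = fls.ev (fls_X_inv :: 'a fls) a / fls.ev fls_X_inv b)"
    using subdegree_ev_fls_X_inv by (intro ex_hom_ratfun field_hom_fls_const) blast
  then show ?thesis by (simp add: hom_at_def None)
next
  case (Some \<alpha>)
  have "a = 0" if "fls.ev (fls_X + fls_const \<alpha>) a = 0" for a
  proof -
    have "fps_of_poly (pcompose a [:\<alpha>, 1:]) = fps_of_poly 0"
      using that by (simp add: ev_fls_X_plus_const)
    then have "pcompose a [:\<alpha>, 1:] = 0" unfolding fps_of_poly_eq_iff .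
    then show ?thesis by (rule pcompose_eq_0) simp
  qed
  then have "\<exists>\<Theta>. field_hom \<Theta> \<and> (\<forall>c. \<Theta> (ratfun_const c) = fls_const c) \<and>
    (\<forall>a b. b \<noteq> 0 \<longrightarrow> \<Theta> (Fract a b)
      = fls.ev (fls_X + fls_const \<alpha>) a / fls.ev (fls_X + fls_const \<alpha>) b)"
    by (intro ex_hom_ratfun field_hom_fls_const) blast
  then show ?thesis by (simp add: hom_at_def Let_def Some)
qed

section \<open>Local parameters and the points of the projective line\<close>

definition param :: "'k::field option \<Rightarrow> 'k ratfun" where
  "param u = (case u of None \<Rightarrow> inverse ratfun_var | Some \<alpha> \<Rightarrow> ratfun_var - ratfun_const \<alpha>)"

lemma ratfun_var_nz [simp]: "ratfun_var \<noteq> 0"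
  using ev_ratfun_var_eq_0[of "[:0, 1:]"] by simp

lemma param_Some: "param (Some \<alpha>) = \<kappa>.ev ratfun_var [:- \<alpha>, 1:]"
  by (simp add: param_def \<kappa>.ev_pCons \<kappa>.hom_uminus)

lemma param_nz: "param u \<noteq> 0"
  by (cases u) (simp add: param_def, simp only: param_Some ev_ratfun_var_eq_0, simp)

lemma hom_at_var:
  assumes "hom_at u \<Theta>"
  shows "\<Theta> ratfun_var = (case u of None \<Rightarrow> fls_X_inv | Some \<alpha> \<Rightarrow> fls_X + fls_const \<alpha>)"
  using assms by (simp add: ratfun_var_def hom_at_def Let_def)

text \<open>\<open>param u\<close> expands to \<open>fls_X\<close>; its inverse is therefore not a
  power series, which makes the place nontrivial.\<close>

lemma rational_place_hom_at:
  assumes "hom_at u \<Theta>"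
  shows "rational_place ratfun_const (laurent_place \<Theta>)" "param u \<in> laurent_place \<Theta>"
    and "\<exists>z. \<Theta> z \<notin> range fps_to_fls"
proof -
  interpret \<Theta>: field_hom \<Theta> using assms by (simp add: hom_at_def)
  have param: "\<Theta> (param u) = fls_X"
    using hom_at_var[OF assms] assms
    by (cases u) (auto simp: param_def \<Theta>.hom_inverse \<Theta>.hom_diff hom_at_def fls_inverse_X_inv)
  then have "\<Theta> (inverse (param u)) \<notin> range fps_to_fls"
    by (simp add: \<Theta>.hom_inverse in_range_fps_to_fls_iff)
  then show "rational_place ratfun_const (laurent_place \<Theta>)" "\<exists>z. \<Theta> z \<notin> range fps_to_fls"
    using assms by (auto simp: hom_at_def intro!: rational_laurent_place \<kappa>.field_hom_axioms)
  show "param u \<in> laurent_place \<Theta>" using param by (intro laurent_placeI[of _ _ fps_X]) simp_all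
qed

lemma (in place) ev_residue:
  assumes "s - \<kappa> \<alpha> \<in> P"
  shows "ev s c \<in> \<O>" "ev s c - \<kappa> (poly c \<alpha>) \<in> P"
proof -
  have s: "s \<in> \<O>" using O_add[OF P_subset_O[OF assms] O_const[of \<alpha>]] by simp
  show O: "ev s c \<in> \<O>" for c
    by (induction c) (auto simp: ev_pCons intro: O_0 O_add O_mult O_const s)
  show "ev s c - \<kappa> (poly c \<alpha>) \<in> P"
  proof (induction c)
    case (pCons a c)
    have "ev s (pCons a c) - \<kappa> (poly (pCons a c) \<alpha>)
      = s * (ev s c - \<kappa> (poly c \<alpha>)) + \<kappa> (poly c \<alpha>) * (s - \<kappa> \<alpha>)"
      by (simp add: ev_pCons hom_add hom_mult algebra_simps)
    also have "\<dots> \<in> P" using pCons by (intro P_add P_mult s O_const assms)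
    finally show ?case .
  qed (simp add: P_0)
qed

lemma (in place) ev_unit:
  assumes "s - \<kappa> \<alpha> \<in> P" "poly c \<alpha> \<noteq> 0"
  shows "ev s c \<in> \<O> - P"
proof -
  have "ev s c \<notin> P"
  proof
    assume "ev s c \<in> P"
    then have "ev s c - (ev s c - \<kappa> (poly c \<alpha>)) \<in> P" using ev_residue(2)[OF assms(1)] by (rule P_diff)
    then show False using assms(2) by simp
  qed
  then show ?thesis using ev_residue(1)[OF assms(1)] by blast
qed

lemma (in place) unit_divide:
  assumes "v \<in> \<O> - P" "w \<in> \<O> - P"
  shows "v / w \<in> \<O> - P"
proof -
  have "v / w \<in> \<O>" using assms O_mult inverse_in_O by (simp add: divide_inverse)
  moreover have "v / w \<notin> P"
  proof
    assume "v / w \<in> P"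
    then have "w * (v / w) \<in> P" using assms by (intro P_mult) auto
    moreover have "w \<noteq> 0" using assms P_0 by blast
    ultimately show False using assms by simp
  qed
  ultimately show ?thesis by blast
qed

lemma (in place) power_int_unit_in_P_iff:
  assumes "t \<in> P" "t \<noteq> 0" "v \<in> \<O> - P"
  shows "t powi i * v \<in> P \<longleftrightarrow> i > 0"
proof -
  have pos: "t powi j * w \<in> P" if "j > 0" "w \<in> \<O>" for j w
  proof -
    have "j = int (Suc (nat j - 1))" using that(1) by simp
    then obtain m where "j = int (Suc m)" by blast
    then have "t powi j * w = t * (t ^ m * w)" by (simp add: power_int_of_nat del: of_nat_Suc)
    moreover have "t * (t ^ m * w) \<in> P"
      by (rule P_mult_right[OF assms(1) O_mult[OF O_power[OF P_subset_O[OF assms(1)]] that(2)]])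
    ultimately show ?thesis by (simp only:)
  qed
  have "t powi i * v \<notin> P" if "i \<le> 0"
  proof
    assume *: "t powi i * v \<in> P"
    have "t powi (- i) \<in> \<O>"
      using pos[of "- i" 1] that O_1 P_subset_O by (cases "i = 0") auto
    then have "t powi (- i) * (t powi i * v) \<in> P" using * by (rule P_mult)
    then show False using assms by (simp add: mult.assoc[symmetric] flip: power_int_add)
  qed
  then show ?thesis using pos assms(3) by force
qed

text \<open>At infinity, a(x) is x^(deg a) times the reflected polynomial at 1/x, whose residue is
  the leading coefficient of \<open>a\<close>. At \<alpha>, the power of x - \<alpha> is split off.
  Exponent and cofactor are chosen before the place P, so that two places can be compared.\<close>

lemma ex_param_unit:
  fixes u :: "'k::field option" and a :: "'k poly"
  assumes "a \<noteq> 0"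
  shows "\<exists>i v. \<kappa>.ev ratfun_var a = param u powi i * v \<and>
    (\<forall>P. place ratfun_const P \<longrightarrow> param u \<in> P \<longrightarrow> v \<in> ring_of_place P - P)"
proof (cases u)
  case None
  let ?t = "inverse ratfun_var :: 'k ratfun"
  let ?v = "\<kappa>.ev ?t (reflect_poly a)"
  have "ratfun_var ^ degree a * ?v = \<kappa>.ev ratfun_var a"
  proof -
    have "?v = (\<Sum>i\<le>degree a. ratfun_const (coeff a (degree a - i)) * ?t ^ i)"
      by (subst \<kappa>.ev_altdef[OF degree_reflect_poly_le]) (auto simp: coeff_reflect_poly intro!: sum.cong)
    also have "\<dots> = (\<Sum>i\<le>degree a. ratfun_const (coeff a i) * ?t ^ (degree a - i))"
      by (rule sum.reindex_bij_witness[of _ "\<lambda>i. degree a - i" "\<lambda>i. degree a - i"]) auto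
    finally have "ratfun_var ^ degree a * ?v
      = (\<Sum>i\<le>degree a. ratfun_const (coeff a i) * (ratfun_var ^ degree a * ?t ^ (degree a - i)))"
      by (simp add: sum_distrib_left mult_ac)
    also have "\<dots> = (\<Sum>i\<le>degree a. ratfun_const (coeff a i) * ratfun_var ^ i)"
    proof (intro sum.cong refl arg_cong2[where f = "(*)"])
      fix i assume "i \<in> {..degree a}"
      then have "(ratfun_var :: 'k ratfun) ^ degree a = ratfun_var ^ i * ratfun_var ^ (degree a - i)"
        by (simp flip: power_add)
      then show "ratfun_var ^ degree a * ?t ^ (degree a - i) = ratfun_var ^ i"
        by (simp add: power_inverse)
    qed
    also have "\<dots> = \<kappa>.ev ratfun_var a" by (rule \<kappa>.ev_altdef[symmetric]) simp
    finally show ?thesis .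
  qed
  then have "\<kappa>.ev ratfun_var a = param u powi (- int (degree a)) * ?v"
    by (simp add: param_def None power_int_minus power_inverse)
  moreover have "?v \<in> ring_of_place P - P" if "place ratfun_const P" "param u \<in> P" for P
  proof -
    interpret place ratfun_const P by fact
    show ?thesis using ev_unit[of ?t 0 "reflect_poly a"] that(2) assms by (simp add: param_def None)
  qed
  ultimately show ?thesis by blast
next
  case (Some \<alpha>)
  obtain b where b: "a = [:- \<alpha>, 1:] ^ order \<alpha> a * b" "poly b \<alpha> \<noteq> 0"
    using order_decomp[OF assms, of \<alpha>] by (auto simp: poly_eq_0_iff_dvd)
  have "\<kappa>.ev ratfun_var a = param u powi (int (order \<alpha> a)) * \<kappa>.ev ratfun_var b"
    by (subst b(1)) (simp add: Some param_Some \<kappa>.ev_mult \<kappa>.ev_power power_int_of_nat)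
  moreover have "\<kappa>.ev ratfun_var b \<in> ring_of_place P - P" if "place ratfun_const P" "param u \<in> P" for P
  proof -
    interpret place ratfun_const P by fact
    show ?thesis using ev_unit[of ratfun_var \<alpha> b] that(2) b(2) by (simp add: param_def Some)
  qed
  ultimately show ?thesis by blast
qed

text \<open>A nonzero function is a power of the parameter times an element that is a unit at both
  places, and the sign of the common exponent decides membership in either.\<close>

lemma place_eqI_param:
  assumes P: "place ratfun_const P" "param u \<in> P" and Q: "place ratfun_const Q" "param u \<in> Q"
  shows "P = Q"
proof -
  interpret P: place ratfun_const P by fact
  interpret Q: place ratfun_const Q by fact
  have "z \<in> P \<longleftrightarrow> z \<in> Q" for z
  proof (cases "z = 0")
    case False
    obtain a b where ab: "z = Fract a b" "b \<noteq> 0" by (metis Fract_cases)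
    then have "a \<noteq> 0" using False by (auto simp: fract_collapse)
    obtain i v where v: "\<kappa>.ev ratfun_var a = param u powi i * v" "v \<in> P.\<O> - P" "v \<in> Q.\<O> - Q"
      using ex_param_unit[OF \<open>a \<noteq> 0\<close>, of u] P Q by blast
    obtain j w where w: "\<kappa>.ev ratfun_var b = param u powi j * w" "w \<in> P.\<O> - P" "w \<in> Q.\<O> - Q"
      using ex_param_unit[OF ab(2), of u] P Q by blast
    have "z = param u powi (i - j) * (v / w)"
      by (simp add: ab(1) Fract_eq_ev v(1) w(1) power_int_diff param_nz)
    then show ?thesis
      using P.power_int_unit_in_P_iff[OF P(2) param_nz P.unit_divide[OF v(2) w(2)], of "i - j"]
        Q.power_int_unit_in_P_iff[OF Q(2) param_nz Q.unit_divide[OF v(3) w(3)], of "i - j"] by simp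
  qed (simp add: P.P_0 Q.P_0)
  then show ?thesis by blast
qed

text \<open>The point \<open>u\<close> is the residue of x, or infinity if x has a pole.\<close>

lemma rational_place_ratfun:
  assumes "rational_place ratfun_const P"
  shows "\<exists>u. param u \<in> P"
proof -
  interpret place ratfun_const P
    using assms by unfold_locales (simp add: rational_place_def)
  show ?thesis
  proof (cases "ratfun_var \<in> \<O>")
    case True
    then obtain k where "ratfun_var - ratfun_const k \<in> P" using assms unfolding rational_place_def by blast
    then have "param (Some k) \<in> P" by (simp add: param_def)
    then show ?thesis by blast
  next
    case False
    then have "param None \<in> P" using inverse_in_P by (simp add: param_def)
    then show ?thesis by blast
  qed
qed

lemma param_unique:
  assumes "place ratfun_const P" "param u \<in> P" "param u' \<in> P"
  shows "u = u'"
proof -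
  interpret place ratfun_const P by fact
  have *: False if "param None \<in> P" "param (Some \<alpha>) \<in> P" for \<alpha>
  proof -
    have "ratfun_var \<in> \<O>"
      using O_add[OF P_subset_O[OF that(2)] O_const[of \<alpha>]] by (simp add: param_def)
    then have "ratfun_var * inverse ratfun_var \<in> P" by (rule P_mult) (use that(1) in \<open>simp add: param_def\<close>)
    then show False using one_notin_P by simp
  qed
  have "\<alpha> = \<beta>" if "param (Some \<alpha>) \<in> P" "param (Some \<beta>) \<in> P" for \<alpha> \<beta>
  proof -
    have "ratfun_const (\<beta> - \<alpha>) \<in> P"
      using P_diff[OF that] by (simp add: param_def \<kappa>.hom_diff)
    then show ?thesis by simp
  qed
  then show ?thesis using assms(2,3) * by (cases u; cases u') blast+
qed

lemma card_rational_places_ratfun: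
  "card {P. rational_place (ratfun_const :: 'k::{field,finite} \<Rightarrow> _) P} = CARD('k) + 1"
proof -
  obtain \<Theta> :: "'k option \<Rightarrow> 'k ratfun \<Rightarrow> 'k fls" where \<Theta>: "\<And>u. hom_at u (\<Theta> u)"
    using ex_hom_at by metis
  have pl: "place ratfun_const P" if "rational_place ratfun_const P" for P :: "'k ratfun set"
    using that by unfold_locales (simp add: rational_place_def)
  note r = rational_place_hom_at[OF \<Theta>]
  have "inj (\<lambda>u. laurent_place (\<Theta> u))"
  proof (rule injI)
    fix u u' assume "laurent_place (\<Theta> u) = laurent_place (\<Theta> u')"
    then show "u = u'" using param_unique[OF pl[OF r(1)[of u]] r(2), of u'] r(2)[of u'] by simp
  qed
  moreover have "range (\<lambda>u. laurent_place (\<Theta> u)) = {P. rational_place ratfun_const P}"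
  proof safe
    fix P :: "'k ratfun set" assume P: "rational_place ratfun_const P"
    then obtain u where "param u \<in> P" using rational_place_ratfun by blast
    then have "P = laurent_place (\<Theta> u)" using place_eqI_param[OF pl[OF P] _ pl[OF r(1)] r(2)] by blast
    then show "P \<in> range (\<lambda>u. laurent_place (\<Theta> u))" by blast
  qed (use r in blast)
  ultimately have "card {P. rational_place (ratfun_const :: 'k \<Rightarrow> _) P} = CARD('k option)"
    by (metis card_image)
  then show ?thesis by (simp add: card_UNIV_option)
qed

section \<open>Splitting\<close>

lemma fps_compose_eq_ev:
  assumes "Z $ 0 = 0"
  shows "fps_to_fls (fps_of_poly T oo Z) = fls.ev (fps_to_fls Z) T"
proof (induction T)
  case (pCons a T)
  then show ?case
    by (simp add: fps_of_poly_pCons fps_compose_add_distrib fps_compose_mult_distrib[OF assms] assms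
        fls.ev_pCons fls_times_fps_to_fls mult.commute)
qed simp

text \<open>For linear \<open>T\<close> with \<open>T'(0) \<noteq> 0\<close> every root modulo the maximal ideal lifts: additivity
  reduces to the root \<open>0\<close>, where the compositional inverse of \<open>T\<close> gives the lift.\<close>

lemma ex_lift_root:
  fixes T :: "'k::field poly"
  assumes T: "linear_poly p T" "prime p" "CHAR('k) = p" "coeff T 1 \<noteq> 0" and \<beta>: "poly T \<beta> = s $ 0"
  shows "\<exists>Y. Y $ 0 = \<beta> \<and> fls.ev (fps_to_fls Y) T = fps_to_fls s"
proof -
  let ?T = "fps_of_poly T" and ?s = "s - fps_const (s $ 0)"
  have "poly T 0 = 0"
    using poly_linear_poly_add[OF T(1-3), of 0 0] by (metis add.right_neutral add_cancel_right_right)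
  then have T0: "?T $ 0 = 0" by (simp add: poly_0_coeff_0)
  have T1: "?T $ 1 \<noteq> 0" using T(4) by simp
  have inv0: "fps_inv ?T $ 0 = 0" by (simp add: fps_inv_def)
  define Z where "Z = fps_inv ?T oo ?s"
  have Z0: "Z $ 0 = 0" by (simp add: Z_def inv0)
  have "?T oo Z = ?T oo fps_inv ?T oo ?s"
    unfolding Z_def by (rule fps_compose_assoc) (simp_all add: inv0)
  also have "\<dots> = ?s" by (simp add: fps_inv_right[OF T0 T1])
  finally have Z: "fls.ev (fps_to_fls Z) T = fps_to_fls ?s"
    using fps_compose_eq_ev[OF Z0, of T] by simp
  \<comment> \<open>Additivity splits the equation: \<beta> accounts for the constant coefficient of
    \<open>s\<close>, and \<open>Z\<close> for the rest.\<close>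
  have "CHAR('k fls) = p" by (simp add: fls.CHAR_eq_hom T(3))
  then have "fls.ev (fps_to_fls (fps_const \<beta> + Z)) T = fls.ev (fls_const \<beta>) T + fls.ev (fps_to_fls Z) T"
    using fls.ev_linear_poly_add[OF T(1,2)] by simp
  also have "\<dots> = fps_to_fls s" by (simp add: Z fls.ev_hom \<beta>)
  finally show ?thesis using Z0 by (intro exI[of _ "fps_const \<beta> + Z"]) simp
qed

lemma (in linear_extension) places_over_laurent_place:
  fixes \<theta> :: "'f \<Rightarrow> 'k fls"
  assumes \<theta>: "field_hom \<theta>" "\<And>c. \<theta> (\<kappa> c) = fls_const c" "\<theta> z0 \<notin> range fps_to_fls"
    and s: "\<theta> f = fps_to_fls s" "card {\<beta>. poly T \<beta> = s $ 0} = degree T" and T1: "coeff T 1 \<noteq> 0"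
  defines "S \<equiv> {Q \<in> places (\<iota> \<circ> \<kappa>). \<iota> -` Q = laurent_place \<theta>}"
  shows "finite S" "card S = extension_degree \<iota>" "\<And>Q. Q \<in> S \<Longrightarrow> rational_place (\<iota> \<circ> \<kappa>) Q"
proof -
  let ?B = "{\<beta>. poly T \<beta> = s $ 0}"
  have \<theta>\<kappa>: "\<theta> \<circ> \<kappa> = fls_const" using \<theta>(2) by auto
  have "\<forall>\<beta>\<in>?B. \<exists>\<Phi>. field_hom \<Phi> \<and> (\<forall>a. \<Phi> (\<iota> a) = \<theta> a) \<and>
      (\<exists>Y. \<Phi> y = fps_to_fls Y \<and> Y $ 0 = \<beta>)"
  proof
    fix \<beta> assume \<beta>: "\<beta> \<in> ?B"
    obtain Y where Y: "Y $ 0 = \<beta>" "fls.ev (fps_to_fls Y) T = fps_to_fls s"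
      using ex_lift_root[OF T(1) p T1, of \<beta> s] \<beta> by blast
    have "poly (map_poly (\<theta> \<circ> \<kappa>) T) (fps_to_fls Y) = \<theta> f"
      using Y(2) s(1) by (simp add: \<theta>\<kappa> fls.ev_def)
    then show "\<exists>\<Phi>. field_hom \<Phi> \<and> (\<forall>a. \<Phi> (\<iota> a) = \<theta> a) \<and>
      (\<exists>Y. \<Phi> y = fps_to_fls Y \<and> Y $ 0 = \<beta>)"
      using ex_hom_generated[OF \<theta>(1)] Y(1) by blast
  qed
  then obtain \<Phi> where "\<forall>\<beta>\<in>?B. field_hom (\<Phi> \<beta>) \<and> (\<forall>a. \<Phi> \<beta> (\<iota> a) = \<theta> a) \<and>
      (\<exists>Y. \<Phi> \<beta> y = fps_to_fls Y \<and> Y $ 0 = \<beta>)"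
    by (rule bchoice[THEN exE])
  then have \<Phi>: "\<And>\<beta>. \<beta> \<in> ?B \<Longrightarrow> field_hom (\<Phi> \<beta>)"
    "\<And>\<beta> a. \<beta> \<in> ?B \<Longrightarrow> \<Phi> \<beta> (\<iota> a) = \<theta> a"
    "\<And>\<beta>. \<beta> \<in> ?B \<Longrightarrow> \<exists>Y. \<Phi> \<beta> y = fps_to_fls Y \<and> Y $ 0 = \<beta>"
    by blast+
  let ?Q = "\<lambda>\<beta>. laurent_place (\<Phi> \<beta>)"
  have rat: "rational_place (\<iota> \<circ> \<kappa>) (?Q \<beta>)" if "\<beta> \<in> ?B" for \<beta>
    using \<Phi>(1,2)[OF that] \<theta> by (intro rational_laurent_place[of _ _ "\<iota> z0"] \<iota>\<kappa>.field_hom_axioms) auto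
  have over: "?Q \<beta> \<in> S" if "\<beta> \<in> ?B" for \<beta>
    using rat[OF that] \<Phi>(2)[OF that] by (auto simp: S_def rational_place_def laurent_place_def)
  \<comment> \<open>The residue of \<open>y\<close> recovers \<beta>: if \<beta> and \<beta>' gave
    the same place, it would contain the constant \<beta> - \<beta>', which must then be 0.\<close>
  have mem: "y - (\<iota> \<circ> \<kappa>) \<beta> \<in> ?Q \<beta>" if \<beta>: "\<beta> \<in> ?B" for \<beta>
  proof -
    interpret \<Phi>: field_hom "\<Phi> \<beta>" using \<Phi>(1)[OF \<beta>] .
    obtain Y where Y: "\<Phi> \<beta> y = fps_to_fls Y" "Y $ 0 = \<beta>" using \<Phi>(3)[OF \<beta>] by blast
    have "\<Phi> \<beta> (y - (\<iota> \<circ> \<kappa>) \<beta>) = fps_to_fls (Y - fps_const \<beta>)"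
      by (simp add: \<Phi>.hom_diff \<Phi>(2)[OF \<beta>] \<theta>(2) Y(1))
    then show ?thesis by (rule laurent_placeI) (simp add: Y(2))
  qed
  have inj: "inj_on ?Q ?B"
  proof (rule inj_onI)
    fix \<beta> \<beta>' assume *: "\<beta> \<in> ?B" "\<beta>' \<in> ?B" "?Q \<beta> = ?Q \<beta>'"
    interpret Q: place "\<iota> \<circ> \<kappa>" "?Q \<beta>"
      using rat[OF *(1)] by unfold_locales (simp add: rational_place_def)
    have "(y - (\<iota> \<circ> \<kappa>) \<beta>') - (y - (\<iota> \<circ> \<kappa>) \<beta>) \<in> ?Q \<beta>"
      using Q.P_diff[OF _ mem[OF *(1)]] mem[OF *(2)] *(3) by metis
    then have "(\<iota> \<circ> \<kappa>) (\<beta> - \<beta>') \<in> ?Q \<beta>" by (simp add: \<iota>\<kappa>.hom_diff del: comp_apply)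
    then show "\<beta> = \<beta>'" by (simp del: comp_apply)
  qed
  interpret PO: places_over \<kappa> \<iota> "laurent_place \<theta>"
    using rational_laurent_place[OF \<kappa>.field_hom_axioms \<theta>] finite_ext
    by unfold_locales (simp_all add: rational_place_def)
  have S: "S = PO.Over" by (simp add: S_def PO.Over_def)
  show fin: "finite S" using PO.finite_Over S by simp
  have "card (?Q ` ?B) = degree T" using card_image[OF inj] s(2) by simp
  moreover have "card S \<le> degree T" using PO.card_Over_le S extension_degree_eq by simp
  \<comment> \<open>As the constructed places already reach the upper bound, every place in
    \<open>S\<close> comes from some \<beta>; this is what makes all of them rational.\<close>
  ultimately have eq: "?Q ` ?B = S" using over fin by (intro card_seteq) auto
  then show "card S = extension_degree \<iota>"
    using \<open>card (?Q ` ?B) = degree T\<close> extension_degree_eq by simp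
  show "rational_place (\<iota> \<circ> \<kappa>) Q" if "Q \<in> S" for Q using that eq rat by blast
qed

section \<open>Evaluating polynomials in several variables\<close>

text \<open>The target is only a ring, so that \<open>mpoly_const\<close> is covered: a shift of
  variables is itself an evaluation, with values in the polynomials.\<close>

locale coeff_hom =
  fixes \<kappa> :: "'k::field \<Rightarrow> 'r::comm_ring_1"
  assumes \<kappa>_1: "\<kappa> 1 = 1" and \<kappa>_add: "\<kappa> (a + b) = \<kappa> a + \<kappa> b" and \<kappa>_mult: "\<kappa> (a * b) = \<kappa> a * \<kappa> b"
begin

lemma \<kappa>_0: "\<kappa> 0 = 0"
  using \<kappa>_add[of 0 0] by (metis add.right_neutral add_cancel_right_right)

definition mon :: "(nat \<Rightarrow> 'r) \<Rightarrow> (nat \<Rightarrow>\<^sub>0 nat) \<Rightarrow> 'r" where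
  "mon v m = (\<Prod>i\<in>Poly_Mapping.keys m. v i ^ Poly_Mapping.lookup m i)"

lemma mon_superset:
  assumes "finite S" "Poly_Mapping.keys m \<subseteq> S"
  shows "mon v m = (\<Prod>i\<in>S. v i ^ Poly_Mapping.lookup m i)"
  unfolding mon_def using assms by (intro prod.mono_neutral_left) (auto simp: in_keys_iff \<kappa>_0)

lemma mon_add: "mon v (m + m') = mon v m * mon v m'"
proof -
  let ?S = "Poly_Mapping.keys m \<union> Poly_Mapping.keys m'"
  have "mon v (m + m') = (\<Prod>i\<in>?S. v i ^ Poly_Mapping.lookup (m + m') i)"
    by (intro mon_superset keys_add) auto
  then show ?thesis
    by (simp add: mon_superset[of ?S m] mon_superset[of ?S m'] lookup_add power_add prod.distrib)
qed

lemma eval_def: "mpoly_eval \<kappa> v A = (\<Sum>m\<in>Poly_Mapping.keys A. \<kappa> (Poly_Mapping.lookup A m) * mon v m)"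
  by (simp add: mpoly_eval_def mon_def)

lemma eval_superset:
  assumes "finite S" "Poly_Mapping.keys A \<subseteq> S"
  shows "mpoly_eval \<kappa> v A = (\<Sum>m\<in>S. \<kappa> (Poly_Mapping.lookup A m) * mon v m)"
  unfolding eval_def using assms by (intro sum.mono_neutral_left) (auto simp: in_keys_iff \<kappa>_0)

lemma eval_0 [simp]: "mpoly_eval \<kappa> v 0 = 0"
  by (simp add: eval_def)

lemma eval_add: "mpoly_eval \<kappa> v (A + B) = mpoly_eval \<kappa> v A + mpoly_eval \<kappa> v B"
proof -
  let ?S = "Poly_Mapping.keys A \<union> Poly_Mapping.keys B"
  have "mpoly_eval \<kappa> v (A + B) = (\<Sum>m\<in>?S. \<kappa> (Poly_Mapping.lookup (A + B) m) * mon v m)"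
    by (intro eval_superset keys_add) auto
  then show ?thesis
    by (simp add: eval_superset[of ?S A] eval_superset[of ?S B] lookup_add \<kappa>_add distrib_right sum.distrib)
qed

lemma eval_sum: "mpoly_eval \<kappa> v (sum G S) = (\<Sum>i\<in>S. mpoly_eval \<kappa> v (G i))"
  by (induction S rule: infinite_finite_induct) (simp_all add: eval_add)

lemma eval_single: "mpoly_eval \<kappa> v (Poly_Mapping.single m c) = \<kappa> c * mon v m"
  by (subst eval_superset[of "{m}"]) (auto simp: \<kappa>_0)

lemma sum_of_monomials:
  "A = (\<Sum>m\<in>Poly_Mapping.keys A. Poly_Mapping.single m (Poly_Mapping.lookup A m))"
proof (rule poly_mapping_eqI)
  fix m
  show "Poly_Mapping.lookup A m = Poly_Mapping.lookup
    (\<Sum>m\<in>Poly_Mapping.keys A. Poly_Mapping.single m (Poly_Mapping.lookup A m)) m"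
    by (cases "m \<in> Poly_Mapping.keys A")
      (auto simp: lookup_sum lookup_single when_def in_keys_iff intro!: sum.neutral[symmetric])
qed

lemma eval_mult: "mpoly_eval \<kappa> v (A * B) = mpoly_eval \<kappa> v A * mpoly_eval \<kappa> v B"
proof -
  let ?s = "\<lambda>A m. Poly_Mapping.single m (Poly_Mapping.lookup A m)"
  have "A * B = (\<Sum>m\<in>Poly_Mapping.keys A. ?s A m) * (\<Sum>m'\<in>Poly_Mapping.keys B. ?s B m')"
    using sum_of_monomials[of A] sum_of_monomials[of B] by simp
  also have "\<dots> = (\<Sum>m\<in>Poly_Mapping.keys A. \<Sum>m'\<in>Poly_Mapping.keys B. ?s A m * ?s B m')"
    by (rule sum_product)
  finally have "mpoly_eval \<kappa> v (A * B) =
    (\<Sum>m\<in>Poly_Mapping.keys A. \<Sum>m'\<in>Poly_Mapping.keys B.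
      (\<kappa> (Poly_Mapping.lookup A m) * mon v m) * (\<kappa> (Poly_Mapping.lookup B m') * mon v m'))"
    by (simp add: eval_sum mult_single eval_single \<kappa>_mult mon_add mult_ac)
  also have "\<dots> = mpoly_eval \<kappa> v A * mpoly_eval \<kappa> v B"
    unfolding eval_def by (rule sum_product[symmetric])
  finally show ?thesis .
qed

lemma eval_const [simp]: "mpoly_eval \<kappa> v (mpoly_const c) = \<kappa> c"
  by (simp add: mpoly_const_def eval_single mon_def)

lemma eval_var [simp]: "mpoly_eval \<kappa> v (mpoly_var i) = v i"
  by (simp add: mpoly_var_def eval_single mon_def \<kappa>_1)

lemma eval_1 [simp]: "mpoly_eval \<kappa> v 1 = 1"
  using eval_const[of v 1] by (simp add: mpoly_const_def \<kappa>_1)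

lemma eval_power: "mpoly_eval \<kappa> v (A ^ i) = mpoly_eval \<kappa> v A ^ i"
  by (induction i) (simp_all add: eval_mult)

lemma eval_prod: "mpoly_eval \<kappa> v (prod G S) = (\<Prod>i\<in>S. mpoly_eval \<kappa> v (G i))"
  by (induction S rule: infinite_finite_induct) (simp_all add: eval_mult)

lemma eval_cyclic_shift:
  "mpoly_eval \<kappa> v (cyclic_shift n A) = mpoly_eval \<kappa> (\<lambda>i. v (Suc i mod n)) A"
  unfolding cyclic_shift_def mpoly_eval_def[of mpoly_const]
  by (simp add: eval_sum eval_mult eval_prod eval_power) (simp add: mpoly_eval_def)

end

lemma mpoly_eval_cong:
  assumes "in_variables n A" "\<And>i. i < n \<Longrightarrow> v i = w i"
  shows "mpoly_eval \<kappa> v A = mpoly_eval \<kappa> w A"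
  unfolding mpoly_eval_def
proof (intro sum.cong prod.cong refl arg_cong2[where f = "(*)"])
  fix m i assume "m \<in> Poly_Mapping.keys A" "i \<in> Poly_Mapping.keys m"
  then have "i < n" using assms(1) unfolding in_variables_def by blast
  then show "v i ^ Poly_Mapping.lookup m i = w i ^ Poly_Mapping.lookup m i" using assms(2) by simp
qed

lemma mpoly_eval_hom:
  assumes "\<phi> 1 = 1" "\<phi> 0 = 0" "\<And>a b. \<phi> (a + b) = \<phi> a + \<phi> b" "\<And>a b. \<phi> (a * b) = \<phi> a * \<phi> b"
  shows "\<phi> (mpoly_eval \<kappa> v A) = mpoly_eval (\<lambda>c. \<phi> (\<kappa> c)) (\<lambda>i. \<phi> (v i)) A"
proof -
  have sum: "\<phi> (sum G S) = (\<Sum>i\<in>S. \<phi> (G i))" for G and S :: "(nat \<Rightarrow>\<^sub>0 nat) set"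
    by (induction S rule: infinite_finite_induct) (simp_all add: assms)
  have prod: "\<phi> (prod G S) = (\<Prod>i\<in>S. \<phi> (G i))" for G and S :: "nat set"
    by (induction S rule: infinite_finite_induct) (simp_all add: assms)
  have power: "\<phi> (a ^ i) = \<phi> a ^ i" for a i
    by (induction i) (simp_all add: assms)
  show ?thesis by (simp add: mpoly_eval_def sum prod power assms)
qed

lemma coeff_hom_mpoly_const: "coeff_hom mpoly_const"
  by unfold_locales (simp_all add: mpoly_const_def single_add mult_single)

lemma coeff_hom_id: "coeff_hom (\<lambda>c. c)"
  by unfold_locales simp_all

section \<open>Values of quasi-symmetric functions\<close>

text \<open>\<open>R\<close> may be given by different fractions at the generic point and at
  \<alpha>. A denominator that does not vanish at \<alpha> cannot vanish identically in x, so the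
  fraction chosen for \<alpha> also computes \<open>f\<close>.\<close>

lemma represents_value:
  fixes f :: "'k::field ratfun"
  assumes f: "has_value n ratfun_const (\<lambda>i. ratfun_var ^ (q ^ i)) R f"
    and w: "has_value n (\<lambda>c. c) (\<lambda>i. \<alpha> ^ (q ^ i)) R w"
  shows "\<exists>a b. f = Fract a b \<and> poly b \<alpha> \<noteq> 0 \<and> w = poly a \<alpha> / poly b \<alpha>"
proof -
  interpret coeff_hom "ratfun_const :: 'k \<Rightarrow> 'k ratfun"
    by unfold_locales (simp_all add: \<kappa>.hom_add \<kappa>.hom_mult)
  interpret i: coeff_hom "\<lambda>c::'k. c" by (rule coeff_hom_id)
  let ?x = "\<lambda>i. ratfun_var ^ (q ^ i) :: 'k ratfun"
  \<comment> \<open>Both evaluations factor through K[X]: first powers of X are substituted, then x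
    or \<alpha>.\<close>
  let ?e = "mpoly_eval (\<lambda>c. [:c:]) (\<lambda>i. [:0, 1:] ^ (q ^ i)) :: 'k mpoly \<Rightarrow> 'k poly"
  obtain A B where AB: "R = Fract A B" "mpoly_eval ratfun_const ?x B \<noteq> 0"
    "f = mpoly_eval ratfun_const ?x A / mpoly_eval ratfun_const ?x B"
    using f unfolding has_value_def by blast
  obtain C D where CD: "R = Fract C D" "mpoly_eval (\<lambda>c. c) (\<lambda>i. \<alpha> ^ (q ^ i)) D \<noteq> 0"
    "w = mpoly_eval (\<lambda>c. c) (\<lambda>i. \<alpha> ^ (q ^ i)) C / mpoly_eval (\<lambda>c. c) (\<lambda>i. \<alpha> ^ (q ^ i)) D"
    using w unfolding has_value_def by blast
  have "B \<noteq> 0" using AB(2) eval_0 by metis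
  have "D \<noteq> 0" using CD(2) i.eval_0 by metis
  have eq: "A * D = C * B" using AB(1) CD(1) \<open>B \<noteq> 0\<close> \<open>D \<noteq> 0\<close> by (simp add: eq_fract)
  have ev: "mpoly_eval ratfun_const ?x G = \<kappa>.ev ratfun_var (?e G)" for G
    by (subst mpoly_eval_hom[of "\<kappa>.ev ratfun_var"]) (simp_all add: \<kappa>.ev_add \<kappa>.ev_mult \<kappa>.ev_power)
  have po: "mpoly_eval (\<lambda>c. c) (\<lambda>i. \<alpha> ^ (q ^ i)) G = poly (?e G) \<alpha>" for G
    by (subst mpoly_eval_hom[of "\<lambda>a. poly a \<alpha>"]) (simp_all add: poly_power)
  have D: "poly (?e D) \<alpha> \<noteq> 0" using CD(2) by (simp add: po)
  then have D': "mpoly_eval ratfun_const ?x D \<noteq> 0" by (auto simp: ev)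
  have "mpoly_eval ratfun_const ?x A * mpoly_eval ratfun_const ?x D
    = mpoly_eval ratfun_const ?x C * mpoly_eval ratfun_const ?x B"
    using eq by (simp flip: eval_mult)
  then have "f = mpoly_eval ratfun_const ?x C / mpoly_eval ratfun_const ?x D"
    unfolding AB(3) frac_eq_eq[OF AB(2) D'] .
  then have "f = Fract (?e C) (?e D)" by (simp add: ev Fract_eq_ev)
  then show ?thesis using D CD(3) po by metis
qed

text \<open>The \<open>q\<close>-th power map on \<open>K\<close> permutes the coordinates of \<open>(\<alpha>, \<alpha>\<^sup>q, \<dots>)\<close> cyclically.\<close>

lemma quasi_symmetric_value:
  fixes \<alpha> :: "'k::field"
  assumes qs: "quasi_symmetric n R" and \<alpha>: "\<alpha> ^ (q ^ n) = \<alpha>" and n: "n > 0"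
    and w: "has_value n (\<lambda>c. c) (\<lambda>i. \<alpha> ^ (q ^ i)) R w"
    and w': "has_value n (\<lambda>c. c) (\<lambda>i. (\<alpha> ^ q) ^ (q ^ i)) R w'"
  shows "w = w'"
proof -
  interpret i: coeff_hom "\<lambda>c::'k. c" by (rule coeff_hom_id)
  interpret c: coeff_hom "mpoly_const :: 'k \<Rightarrow> 'k mpoly" by (rule coeff_hom_mpoly_const)
  let ?e = "mpoly_eval (\<lambda>c. c) (\<lambda>i. \<alpha> ^ (q ^ i))" and ?e' = "mpoly_eval (\<lambda>c. c) (\<lambda>i. (\<alpha> ^ q) ^ (q ^ i))"
  have sh: "cyclic_shift n (G * H) = cyclic_shift n G * cyclic_shift n H" for G H :: "'k mpoly"
    by (simp add: cyclic_shift_def c.eval_mult)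
  have e': "?e (cyclic_shift n G) = ?e' G" if "in_variables n G" for G :: "'k mpoly"
    unfolding i.eval_cyclic_shift
  proof (rule mpoly_eval_cong[OF that])
    fix j assume "j < n"
    show "\<alpha> ^ q ^ (Suc j mod n) = (\<alpha> ^ q) ^ q ^ j"
    \<comment> \<open>At the last index the shift wraps around to the coordinate \<alpha>, which is
      \<alpha>^(q^n) by assumption.\<close>
    proof (cases "Suc j = n")
      case True
      have "(\<alpha> ^ q) ^ q ^ j = \<alpha>" using \<alpha> unfolding True[symmetric] power_Suc power_mult .
      moreover have "Suc j mod n = 0" using True by simp
      ultimately show ?thesis by (simp only: power_0 power_one_right)
    next
      case False
      then show ?thesis using \<open>j < n\<close> by (simp add: power_mult)
    qed
  qed
  obtain A B where AB: "R = Fract A B" "B \<noteq> 0" "Fract (cyclic_shift n A) (cyclic_shift n B) = R"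
    using qs unfolding quasi_symmetric_def by blast
  obtain C D where CD: "R = Fract C D" "?e D \<noteq> 0" "w = ?e C / ?e D"
    using w unfolding has_value_def by blast
  obtain C' D' where CD': "in_variables n C'" "in_variables n D'" "R = Fract C' D'" "?e' D' \<noteq> 0"
    "w' = ?e' C' / ?e' D'"
    using w' unfolding has_value_def by blast
  have nz: "D \<noteq> 0" "D' \<noteq> 0" using CD(2) CD'(4) i.eval_0 by metis+
  show ?thesis
  \<comment> \<open>With the convention \<open>Fract _ 0 = 0\<close> this case forces R = 0, and
    both values vanish.\<close>
  proof (cases "cyclic_shift n B = 0")
    case True
    then have "R = 0" using AB(3) by (simp add: fract_collapse)
    then have "C = 0" "C' = 0" using CD(1) CD'(3) nz by (simp_all add: Zero_fract_def eq_fract)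
    then show ?thesis using CD(3) CD'(5) by simp
  next
    case False
    \<comment> \<open>Quasi-symmetry is known for the fraction A/B only; cross-multiplication
      transfers it to C'/D', whose denominator is nonzero at the point of \<alpha>^q.\<close>
    have "A * D' = C' * B" using AB CD' nz by (simp add: eq_fract)
    then have 1: "cyclic_shift n A * cyclic_shift n D' = cyclic_shift n C' * cyclic_shift n B"
      by (simp flip: sh)
    have sD': "cyclic_shift n D' \<noteq> 0" using e'[OF CD'(2)] CD'(4) by auto
    then have "R = Fract (cyclic_shift n C') (cyclic_shift n D')"
      using 1 False AB(3) by (metis eq_fract(1))
    then have "C * cyclic_shift n D' = cyclic_shift n C' * D"
      using CD(1) nz sD' by (simp add: eq_fract)
    then have "?e C * ?e' D' = ?e' C' * ?e D"
      using e' CD' by (metis i.eval_mult)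
    then show ?thesis unfolding CD(3) CD'(5) frac_eq_eq[OF CD(2) CD'(4)] .
  qed
qed

lemma (in field_hom) map_poly_hom_mult: "map_poly \<iota> (a * b) = map_poly \<iota> a * map_poly \<iota> b"
  by (rule poly_eqI) (simp add: coeff_map_poly coeff_mult hom_sum hom_mult)

text \<open>Raising coefficients to the power \<open>q\<close> fixes a fraction u/v with
  coefficients in F_q. Since \<open>v\<close> may vanish at the points in question, the comparison
  is made by cross-multiplying polynomials, and \<open>v\<close> is cancelled before
  evaluation.\<close>

lemma value_Frobenius:
  fixes \<alpha> :: "'k::field"
  assumes frob: "field_hom (\<lambda>c::'k. c ^ q)" and f: "coeffs_in_Fq q f"
    and ab: "f = Fract a b" "poly b \<alpha> \<noteq> 0" and cd: "f = Fract c d" "poly d (\<alpha> ^ q) \<noteq> 0"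
  shows "(poly a \<alpha> / poly b \<alpha>) ^ q = poly c (\<alpha> ^ q) / poly d (\<alpha> ^ q)"
proof -
  interpret \<sigma>: field_hom "\<lambda>c::'k. c ^ q" by (rule frob)
  let ?\<sigma> = "map_poly (\<lambda>c::'k. c ^ q)"
  have \<sigma>: "poly (?\<sigma> r) (\<alpha> ^ q) = poly r \<alpha> ^ q" for r
    using \<sigma>.ev_hom[of \<alpha> r] by (simp add: \<sigma>.ev_def)
  obtain u v where uv: "v \<noteq> 0" "f = Fract u v" "\<And>i. coeff u i \<in> Fq q" "\<And>i. coeff v i \<in> Fq q"
    using f unfolding coeffs_in_Fq_def by blast
  have fixed: "?\<sigma> u = u" "?\<sigma> v = v"
    using uv(3,4) by (auto intro!: poly_eqI simp: coeff_map_poly Fq_def)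
  have nz: "b \<noteq> 0" "d \<noteq> 0" using ab cd by auto
  have "a * v = u * b" using ab uv nz by (simp add: eq_fract)
  then have 1: "?\<sigma> a * v = u * ?\<sigma> b" using fixed by (metis \<sigma>.map_poly_hom_mult)
  have 2: "c * v = u * d" using cd uv nz by (simp add: eq_fract)
  have "v * (?\<sigma> a * d) = v * (c * ?\<sigma> b)"
    using 1 2 by (metis mult.assoc mult.commute)
  then have "?\<sigma> a * d = c * ?\<sigma> b" using uv(1) by simp
  then have "poly (?\<sigma> a) (\<alpha> ^ q) * poly d (\<alpha> ^ q) = poly c (\<alpha> ^ q) * poly (?\<sigma> b) (\<alpha> ^ q)"
    by (simp flip: poly_mult)
  then show ?thesis using ab(2) cd(2) by (simp add: \<sigma> field_simps)
qed

text \<open>The value at \<alpha>^q is computed twice: it is the value at \<alpha> by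
  quasi-symmetry, and its \<open>q\<close>-th power because the coefficients lie in F_q.\<close>

lemma Fqs_phi_value:
  fixes f :: "'k::field ratfun" and \<alpha> :: 'k
  assumes frob: "field_hom (\<lambda>c::'k. c ^ q)" and \<alpha>: "\<alpha> ^ (q ^ n) = \<alpha>" and n: "n > 0"
    and f: "f \<in> Fqs_phi n q" "nq_regular n q f"
  shows "\<exists>a b. f = Fract a b \<and> poly b \<alpha> \<noteq> 0 \<and> (poly a \<alpha> / poly b \<alpha>) ^ q = poly a \<alpha> / poly b \<alpha>"
proof -
  obtain R where R: "nq_represents n q R f"
    and reg: "\<And>\<alpha>. \<exists>w. has_value n (\<lambda>c. c) (\<lambda>i. \<alpha> ^ (q ^ i)) R w"
    using f(2) unfolding nq_regular_def by blast
  note R' = R[unfolded nq_represents_def]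
  obtain w where w: "has_value n (\<lambda>c. c) (\<lambda>i. \<alpha> ^ (q ^ i)) R w" using reg by blast
  obtain w' where w': "has_value n (\<lambda>c. c) (\<lambda>i. (\<alpha> ^ q) ^ (q ^ i)) R w'" using reg by blast
  obtain a b where ab: "f = Fract a b" "poly b \<alpha> \<noteq> 0" "w = poly a \<alpha> / poly b \<alpha>"
    using represents_value[OF conjunct2[OF R'] w] by blast
  obtain c d where cd: "f = Fract c d" "poly d (\<alpha> ^ q) \<noteq> 0" "w' = poly c (\<alpha> ^ q) / poly d (\<alpha> ^ q)"
    using represents_value[OF conjunct2[OF R'] w'] by blast
  have "w = w'" using quasi_symmetric_value[OF conjunct1[OF R'] \<alpha> n w w'] .
  moreover have "w ^ q = w'"
    using value_Frobenius[OF frob _ ab(1,2) cd(1,2)] f(1) ab(3) cd(3) by (simp add: Fqs_phi_def)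
  ultimately show ?thesis using ab by blast
qed

section \<open>Expansion of h/g at the points of the projective line\<close>

lemma ratfun_degree_Fract:
  assumes "a \<noteq> 0" "b \<noteq> 0"
  shows "ratfun_degree (Fract a b) = int (degree a) - int (degree b)"
proof -
  have "Fract a b \<noteq> 0" using assms by (simp add: Zero_fract_def eq_fract)
  moreover have "(THE d. \<exists>a' b'. a' \<noteq> 0 \<and> b' \<noteq> 0 \<and> Fract a b = Fract a' b' \<and>
      d = int (degree a') - int (degree b')) = int (degree a) - int (degree b)"
  proof (rule the_equality)
    fix d assume "\<exists>a' b'. a' \<noteq> 0 \<and> b' \<noteq> 0 \<and> Fract a b = Fract a' b' \<and>
      d = int (degree a') - int (degree b')"
    then obtain a' b' where *: "a' \<noteq> 0" "b' \<noteq> 0" "Fract a b = Fract a' b'"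
      "d = int (degree a') - int (degree b')" by blast
    then have "a * b' = a' * b" using assms by (simp add: eq_fract)
    then have "degree a + degree b' = degree a' + degree b"
      using assms * by (metis degree_mult_eq)
    then show "d = int (degree a) - int (degree b)" using *(4) by linarith
  qed (use assms in blast)
  ultimately show ?thesis by (simp add: ratfun_degree_def)
qed

text \<open>The order at infinity is the degree of the denominator minus that of the
  numerator.\<close>

lemma hom_at_None_degree_neg:
  assumes "hom_at None \<Theta>" and hg: "h \<noteq> 0" "g \<noteq> 0" "ratfun_degree h < ratfun_degree g"
  shows "\<exists>s. \<Theta> (h / g) = fps_to_fls s \<and> s $ 0 = 0"
proof -
  obtain a b c d where h: "h = Fract a b" "b \<noteq> 0" and g: "g = Fract c d" "d \<noteq> 0"
    by (metis Fract_cases)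
  have nz: "a \<noteq> 0" "c \<noteq> 0" using hg h g by (auto simp: fract_collapse)
  have deg: "degree a + degree d < degree b + degree c"
    using hg(3) h g nz by (simp add: ratfun_degree_Fract)
  have "\<Theta> (h / g) = fls.ev fls_X_inv (a * d) / fls.ev fls_X_inv (b * c)"
    using assms(1) h g nz by (simp add: hom_at_def)
  moreover have "a * d \<noteq> 0" "b * c \<noteq> 0" using h g nz by auto
  note subdegree_ev_fls_X_inv[OF this(1)] subdegree_ev_fls_X_inv[OF this(2)]
  ultimately have "fls_subdegree (\<Theta> (h / g)) = int (degree (b * c)) - int (degree (a * d))"
    by (simp add: fls_divide_subdegree)
  also have "\<dots> > 0" using deg h g nz by (simp add: degree_mult_eq)
  finally show ?thesis by (subst fls_subdegree_pos_iff[symmetric]) blast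
qed

text \<open>The expansion of \<open>b\<close> has constant coefficient b(\<alpha>) \<noteq> 0, so it
  is invertible as a power series.\<close>

lemma hom_at_Some_value:
  assumes "hom_at (Some \<alpha>) \<Theta>" and b: "poly b \<alpha> \<noteq> 0"
  shows "\<exists>s. \<Theta> (Fract a b) = fps_to_fls s \<and> s $ 0 = poly a \<alpha> / poly b \<alpha>"
proof -
  let ?F = "\<lambda>a. fps_of_poly (pcompose a [:\<alpha>, 1:])"
  have F0: "?F r $ 0 = poly r \<alpha>" for r
    by (simp add: poly_pcompose flip: poly_0_coeff_0)
  have "b \<noteq> 0" using b by auto
  then have "\<Theta> (Fract a b) = fps_to_fls (?F a) / fps_to_fls (?F b)"
    using assms(1) by (simp add: hom_at_def Let_def ev_fls_X_plus_const)
  also have "\<dots> = fps_to_fls (?F a * inverse (?F b))"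
  proof -
    have "?F b * inverse (?F b) = 1" using F0[of b] b by (simp add: inverse_mult_eq_1')
    then have "fps_to_fls (?F b) * fps_to_fls (inverse (?F b)) = 1"
      by (simp flip: fls_times_fps_to_fls)
    then have "inverse (fps_to_fls (?F b)) = fps_to_fls (inverse (?F b))" by (rule inverse_unique)
    then show ?thesis by (simp add: divide_inverse fls_times_fps_to_fls)
  qed
  finally show ?thesis using F0 by (intro exI[of _ "?F a * inverse (?F b)"]) (simp add: divide_inverse)
qed

section \<open>The theorem\<close>

text \<open>On a field with q^n elements its values are the traces to F_q.\<close>

definition trace_poly :: "nat \<Rightarrow> nat \<Rightarrow> 'k::field poly" where
  "trace_poly q n = (\<Sum>i<n. monom 1 (q ^ i))"

lemma coeff_trace_poly:
  assumes "q > 1" "i < n"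
  shows "coeff (trace_poly q n) (q ^ i) = 1"
proof -
  have "coeff (trace_poly q n) (q ^ i) = (\<Sum>j<n. if j = i then 1 else 0)"
    unfolding trace_poly_def coeff_sum
    using assms by (intro sum.cong) (auto simp: power_inject_exp)
  then show ?thesis using assms by simp
qed

lemma degree_trace_poly:
  assumes "q > 1" "n > 0"
  shows "degree (trace_poly q n) = q ^ (n - 1)"
proof (rule antisym)
  show "degree (trace_poly q n) \<le> q ^ (n - 1)"
    unfolding trace_poly_def using assms
    by (intro degree_sum_le) (auto intro!: order.trans[OF degree_monom_le] power_increasing)
  show "q ^ (n - 1) \<le> degree (trace_poly q n)"
    using assms by (intro le_degree) (simp add: coeff_trace_poly)
qed

lemma linear_trace_poly:
  assumes "p > 1"
  shows "linear_poly p (trace_poly (p ^ k) n)"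
  using assms
  by (auto simp: linear_poly_iff trace_poly_def coeff_sum simp flip: power_mult
      elim!: sum.not_neutral_contains_not_neutral split: if_splits)

lemma (in field_hom) ev_trace_poly: "ev y (trace_poly q n) = (\<Sum>i<n. y ^ (q ^ i))"
  by (simp add: trace_poly_def ev_sum ev_monom)

theorem theorem4p3:
  fixes p k q n :: nat
    and h g :: "'k::{field,finite} ratfun"
    and \<iota> :: "'k ratfun \<Rightarrow> 'e::field" and y :: 'e
    and \<iota>' :: "'k ratfun \<Rightarrow> 'm::field"
  assumes "prime p" and "k \<ge> 1" and "q = p ^ k" and "n > 1"
    and "CARD('k) = q ^ n"
    and "h \<in> Fqs_phi n q" and "g \<in> Fqs_phi n q"
    and "nq_regular n q h" and "nq_regular n q g"
    and "\<not> (\<exists>(L :: 'k poly) r. linear_poly p L \<and> degree L > 1 \<and>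
              h / g = poly (map_poly ratfun_const L) r)"
    and "ratfun_degree g > ratfun_degree h"
    and "\<forall>\<alpha>. \<not> has_zero_at g \<alpha>"
    and "field_embedding \<iota>"
    and "(\<Sum>i<n. y ^ (q ^ i)) = \<iota> (h / g)"
    and "adjoin \<iota> y = UNIV"
  shows "(\<forall>P \<in> rational_places (ratfun_const :: 'k \<Rightarrow> 'k ratfun).
            splits_completely ratfun_const \<iota> P) \<and>
         num_rational_places (\<iota> \<circ> ratfun_const) = q ^ (n - 1) * (q ^ n + 1) \<and>
         real (num_rational_places (\<iota> \<circ> ratfun_const)) / real (extension_degree \<iota>)
           = real (q ^ n + 1) \<and>
         (field_embedding \<iota>' \<and> finite_extension \<iota>' \<longrightarrow>
            finite (rational_places (\<iota>' \<circ> ratfun_const)) \<and>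
            real (num_rational_places (\<iota>' \<circ> ratfun_const)) / real (extension_degree \<iota>')
              \<le> real (q ^ n + 1))"
proof -
  have p1: "p > 1" using \<open>prime p\<close> by (rule prime_gt_1_nat)
  have q1: "q > 1" unfolding \<open>q = p ^ k\<close> using p1 \<open>k \<ge> 1\<close> by (intro one_less_power) auto
  have n0: "n > 0" using \<open>n > 1\<close> by simp
  have char: "CHAR('k) = p"
    using \<open>CARD('k) = q ^ n\<close> \<open>q = p ^ k\<close>
    by (intro CHAR_eq_prime_if_card[OF \<open>prime p\<close>, of "k * n"]) (simp add: power_mult)
  let ?T = "trace_poly q n :: 'k poly"
  let ?f = "h / g"
  have poly_T: "poly ?T v = (\<Sum>i<n. v ^ (q ^ i))" for v
    by (simp add: trace_poly_def poly_sum poly_monom)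
  have fibre: "card {v. poly ?T v = c} = degree ?T" if "c ^ q = c" for c
    using trace_fibre_card[OF assms(1,3,2,4,5) that] q1 n0 by (simp add: poly_T degree_trace_poly)
  have linT: "linear_poly p ?T" unfolding \<open>q = p ^ k\<close> using p1 by (rule linear_trace_poly)
  \<comment> \<open>This is the derivative of the trace polynomial at 0; that it is nonzero allows
    roots to be lifted to power series.\<close>
  have T1: "coeff ?T 1 \<noteq> 0" using coeff_trace_poly[OF q1 n0, where 'a='k] by simp
  interpret \<iota>: field_hom \<iota> using \<open>field_embedding \<iota>\<close> by (rule field_hom.intro)
  interpret linear_extension ratfun_const \<iota> p ?T ?f y
  proof unfold_locales
    show "lead_coeff ?T = 1" using coeff_trace_poly[OF q1, of "n - 1" n] n0 q1 by (simp add: degree_trace_poly)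
    show "card {v. poly ?T v = 0} = degree ?T" using q1 by (intro fibre) simp
    interpret \<iota>\<kappa>: field_hom "\<iota> \<circ> (ratfun_const :: 'k \<Rightarrow> _)"
      by (rule field_hom_comp[OF field_hom_ratfun_const \<iota>.field_hom_axioms])
    show "poly (map_poly (\<iota> \<circ> ratfun_const) ?T) y = \<iota> ?f"
      using \<iota>\<kappa>.ev_trace_poly[of y q n] assms(14) by (simp only: \<iota>\<kappa>.ev_def)
    show "\<not> (\<exists>L r. linear_poly p L \<and> degree L > 1 \<and> ?f = poly (map_poly ratfun_const L) r)"
      using assms(10) by blast
  qed (use assms char linT in auto)
  have deg: "extension_degree \<iota> = q ^ (n - 1)"
    using extension_degree_eq q1 n0 by (simp add: degree_trace_poly)
  \<comment> \<open>0 is the value of the linear polynomial X^p at 0, so it is excluded as an image.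
    This matters because \<open>ratfun_degree\<close> is a mere convention at 0.\<close>
  have "?f \<noteq> 0"
  proof
    assume "?f = 0"
    have "linear_poly p (monom (1::'k) p)"
      unfolding linear_poly_iff[OF p1] by (auto intro: exI[of _ 1])
    moreover have "degree (monom (1::'k) p) > 1" using p1 by (simp add: degree_monom_eq)
    moreover have "?f = poly (map_poly ratfun_const (monom (1::'k) p)) 0"
      unfolding \<open>?f = 0\<close> using p1 by (simp add: map_poly_monom poly_monom)
    ultimately show False using assms(10) by blast
  qed
  then have hg: "h \<noteq> 0" "g \<noteq> 0" by auto
  have frob: "field_hom (\<lambda>c::'k. c ^ q)"
    using freshmans_dream'[of q k, where 'a='k] char \<open>prime p\<close> \<open>q = p ^ k\<close>
    by unfold_locales (auto simp: field_embedding_def power_mult_distrib)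
  \<comment> \<open>At every point of the projective line h/g has no pole and its value lies in F_q,
    where the fibres of the trace have full size.\<close>
  have expand: "\<exists>s. \<Theta> ?f = fps_to_fls s \<and> (s $ 0) ^ q = s $ 0" if \<Theta>: "hom_at u \<Theta>" for u \<Theta>
  proof (cases u)
    case None
    then obtain s where "\<Theta> ?f = fps_to_fls s" "s $ 0 = 0"
      using hom_at_None_degree_neg[of \<Theta> h g] \<Theta> hg assms(11) by blast
    then show ?thesis using q1 by auto
  next
    case (Some \<alpha>)
    have \<alpha>: "\<alpha> ^ (q ^ n) = \<alpha>" using power_card_UNIV[of \<alpha>] \<open>CARD('k) = q ^ n\<close> by simp
    obtain a b where ab: "h = Fract a b" "poly b \<alpha> \<noteq> 0" "(poly a \<alpha> / poly b \<alpha>) ^ q = poly a \<alpha> / poly b \<alpha>"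
      using Fqs_phi_value[OF frob \<alpha> n0 assms(6,8)] by blast
    obtain c d where cd: "g = Fract c d" "poly d \<alpha> \<noteq> 0" "(poly c \<alpha> / poly d \<alpha>) ^ q = poly c \<alpha> / poly d \<alpha>"
      using Fqs_phi_value[OF frob \<alpha> n0 assms(7,9)] by blast
    \<comment> \<open>\<open>d\<close> does not vanish at \<alpha>, so a root of \<open>c\<close>
      there would be a zero of \<open>g\<close>.\<close>
    have c: "poly c \<alpha> \<noteq> 0" using assms(12) cd(1,2) unfolding has_zero_at_def by blast
    have f: "?f = Fract (a * d) (b * c)" by (simp add: ab(1) cd(1))
    have "poly (b * c) \<alpha> \<noteq> 0" using ab(2) c by simp
    then obtain s where s: "\<Theta> ?f = fps_to_fls s" "s $ 0 = poly (a * d) \<alpha> / poly (b * c) \<alpha>"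
      using hom_at_Some_value[of \<alpha> \<Theta> "b * c" "a * d"] \<Theta> unfolding f Some by blast
    have "s $ 0 = (poly a \<alpha> / poly b \<alpha>) / (poly c \<alpha> / poly d \<alpha>)" by (simp add: s(2))
    then have "(s $ 0) ^ q = s $ 0" using ab(3) cd(3) by (simp only: power_divide[of "_ / _" "_ / _"])
    then show ?thesis using s(1) by blast
  qed
  let ?S = "\<lambda>P. {Q \<in> places (\<iota> \<circ> ratfun_const). \<iota> -` Q = P}"
  have split: "finite (?S P) \<and> card (?S P) = extension_degree \<iota> \<and>
      (\<forall>Q\<in>?S P. rational_place (\<iota> \<circ> ratfun_const) Q)"
    if P: "rational_place (ratfun_const :: 'k \<Rightarrow> _) P" for P
  proof -
    obtain u where u: "param u \<in> P" using rational_place_ratfun[OF P] by blast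
    obtain \<Theta> where \<Theta>: "hom_at u \<Theta>" using ex_hom_at by blast
    note r = rational_place_hom_at[OF \<Theta>]
    have pl: "place ratfun_const P'" if "rational_place ratfun_const P'" for P' :: "'k ratfun set"
      using that by unfold_locales (simp add: rational_place_def)
    have P': "P = laurent_place \<Theta>" using place_eqI_param[OF pl[OF P] u pl[OF r(1)] r(2)] .
    obtain z where z: "\<Theta> z \<notin> range fps_to_fls" using r(3) by blast
    obtain s where s: "\<Theta> ?f = fps_to_fls s" "(s $ 0) ^ q = s $ 0" using expand[OF \<Theta>] by blast
    have hom: "field_hom \<Theta>" "\<And>c. \<Theta> (ratfun_const c) = fls_const c" using \<Theta> by (simp_all add: hom_at_def)
    show ?thesis
      unfolding P' using places_over_laurent_place[OF hom z s(1) fibre[OF s(2)] T1] by blast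
  qed
  let ?R = "{P. rational_place (ratfun_const :: 'k \<Rightarrow> _) P}"
  have cardR: "card ?R = q ^ n + 1" using card_rational_places_ratfun[where 'k='k] assms(5) by simp
  then have finR: "finite ?R" by (intro card_ge_0_finite) simp
  have ratF: "rational_places (ratfun_const :: 'k \<Rightarrow> _) = ?R"
    by (rule rational_places_eq[OF field_hom_ratfun_const])
  have complete: "splits_completely ratfun_const \<iota> P" if "P \<in> ?R" for P
  proof -
    have P: "rational_place ratfun_const P" using that by simp
    have "{Q \<in> places (\<iota> \<circ> ratfun_const). lies_over \<iota> Q P} = ?S P"
      using lies_over_iff[OF field_hom_ratfun_const \<iota>.field_hom_axioms finite_ext P] by blast
    then show ?thesis using split[OF P] finite_ext by (simp add: splits_completely_def)
  qed
  have "rational_places (\<iota> \<circ> ratfun_const) = (\<Union>P\<in>?R. ?S P)"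
    unfolding rational_places_eq[OF \<iota>\<kappa>.field_hom_axioms]
  proof (intro equalityI subsetI)
    fix Q assume "Q \<in> {Q. rational_place (\<iota> \<circ> (ratfun_const :: 'k \<Rightarrow> _)) Q}"
    then show "Q \<in> (\<Union>P\<in>?R. ?S P)"
      using rational_place_restrict[OF field_hom_ratfun_const \<iota>.field_hom_axioms finite_ext, of Q]
      by (auto simp: rational_place_def)
  qed (use split in blast)
  then have "num_rational_places (\<iota> \<circ> (ratfun_const :: 'k \<Rightarrow> _)) = card (\<Union>P\<in>?R. ?S P)"
    by (simp add: num_rational_places_def)
  also have "\<dots> = (\<Sum>P\<in>?R. card (?S P))"
    using split finR by (intro card_UN_disjoint) auto
  also have "\<dots> = card ?R * extension_degree \<iota>" using split by simp
  finally have num: "num_rational_places (\<iota> \<circ> (ratfun_const :: 'k \<Rightarrow> _)) = q ^ (n - 1) * (q ^ n + 1)"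
    by (simp add: cardR deg)
  \<comment> \<open>A rational place of the larger field restricts to one of the q^n + 1 rational
    places of K(x), and over each of these lie at most as many places as the degree.\<close>
  have bound: "finite (rational_places (\<iota>' \<circ> ratfun_const)) \<and>
      num_rational_places (\<iota>' \<circ> ratfun_const) \<le> (q ^ n + 1) * extension_degree \<iota>'"
    if "field_embedding \<iota>'" and ext': "finite_extension \<iota>'"
  proof -
    interpret \<iota>': field_hom \<iota>' using that(1) by (rule field_hom.intro)
    let ?S' = "\<lambda>P. {Q \<in> places (\<iota>' \<circ> ratfun_const). \<iota>' -` Q = P}"
    have over: "finite (?S' P) \<and> card (?S' P) \<le> extension_degree \<iota>'" if "P \<in> ?R" for P
    proof -
      interpret places_over ratfun_const \<iota>' P
        using that ext' by unfold_locales (simp_all add: rational_place_def)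
      show ?thesis using finite_Over card_Over_le by (simp add: Over_def)
    qed
    have sub: "rational_places (\<iota>' \<circ> ratfun_const) \<subseteq> (\<Union>P\<in>?R. ?S' P)"
      unfolding rational_places_eq[OF field_hom_comp[OF field_hom_ratfun_const \<iota>'.field_hom_axioms]]
      using rational_place_restrict[OF field_hom_ratfun_const \<iota>'.field_hom_axioms ext']
      by (auto simp: rational_place_def)
    have fin: "finite (\<Union>P\<in>?R. ?S' P)" using finR over by blast
    have "num_rational_places (\<iota>' \<circ> ratfun_const) \<le> card (\<Union>P\<in>?R. ?S' P)"
      unfolding num_rational_places_def by (rule card_mono[OF fin sub])
    also have "\<dots> \<le> (\<Sum>P\<in>?R. card (?S' P))" by (rule card_UN_le[OF finR])
    also have "\<dots> \<le> card ?R * extension_degree \<iota>'"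
      using over sum_bounded_above[of ?R "\<lambda>P. card (?S' P)" "extension_degree \<iota>'"] by simp
    finally show ?thesis using finite_subset[OF sub fin] cardR by simp
  qed
  \<comment> \<open>The case \<open>d = 0\<close> is settled by the convention that division by 0
    gives 0.\<close>
  have ratio: "real a / real d \<le> real c" if "a \<le> c * d" for a c d :: nat
  proof (cases "d = 0")
    case False
    have "real a \<le> real c * real d" using that by (simp flip: of_nat_mult)
    then show ?thesis using False by (simp add: field_simps)
  qed simp
  show ?thesis
  proof (intro conjI impI ballI)
    show "splits_completely ratfun_const \<iota> P" if "P \<in> rational_places ratfun_const" for P
      using that complete unfolding ratF by blast
    show "num_rational_places (\<iota> \<circ> (ratfun_const :: 'k \<Rightarrow> _)) = q ^ (n - 1) * (q ^ n + 1)" by (rule num)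
    have "real (q ^ (n - 1)) \<noteq> 0" using q1 by simp
    then show "real (num_rational_places (\<iota> \<circ> (ratfun_const :: 'k \<Rightarrow> _))) / real (extension_degree \<iota>)
        = real (q ^ n + 1)"
      unfolding num deg of_nat_mult by (rule nonzero_mult_div_cancel_left)
    assume "field_embedding \<iota>' \<and> finite_extension \<iota>'"
    then show "finite (rational_places (\<iota>' \<circ> ratfun_const))"
      and "real (num_rational_places (\<iota>' \<circ> ratfun_const)) / real (extension_degree \<iota>')
        \<le> real (q ^ n + 1)"
      using bound ratio by blast+
  qed
qed

end
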